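(* Let $\mathbb F$ be a field of characteristic $p>0$ and let $A$ be a divided power algebra over $\mathbb F$. There is a one-to-one correspondence between vector fields over $A$ in the algebraic tangent structure and special inner derivations of $A$, and likewise a one-to-one correspondence between vector fields over $A$ in the geometric tangent structure and special inner derivations of $A$.
   Context: Divided power algebras. A divided power algebra over $\mathbb F$ is a commutative associative non-unital $\mathbb F$-algebra $(A,* )$ (product also written by concatenation) with functions $a\mapsto a^{[n]}$, $A\to A$, for all integers $n\ge1$, such that for all $a,b\in A$, $\lambda\in\mathbb F$: $(\lambda a)^{[n]}=\lambda^na^{[n]}$; $a^{[m]}*a^{[n]}=\binom{m+n}{m}a^{[m+n]}$; $(a+b)^{[n]}=a^{[n]}+\sum_{l=1}^{n-1}a^{[l]}*b^{[n-l]}+b^{[n]}$; $a^{[1]}=a$; $(a*b)^{[n]}=n!\,a^{[n]}*b^{[n]}=a^{*n}*b^{[n]}=a^{[n]}*b^{*n}$; $(a^{[n]})^{[m]}=\frac{(mn)!}{m!(n!)^m}a^{[mn]}$. Morphisms are algebra morphisms commuting with all $(-)^{[n]}$. $U(A)$ is the underlying commutative (non-unital) algebra of $A$; modules over it are in the non-unital sense. In characteristic $p>0$, a divided power structure is determined by its $p$-th operation. Special inner derivations. A special inner derivation of $A$ is an $\mathbb F$-linear map $D:A\to A$ with $D(ab)=aD(b)+bD(a)$ and $D(a^{[p]})=-a^{p-1}D(a)$ for all $a,b\in A$. Vector fields in the algebraic tangent structure. $\mathsf TA=A\ltimes_pA$ is the divided power algebra on $A\oplus A$ with product $(a,b)*(a',b')=(aa',ab'+a'b)$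 and $p$-th divided power $(a,b)^{[p]}=(a^{[p]},-a^{p-1}b)$; the projection is $p_A:\mathsf TA\to A$, $p_A(a,b)=a$. A vector field over $A$ is a morphism of divided power algebras $v:A\to\mathsf TA$ with $p_Av=\mathrm{id}_A$. Vector fields in the geometric tangent structure (on the opposite category of divided power algebras). A divided power $A$-algebra is a morphism $f:A\to B$ of divided power algebras; the functor sending it to the $U(A)$-module $B$ has a left adjoint $M\mapsto\Gamma_A^+(M)$. $\Omega_{U(A)}$ is the module of Kähler differentials of $U(A)$, i.e. the quotient of the free $U(A)$-module on symbols $\mathsf da$, $a\in A$, by $\mathsf d(a+\lambda b)=\mathsf da+\lambda\,\mathsf db$, $\mathsf d(ab)=a\,\mathsf db+b\,\mathsf da$; $\Omega^1_A$ is its quotient by the submodule generated by the elements $\mathsf d(a^{[n]})-a^{[n-1]}\mathsf da$, $n\ge2$. Set $\mathsf T^\circ A=\Gamma_A^+(\Omega^1_A)$, with structural morphism $p_A^\circ:A\to\mathsf T^\circ A$, $p^\circ_A(a)=a$. The projection of the geometric tangent structure is the opposite of $p^\circ_A$, so a vector field over $A$ is a section of it in the opposite category, i.e. a morphism of divided power algebras $v:\mathsf T^\circ A\to A$ with $v\,p^\circ_A=\mathrm{id}_A$. *)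

theory Defs
  imports "HOL-Algebra.AbelCoset" "HOL-Algebra.Module" "HOL-Algebra.Multiplicative_Group"
    "HOL-Number_Theory.Residues"
begin

text \<open>
  All algebras are carrier-based records extending the module record of HOL-Algebra. That record
  has a field \<^const>\<open>one\<close> (and, for modules, \<^const>\<open>monoid.mult\<close>); nothing below depends on it, in
  particular algebras are not assumed to have a unit.
\<close>

section \<open>Divided power algebras\<close>

definition characteristic :: "('f, 'k) ring_scheme \<Rightarrow> nat" where
  "characteristic F = group.ord (add_monoid F) \<one>\<^bsub>F\<^esub>"

text \<open>The power \<open>a * \<dots> * a\<close> with \<open>n \<ge> 1\<close> factors. The library power operation starts from
  \<^const>\<open>one\<close>, so it cannot be used here.\<close>

fun npow :: "('a, 'k) monoid_scheme \<Rightarrow> 'a \<Rightarrow> nat \<Rightarrow> 'a" where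
  "npow A a (Suc 0) = a"
| "npow A a (Suc (Suc n)) = a \<otimes>\<^bsub>A\<^esub> npow A a (Suc n)"

locale comm_nonunital_algebra = module F A + F: field F
  for F (structure) and A (structure) +
  assumes mult_closed [simp, intro]:
      "\<lbrakk>a \<in> carrier A; b \<in> carrier A\<rbrakk> \<Longrightarrow> a \<otimes>\<^bsub>A\<^esub> b \<in> carrier A"
    and mult_assoc:
      "\<lbrakk>a \<in> carrier A; b \<in> carrier A; c \<in> carrier A\<rbrakk> \<Longrightarrow>
        (a \<otimes>\<^bsub>A\<^esub> b) \<otimes>\<^bsub>A\<^esub> c = a \<otimes>\<^bsub>A\<^esub> (b \<otimes>\<^bsub>A\<^esub> c)"
    and mult_comm:
      "\<lbrakk>a \<in> carrier A; b \<in> carrier A\<rbrakk> \<Longrightarrow> a \<otimes>\<^bsub>A\<^esub> b = b \<otimes>\<^bsub>A\<^esub> a"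
    and mult_add_left:
      "\<lbrakk>a \<in> carrier A; b \<in> carrier A; c \<in> carrier A\<rbrakk> \<Longrightarrow>
        (a \<oplus>\<^bsub>A\<^esub> b) \<otimes>\<^bsub>A\<^esub> c = a \<otimes>\<^bsub>A\<^esub> c \<oplus>\<^bsub>A\<^esub> b \<otimes>\<^bsub>A\<^esub> c"
    and mult_smult_left:
      "\<lbrakk>r \<in> carrier F; a \<in> carrier A; b \<in> carrier A\<rbrakk> \<Longrightarrow>
        (r \<odot>\<^bsub>A\<^esub> a) \<otimes>\<^bsub>A\<^esub> b = r \<odot>\<^bsub>A\<^esub> (a \<otimes>\<^bsub>A\<^esub> b)"

text \<open>\<open>\<gamma>\<^bsub>A\<^esub> n a\<close> is the divided power \<open>a\<^sup>[\<^sup>n\<^sup>]\<close>; its value at \<open>n = 0\<close> is irrelevant.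
  In \<open>dp_dp\<close> the division of natural numbers is exact.\<close>

record ('f, 'a) dp_algebra = "('f, 'a) module" +
  dp :: "nat \<Rightarrow> 'a \<Rightarrow> 'a" (\<open>\<gamma>\<index>\<close>)

locale divided_power_algebra = comm_nonunital_algebra F A
  for F :: "('f, 'k) ring_scheme" (structure) and A :: "('f, 'a, 'u) dp_algebra_scheme" (structure) +
  assumes dp_closed [simp, intro]:
      "\<lbrakk>n \<ge> 1; a \<in> carrier A\<rbrakk> \<Longrightarrow> \<gamma>\<^bsub>A\<^esub> n a \<in> carrier A"
    and dp_smult:
      "\<lbrakk>n \<ge> 1; r \<in> carrier F; a \<in> carrier A\<rbrakk> \<Longrightarrow>
        \<gamma>\<^bsub>A\<^esub> n (r \<odot>\<^bsub>A\<^esub> a) = (r [^]\<^bsub>F\<^esub> n) \<odot>\<^bsub>A\<^esub> \<gamma>\<^bsub>A\<^esub> n a"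
    and dp_mult:
      "\<lbrakk>m \<ge> 1; n \<ge> 1; a \<in> carrier A\<rbrakk> \<Longrightarrow>
        \<gamma>\<^bsub>A\<^esub> m a \<otimes>\<^bsub>A\<^esub> \<gamma>\<^bsub>A\<^esub> n a = [((m + n) choose m)] \<cdot>\<^bsub>A\<^esub> (\<gamma>\<^bsub>A\<^esub> (m + n) a)"
    and dp_add:
      "\<lbrakk>n \<ge> 1; a \<in> carrier A; b \<in> carrier A\<rbrakk> \<Longrightarrow>
        \<gamma>\<^bsub>A\<^esub> n (a \<oplus>\<^bsub>A\<^esub> b) =
          \<gamma>\<^bsub>A\<^esub> n a \<oplus>\<^bsub>A\<^esub> (\<Oplus>\<^bsub>A\<^esub>l\<in>{1..n-1}. \<gamma>\<^bsub>A\<^esub> l a \<otimes>\<^bsub>A\<^esub> \<gamma>\<^bsub>A\<^esub> (n - l) b) \<oplus>\<^bsub>A\<^esub> \<gamma>\<^bsub>A\<^esub> n b"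
    and dp_one:
      "a \<in> carrier A \<Longrightarrow> \<gamma>\<^bsub>A\<^esub> 1 a = a"
    and dp_prod:
      "\<lbrakk>n \<ge> 1; a \<in> carrier A; b \<in> carrier A\<rbrakk> \<Longrightarrow>
        \<gamma>\<^bsub>A\<^esub> n (a \<otimes>\<^bsub>A\<^esub> b) = [(fact n :: nat)] \<cdot>\<^bsub>A\<^esub> (\<gamma>\<^bsub>A\<^esub> n a \<otimes>\<^bsub>A\<^esub> \<gamma>\<^bsub>A\<^esub> n b)"
    and dp_prod_left:
      "\<lbrakk>n \<ge> 1; a \<in> carrier A; b \<in> carrier A\<rbrakk> \<Longrightarrow>
        \<gamma>\<^bsub>A\<^esub> n (a \<otimes>\<^bsub>A\<^esub> b) = npow A a n \<otimes>\<^bsub>A\<^esub> \<gamma>\<^bsub>A\<^esub> n b"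
    and dp_prod_right:
      "\<lbrakk>n \<ge> 1; a \<in> carrier A; b \<in> carrier A\<rbrakk> \<Longrightarrow>
        \<gamma>\<^bsub>A\<^esub> n (a \<otimes>\<^bsub>A\<^esub> b) = \<gamma>\<^bsub>A\<^esub> n a \<otimes>\<^bsub>A\<^esub> npow A b n"
    and dp_dp:
      "\<lbrakk>m \<ge> 1; n \<ge> 1; a \<in> carrier A\<rbrakk> \<Longrightarrow>
        \<gamma>\<^bsub>A\<^esub> m (\<gamma>\<^bsub>A\<^esub> n a) = [(fact (m * n) div (fact m * fact n ^ m) :: nat)] \<cdot>\<^bsub>A\<^esub> (\<gamma>\<^bsub>A\<^esub> (m * n) a)"

definition dp_hom ::
  "('f, 'k) ring_scheme \<Rightarrow> ('f, 'a, 'u) dp_algebra_scheme \<Rightarrow> ('f, 'b, 'v) dp_algebra_scheme \<Rightarrow>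
    ('a \<Rightarrow> 'b) set" where
  "dp_hom F A B = {h \<in> carrier A \<rightarrow> carrier B.
     (\<forall>a\<in>carrier A. \<forall>b\<in>carrier A. h (a \<oplus>\<^bsub>A\<^esub> b) = h a \<oplus>\<^bsub>B\<^esub> h b) \<and>
     (\<forall>r\<in>carrier F. \<forall>a\<in>carrier A. h (r \<odot>\<^bsub>A\<^esub> a) = r \<odot>\<^bsub>B\<^esub> h a) \<and>
     (\<forall>a\<in>carrier A. \<forall>b\<in>carrier A. h (a \<otimes>\<^bsub>A\<^esub> b) = h a \<otimes>\<^bsub>B\<^esub> h b) \<and>
     (\<forall>n\<ge>1. \<forall>a\<in>carrier A. h (\<gamma>\<^bsub>A\<^esub> n a) = \<gamma>\<^bsub>B\<^esub> n (h a))}"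


section \<open>Special inner derivations\<close>

text \<open>Maps out of a carrier are normalised outside it by \<^const>\<open>extensional\<close>, so that equality of
  functions is equality of maps.\<close>

definition special_inner_derivations ::
  "nat \<Rightarrow> ('f, 'k) ring_scheme \<Rightarrow> ('f, 'a, 'u) dp_algebra_scheme \<Rightarrow> ('a \<Rightarrow> 'a) set" where
  "special_inner_derivations p F A = {D \<in> carrier A \<rightarrow>\<^sub>E carrier A.
     (\<forall>a\<in>carrier A. \<forall>b\<in>carrier A. D (a \<oplus>\<^bsub>A\<^esub> b) = D a \<oplus>\<^bsub>A\<^esub> D b) \<and>
     (\<forall>r\<in>carrier F. \<forall>a\<in>carrier A. D (r \<odot>\<^bsub>A\<^esub> a) = r \<odot>\<^bsub>A\<^esub> D a) \<and>
     (\<forall>a\<in>carrier A. \<forall>b\<in>carrier A. D (a \<otimes>\<^bsub>A\<^esub> b) = a \<otimes>\<^bsub>A\<^esub> D b \<oplus>\<^bsub>A\<^esub> b \<otimes>\<^bsub>A\<^esub> D a) \<and>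
     (\<forall>a\<in>carrier A. D (\<gamma>\<^bsub>A\<^esub> p a) = \<ominus>\<^bsub>A\<^esub> (npow A a (p - 1) \<otimes>\<^bsub>A\<^esub> D a))}"


section \<open>The algebraic tangent structure\<close>

definition square_zero_ext ::
  "('f, 'a, 'u) dp_algebra_scheme \<Rightarrow> (nat \<Rightarrow> 'a \<times> 'a \<Rightarrow> 'a \<times> 'a) \<Rightarrow> ('f, 'a \<times> 'a) dp_algebra" where
  "square_zero_ext A g =
    \<lparr>carrier = carrier A \<times> carrier A,
     monoid.mult = (\<lambda>(a, b) (a', b'). (a \<otimes>\<^bsub>A\<^esub> a', a \<otimes>\<^bsub>A\<^esub> b' \<oplus>\<^bsub>A\<^esub> a' \<otimes>\<^bsub>A\<^esub> b)),
     one = undefined,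
     zero = (\<zero>\<^bsub>A\<^esub>, \<zero>\<^bsub>A\<^esub>),
     add = (\<lambda>(a, b) (a', b'). (a \<oplus>\<^bsub>A\<^esub> a', b \<oplus>\<^bsub>A\<^esub> b')),
     smult = (\<lambda>r (a, b). (r \<odot>\<^bsub>A\<^esub> a, r \<odot>\<^bsub>A\<^esub> b)),
     dp = g\<rparr>"

text \<open>The divided power structure on \<open>A \<oplus> A\<close> is specified by its \<open>p\<close>-th operation. It exists, and
  it is unique on the carrier in degrees \<open>n \<ge> 1\<close>: see \<open>dp_determined\<close> and \<open>tangent_dpa\<close> below.\<close>

definition tangent ::
  "nat \<Rightarrow> ('f, 'k) ring_scheme \<Rightarrow> ('f, 'a, 'u) dp_algebra_scheme \<Rightarrow> ('f, 'a \<times> 'a) dp_algebra" where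
  "tangent p F A = square_zero_ext A (SOME g.
     divided_power_algebra F (square_zero_ext A g) \<and>
     (\<forall>a\<in>carrier A. \<forall>b\<in>carrier A. g p (a, b) = (\<gamma>\<^bsub>A\<^esub> p a, \<ominus>\<^bsub>A\<^esub> (npow A a (p - 1) \<otimes>\<^bsub>A\<^esub> b))))"

definition algebraic_vector_fields ::
  "nat \<Rightarrow> ('f, 'k) ring_scheme \<Rightarrow> ('f, 'a, 'u) dp_algebra_scheme \<Rightarrow> ('a \<Rightarrow> 'a \<times> 'a) set" where
  "algebraic_vector_fields p F A =
    {v \<in> dp_hom F A (tangent p F A) \<inter> extensional (carrier A). \<forall>a\<in>carrier A. fst (v a) = a}"


section \<open>Modules over a non-unital algebra\<close>

text \<open>A module is an \<open>F\<close>-vector space with an \<open>F\<close>-bilinear associative action.\<close>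

record ('f, 'a, 'm) act_module = "('f, 'm) module" +
  act :: "'a \<Rightarrow> 'm \<Rightarrow> 'm" (infixr \<open>\<triangleright>\<index>\<close> 70)

locale nonunital_module = A: comm_nonunital_algebra F A + M: module F M
  for F :: "('f, 'k) ring_scheme" (structure) and A :: "('f, 'a, 'u) module_scheme" (structure)
    and M :: "('f, 'a, 'm, 'v) act_module_scheme" (structure) +
  assumes act_closed [simp, intro]:
      "\<lbrakk>a \<in> carrier A; x \<in> carrier M\<rbrakk> \<Longrightarrow> a \<triangleright>\<^bsub>M\<^esub> x \<in> carrier M"
    and act_add_left:
      "\<lbrakk>a \<in> carrier A; b \<in> carrier A; x \<in> carrier M\<rbrakk> \<Longrightarrow>
        (a \<oplus>\<^bsub>A\<^esub> b) \<triangleright>\<^bsub>M\<^esub> x = (a \<triangleright>\<^bsub>M\<^esub> x) \<oplus>\<^bsub>M\<^esub> (b \<triangleright>\<^bsub>M\<^esub> x)"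
    and act_add_right:
      "\<lbrakk>a \<in> carrier A; x \<in> carrier M; y \<in> carrier M\<rbrakk> \<Longrightarrow>
        a \<triangleright>\<^bsub>M\<^esub> (x \<oplus>\<^bsub>M\<^esub> y) = (a \<triangleright>\<^bsub>M\<^esub> x) \<oplus>\<^bsub>M\<^esub> (a \<triangleright>\<^bsub>M\<^esub> y)"
    and act_smult_left:
      "\<lbrakk>r \<in> carrier F; a \<in> carrier A; x \<in> carrier M\<rbrakk> \<Longrightarrow>
        (r \<odot>\<^bsub>A\<^esub> a) \<triangleright>\<^bsub>M\<^esub> x = r \<odot>\<^bsub>M\<^esub> (a \<triangleright>\<^bsub>M\<^esub> x)"
    and act_smult_right:
      "\<lbrakk>r \<in> carrier F; a \<in> carrier A; x \<in> carrier M\<rbrakk> \<Longrightarrow>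
        a \<triangleright>\<^bsub>M\<^esub> (r \<odot>\<^bsub>M\<^esub> x) = r \<odot>\<^bsub>M\<^esub> (a \<triangleright>\<^bsub>M\<^esub> x)"
    and act_assoc:
      "\<lbrakk>a \<in> carrier A; b \<in> carrier A; x \<in> carrier M\<rbrakk> \<Longrightarrow>
        (a \<otimes>\<^bsub>A\<^esub> b) \<triangleright>\<^bsub>M\<^esub> x = a \<triangleright>\<^bsub>M\<^esub> (b \<triangleright>\<^bsub>M\<^esub> x)"

text \<open>In the non-unital sense the free module on one generator \<open>e\<close> is \<open>F e \<oplus> A e\<close>, since \<open>e\<close> itself
  is not a multiple of \<open>e\<close> by an element of \<open>A\<close>. So a coefficient is a pair \<open>(r, a)\<close>, standing for
  \<open>r e + a e\<close>.\<close>

definition free_act_module ::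
  "('f, 'k) ring_scheme \<Rightarrow> ('f, 'a, 'u) module_scheme \<Rightarrow> 's set \<Rightarrow>
    ('f, 'a, 's \<Rightarrow> 'f \<times> 'a) act_module" where
  "free_act_module F A S =
    \<lparr>carrier = {u \<in> UNIV \<rightarrow> carrier F \<times> carrier A.
       (\<forall>s. s \<notin> S \<longrightarrow> u s = (\<zero>\<^bsub>F\<^esub>, \<zero>\<^bsub>A\<^esub>)) \<and> finite {s. u s \<noteq> (\<zero>\<^bsub>F\<^esub>, \<zero>\<^bsub>A\<^esub>)}},
     monoid.mult = undefined,
     one = undefined,
     zero = (\<lambda>s. (\<zero>\<^bsub>F\<^esub>, \<zero>\<^bsub>A\<^esub>)),
     add = (\<lambda>u v s. (fst (u s) \<oplus>\<^bsub>F\<^esub> fst (v s), snd (u s) \<oplus>\<^bsub>A\<^esub> snd (v s))),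
     smult = (\<lambda>r u s. (r \<otimes>\<^bsub>F\<^esub> fst (u s), r \<odot>\<^bsub>A\<^esub> snd (u s))),
     act = (\<lambda>a u s. (\<zero>\<^bsub>F\<^esub>, (fst (u s) \<odot>\<^bsub>A\<^esub> a) \<oplus>\<^bsub>A\<^esub> (a \<otimes>\<^bsub>A\<^esub> snd (u s))))\<rparr>"

definition free_gen ::
  "('f, 'k) ring_scheme \<Rightarrow> ('f, 'a, 'u) module_scheme \<Rightarrow> 's \<Rightarrow> 's \<Rightarrow> 'f \<times> 'a" where
  "free_gen F A s = (\<lambda>t. if t = s then (\<one>\<^bsub>F\<^esub>, \<zero>\<^bsub>A\<^esub>) else (\<zero>\<^bsub>F\<^esub>, \<zero>\<^bsub>A\<^esub>))"

definition act_submodule ::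
  "('f, 'k) ring_scheme \<Rightarrow> ('f, 'a, 'u) module_scheme \<Rightarrow> ('f, 'a, 'm, 'v) act_module_scheme \<Rightarrow>
    'm set \<Rightarrow> bool" where
  "act_submodule F A M N \<longleftrightarrow> submodule N F M \<and> (\<forall>a\<in>carrier A. \<forall>x\<in>N. a \<triangleright>\<^bsub>M\<^esub> x \<in> N)"

definition generated_submodule ::
  "('f, 'k) ring_scheme \<Rightarrow> ('f, 'a, 'u) module_scheme \<Rightarrow> ('f, 'a, 'm, 'v) act_module_scheme \<Rightarrow>
    'm set \<Rightarrow> 'm set" where
  "generated_submodule F A M S = \<Inter>{N. act_submodule F A M N \<and> S \<subseteq> N}"

definition quotient_module ::
  "('f, 'a, 'm, 'v) act_module_scheme \<Rightarrow> 'm set \<Rightarrow> ('f, 'a, 'm set) act_module" where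
  "quotient_module M N =
    \<lparr>carrier = a_rcosets\<^bsub>M\<^esub> N,
     monoid.mult = undefined,
     one = undefined,
     zero = N,
     add = (\<lambda>X Y. X <+>\<^bsub>M\<^esub> Y),
     smult = (\<lambda>r X. \<Union>x\<in>X. N +>\<^bsub>M\<^esub> (r \<odot>\<^bsub>M\<^esub> x)),
     act = (\<lambda>a X. \<Union>x\<in>X. N +>\<^bsub>M\<^esub> (a \<triangleright>\<^bsub>M\<^esub> x))\<rparr>"


section \<open>Differentials\<close>

definition kahler_relations ::
  "('f, 'k) ring_scheme \<Rightarrow> ('f, 'a, 'u) module_scheme \<Rightarrow> ('a \<Rightarrow> 'f \<times> 'a) set" where
  "kahler_relations F A = (let L = free_act_module F A (carrier A); d = free_gen F A in
     {d (a \<oplus>\<^bsub>A\<^esub> r \<odot>\<^bsub>A\<^esub> b) \<ominus>\<^bsub>L\<^esub> (d a \<oplus>\<^bsub>L\<^esub> r \<odot>\<^bsub>L\<^esub> d b) |a b r.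
        a \<in> carrier A \<and> b \<in> carrier A \<and> r \<in> carrier F} \<union>
     {d (a \<otimes>\<^bsub>A\<^esub> b) \<ominus>\<^bsub>L\<^esub> ((a \<triangleright>\<^bsub>L\<^esub> d b) \<oplus>\<^bsub>L\<^esub> (b \<triangleright>\<^bsub>L\<^esub> d a)) |a b.
        a \<in> carrier A \<and> b \<in> carrier A})"

definition kahler_submodule ::
  "('f, 'k) ring_scheme \<Rightarrow> ('f, 'a, 'u) module_scheme \<Rightarrow> ('a \<Rightarrow> 'f \<times> 'a) set" where
  "kahler_submodule F A =
    generated_submodule F A (free_act_module F A (carrier A)) (kahler_relations F A)"

definition kahler ::
  "('f, 'k) ring_scheme \<Rightarrow> ('f, 'a, 'u) module_scheme \<Rightarrow>
    ('f, 'a, ('a \<Rightarrow> 'f \<times> 'a) set) act_module" where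
  "kahler F A = quotient_module (free_act_module F A (carrier A)) (kahler_submodule F A)"

definition kahler_d ::
  "('f, 'k) ring_scheme \<Rightarrow> ('f, 'a, 'u) module_scheme \<Rightarrow> 'a \<Rightarrow> ('a \<Rightarrow> 'f \<times> 'a) set" where
  "kahler_d F A a =
    kahler_submodule F A +>\<^bsub>free_act_module F A (carrier A)\<^esub> free_gen F A a"

definition omega_submodule ::
  "('f, 'k) ring_scheme \<Rightarrow> ('f, 'a, 'u) dp_algebra_scheme \<Rightarrow> ('a \<Rightarrow> 'f \<times> 'a) set set" where
  "omega_submodule F A = generated_submodule F A (kahler F A)
     {kahler_d F A (\<gamma>\<^bsub>A\<^esub> n a) \<ominus>\<^bsub>kahler F A\<^esub> (\<gamma>\<^bsub>A\<^esub> (n - 1) a \<triangleright>\<^bsub>kahler F A\<^esub> kahler_d F A a) |n a.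
        2 \<le> n \<and> a \<in> carrier A}"

definition omega ::
  "('f, 'k) ring_scheme \<Rightarrow> ('f, 'a, 'u) dp_algebra_scheme \<Rightarrow>
    ('f, 'a, ('a \<Rightarrow> 'f \<times> 'a) set set) act_module" where
  "omega F A = quotient_module (kahler F A) (omega_submodule F A)"

definition omega_d ::
  "('f, 'k) ring_scheme \<Rightarrow> ('f, 'a, 'u) dp_algebra_scheme \<Rightarrow> 'a \<Rightarrow>
    ('a \<Rightarrow> 'f \<times> 'a) set set" where
  "omega_d F A a = omega_submodule F A +>\<^bsub>kahler F A\<^esub> kahler_d F A a"


section \<open>The divided power \<open>A\<close>-algebra generated by a module\<close>

text \<open>\<open>\<Gamma>\<^sub>A\<^sup>+(M)\<close> is constructed by generators and relations: formal expressions in elements of \<open>A\<close> and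
  \<open>M\<close>, modulo the least congruence that imposes the laws of divided power algebras, makes
  \<open>GBase\<close> a morphism of divided power algebras and \<open>GGen\<close> a morphism of modules. The adjunction is
  proved in \<open>gamma_universal\<close> below.\<close>

datatype ('f, 'a, 'm) gterm =
    GBase 'a
  | GGen 'm
  | GZero
  | GAdd "('f, 'a, 'm) gterm" "('f, 'a, 'm) gterm"
  | GSmult 'f "('f, 'a, 'm) gterm"
  | GMult "('f, 'a, 'm) gterm" "('f, 'a, 'm) gterm"
  | GDp nat "('f, 'a, 'm) gterm"

inductive_set gterms ::
  "('f, 'k) ring_scheme \<Rightarrow> ('f, 'a, 'u) dp_algebra_scheme \<Rightarrow> ('f, 'a, 'm, 'v) act_module_scheme \<Rightarrow>
    ('f, 'a, 'm) gterm set"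
  for F :: "('f, 'k) ring_scheme" and A :: "('f, 'a, 'u) dp_algebra_scheme"
    and M :: "('f, 'a, 'm, 'v) act_module_scheme" where
  term_base: "a \<in> carrier A \<Longrightarrow> GBase a \<in> gterms F A M"
| term_gen: "x \<in> carrier M \<Longrightarrow> GGen x \<in> gterms F A M"
| term_zero: "GZero \<in> gterms F A M"
| term_add: "\<lbrakk>s \<in> gterms F A M; t \<in> gterms F A M\<rbrakk> \<Longrightarrow> GAdd s t \<in> gterms F A M"
| term_smult: "\<lbrakk>r \<in> carrier F; t \<in> gterms F A M\<rbrakk> \<Longrightarrow> GSmult r t \<in> gterms F A M"
| term_mult: "\<lbrakk>s \<in> gterms F A M; t \<in> gterms F A M\<rbrakk> \<Longrightarrow> GMult s t \<in> gterms F A M"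
| term_dp: "\<lbrakk>n \<ge> 1; t \<in> gterms F A M\<rbrakk> \<Longrightarrow> GDp n t \<in> gterms F A M"

text \<open>The sum of \<open>f l\<close> over \<open>1 \<le> l \<le> k\<close>, the multiple \<open>k t\<close> and the power with \<open>n \<ge> 1\<close> factors.\<close>

primrec gsum :: "(nat \<Rightarrow> ('f, 'a, 'm) gterm) \<Rightarrow> nat \<Rightarrow> ('f, 'a, 'm) gterm" where
  "gsum f 0 = GZero"
| "gsum f (Suc k) = GAdd (gsum f k) (f (Suc k))"

definition gnat :: "nat \<Rightarrow> ('f, 'a, 'm) gterm \<Rightarrow> ('f, 'a, 'm) gterm" where
  "gnat k t = gsum (\<lambda>_. t) k"

fun gpow :: "('f, 'a, 'm) gterm \<Rightarrow> nat \<Rightarrow> ('f, 'a, 'm) gterm" where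
  "gpow t (Suc 0) = t"
| "gpow t (Suc (Suc n)) = GMult t (gpow t (Suc n))"

inductive gamma_eq ::
  "('f, 'k) ring_scheme \<Rightarrow> ('f, 'a, 'u) dp_algebra_scheme \<Rightarrow> ('f, 'a, 'm, 'v) act_module_scheme \<Rightarrow>
    ('f, 'a, 'm) gterm \<Rightarrow> ('f, 'a, 'm) gterm \<Rightarrow> bool"
  for F :: "('f, 'k) ring_scheme" and A :: "('f, 'a, 'u) dp_algebra_scheme"
    and M :: "('f, 'a, 'm, 'v) act_module_scheme" where
  gam_refl: "t \<in> gterms F A M \<Longrightarrow> gamma_eq F A M t t"
| gam_sym: "gamma_eq F A M s t \<Longrightarrow> gamma_eq F A M t s"
| gam_trans: "\<lbrakk>gamma_eq F A M s t; gamma_eq F A M t u\<rbrakk> \<Longrightarrow> gamma_eq F A M s u"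
| gam_cong_add: "\<lbrakk>gamma_eq F A M s s'; gamma_eq F A M t t'\<rbrakk> \<Longrightarrow> gamma_eq F A M (GAdd s t) (GAdd s' t')"
| gam_cong_smult: "\<lbrakk>r \<in> carrier F; gamma_eq F A M t t'\<rbrakk> \<Longrightarrow> gamma_eq F A M (GSmult r t) (GSmult r t')"
| gam_cong_mult: "\<lbrakk>gamma_eq F A M s s'; gamma_eq F A M t t'\<rbrakk> \<Longrightarrow> gamma_eq F A M (GMult s t) (GMult s' t')"
| gam_cong_dp: "\<lbrakk>n \<ge> 1; gamma_eq F A M t t'\<rbrakk> \<Longrightarrow> gamma_eq F A M (GDp n t) (GDp n t')"
| gam_add_assoc: "\<lbrakk>s \<in> gterms F A M; t \<in> gterms F A M; u \<in> gterms F A M\<rbrakk> \<Longrightarrow>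
    gamma_eq F A M (GAdd (GAdd s t) u) (GAdd s (GAdd t u))"
| gam_add_comm: "\<lbrakk>s \<in> gterms F A M; t \<in> gterms F A M\<rbrakk> \<Longrightarrow> gamma_eq F A M (GAdd s t) (GAdd t s)"
| gam_add_zero: "t \<in> gterms F A M \<Longrightarrow> gamma_eq F A M (GAdd GZero t) t"
| gam_add_neg: "t \<in> gterms F A M \<Longrightarrow> gamma_eq F A M (GAdd (GSmult (\<ominus>\<^bsub>F\<^esub> \<one>\<^bsub>F\<^esub>) t) t) GZero"
| gam_smult_add_left: "\<lbrakk>r \<in> carrier F; r' \<in> carrier F; t \<in> gterms F A M\<rbrakk> \<Longrightarrow>
    gamma_eq F A M (GSmult (r \<oplus>\<^bsub>F\<^esub> r') t) (GAdd (GSmult r t) (GSmult r' t))"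
| gam_smult_add_right: "\<lbrakk>r \<in> carrier F; s \<in> gterms F A M; t \<in> gterms F A M\<rbrakk> \<Longrightarrow>
    gamma_eq F A M (GSmult r (GAdd s t)) (GAdd (GSmult r s) (GSmult r t))"
| gam_smult_assoc: "\<lbrakk>r \<in> carrier F; r' \<in> carrier F; t \<in> gterms F A M\<rbrakk> \<Longrightarrow>
    gamma_eq F A M (GSmult (r \<otimes>\<^bsub>F\<^esub> r') t) (GSmult r (GSmult r' t))"
| gam_smult_one: "t \<in> gterms F A M \<Longrightarrow> gamma_eq F A M (GSmult \<one>\<^bsub>F\<^esub> t) t"
| gam_mult_assoc: "\<lbrakk>s \<in> gterms F A M; t \<in> gterms F A M; u \<in> gterms F A M\<rbrakk> \<Longrightarrow>
    gamma_eq F A M (GMult (GMult s t) u) (GMult s (GMult t u))"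
| gam_mult_comm: "\<lbrakk>s \<in> gterms F A M; t \<in> gterms F A M\<rbrakk> \<Longrightarrow> gamma_eq F A M (GMult s t) (GMult t s)"
| gam_mult_add: "\<lbrakk>s \<in> gterms F A M; t \<in> gterms F A M; u \<in> gterms F A M\<rbrakk> \<Longrightarrow>
    gamma_eq F A M (GMult (GAdd s t) u) (GAdd (GMult s u) (GMult t u))"
| gam_mult_smult: "\<lbrakk>r \<in> carrier F; s \<in> gterms F A M; t \<in> gterms F A M\<rbrakk> \<Longrightarrow>
    gamma_eq F A M (GMult (GSmult r s) t) (GSmult r (GMult s t))"
| gam_dp_smult: "\<lbrakk>n \<ge> 1; r \<in> carrier F; t \<in> gterms F A M\<rbrakk> \<Longrightarrow>
    gamma_eq F A M (GDp n (GSmult r t)) (GSmult (r [^]\<^bsub>F\<^esub> n) (GDp n t))"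
| gam_dp_mult: "\<lbrakk>m \<ge> 1; n \<ge> 1; t \<in> gterms F A M\<rbrakk> \<Longrightarrow>
    gamma_eq F A M (GMult (GDp m t) (GDp n t)) (gnat ((m + n) choose m) (GDp (m + n) t))"
| gam_dp_add: "\<lbrakk>n \<ge> 1; s \<in> gterms F A M; t \<in> gterms F A M\<rbrakk> \<Longrightarrow>
    gamma_eq F A M (GDp n (GAdd s t))
      (GAdd (GAdd (GDp n s) (gsum (\<lambda>l. GMult (GDp l s) (GDp (n - l) t)) (n - 1))) (GDp n t))"
| gam_dp_one: "t \<in> gterms F A M \<Longrightarrow> gamma_eq F A M (GDp 1 t) t"
| gam_dp_prod: "\<lbrakk>n \<ge> 1; s \<in> gterms F A M; t \<in> gterms F A M\<rbrakk> \<Longrightarrow>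
    gamma_eq F A M (GDp n (GMult s t)) (gnat (fact n) (GMult (GDp n s) (GDp n t)))"
| gam_dp_prod_left: "\<lbrakk>n \<ge> 1; s \<in> gterms F A M; t \<in> gterms F A M\<rbrakk> \<Longrightarrow>
    gamma_eq F A M (GDp n (GMult s t)) (GMult (gpow s n) (GDp n t))"
| gam_dp_prod_right: "\<lbrakk>n \<ge> 1; s \<in> gterms F A M; t \<in> gterms F A M\<rbrakk> \<Longrightarrow>
    gamma_eq F A M (GDp n (GMult s t)) (GMult (GDp n s) (gpow t n))"
| gam_dp_dp: "\<lbrakk>m \<ge> 1; n \<ge> 1; t \<in> gterms F A M\<rbrakk> \<Longrightarrow>
    gamma_eq F A M (GDp m (GDp n t)) (gnat (fact (m * n) div (fact m * fact n ^ m)) (GDp (m * n) t))"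
| gam_base_add: "\<lbrakk>a \<in> carrier A; b \<in> carrier A\<rbrakk> \<Longrightarrow>
    gamma_eq F A M (GBase (a \<oplus>\<^bsub>A\<^esub> b)) (GAdd (GBase a) (GBase b))"
| gam_base_smult: "\<lbrakk>r \<in> carrier F; a \<in> carrier A\<rbrakk> \<Longrightarrow>
    gamma_eq F A M (GBase (r \<odot>\<^bsub>A\<^esub> a)) (GSmult r (GBase a))"
| gam_base_mult: "\<lbrakk>a \<in> carrier A; b \<in> carrier A\<rbrakk> \<Longrightarrow>
    gamma_eq F A M (GBase (a \<otimes>\<^bsub>A\<^esub> b)) (GMult (GBase a) (GBase b))"
| gam_base_dp: "\<lbrakk>n \<ge> 1; a \<in> carrier A\<rbrakk> \<Longrightarrow>
    gamma_eq F A M (GBase (\<gamma>\<^bsub>A\<^esub> n a)) (GDp n (GBase a))"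
| gam_gen_add: "\<lbrakk>x \<in> carrier M; y \<in> carrier M\<rbrakk> \<Longrightarrow>
    gamma_eq F A M (GGen (x \<oplus>\<^bsub>M\<^esub> y)) (GAdd (GGen x) (GGen y))"
| gam_gen_smult: "\<lbrakk>r \<in> carrier F; x \<in> carrier M\<rbrakk> \<Longrightarrow>
    gamma_eq F A M (GGen (r \<odot>\<^bsub>M\<^esub> x)) (GSmult r (GGen x))"
| gam_gen_act: "\<lbrakk>a \<in> carrier A; x \<in> carrier M\<rbrakk> \<Longrightarrow>
    gamma_eq F A M (GGen (a \<triangleright>\<^bsub>M\<^esub> x)) (GMult (GBase a) (GGen x))"

definition gamma_rel ::
  "('f, 'k) ring_scheme \<Rightarrow> ('f, 'a, 'u) dp_algebra_scheme \<Rightarrow> ('f, 'a, 'm, 'v) act_module_scheme \<Rightarrow>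
    ('f, 'a, 'm) gterm rel" where
  "gamma_rel F A M = {(s, t). gamma_eq F A M s t}"

definition gamma_algebra ::
  "('f, 'k) ring_scheme \<Rightarrow> ('f, 'a, 'u) dp_algebra_scheme \<Rightarrow> ('f, 'a, 'm, 'v) act_module_scheme \<Rightarrow>
    ('f, ('f, 'a, 'm) gterm set) dp_algebra" where
  "gamma_algebra F A M = (let R = gamma_rel F A M in
    \<lparr>carrier = gterms F A M // R,
     monoid.mult = (\<lambda>X Y. \<Union>s\<in>X. \<Union>t\<in>Y. R `` {GMult s t}),
     one = undefined,
     zero = R `` {GZero},
     add = (\<lambda>X Y. \<Union>s\<in>X. \<Union>t\<in>Y. R `` {GAdd s t}),
     smult = (\<lambda>r X. \<Union>t\<in>X. R `` {GSmult r t}),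
     dp = (\<lambda>n X. \<Union>t\<in>X. R `` {GDp n t})\<rparr>)"

definition gamma_base ::
  "('f, 'k) ring_scheme \<Rightarrow> ('f, 'a, 'u) dp_algebra_scheme \<Rightarrow> ('f, 'a, 'm, 'v) act_module_scheme \<Rightarrow>
    'a \<Rightarrow> ('f, 'a, 'm) gterm set" where
  "gamma_base F A M a = gamma_rel F A M `` {GBase a}"

definition gamma_gen ::
  "('f, 'k) ring_scheme \<Rightarrow> ('f, 'a, 'u) dp_algebra_scheme \<Rightarrow> ('f, 'a, 'm, 'v) act_module_scheme \<Rightarrow>
    'm \<Rightarrow> ('f, 'a, 'm) gterm set" where
  "gamma_gen F A M x = gamma_rel F A M `` {GGen x}"


section \<open>The geometric tangent structure\<close>

abbreviation cotangent where
  "cotangent F A \<equiv> gamma_algebra F A (omega F A)"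

abbreviation cotangent_base where
  "cotangent_base F A \<equiv> gamma_base F A (omega F A)"

text \<open>The image of \<open>da\<close> under the unit of the adjunction.\<close>

abbreviation cotangent_d where
  "cotangent_d F A a \<equiv> gamma_gen F A (omega F A) (omega_d F A a)"

definition geometric_vector_fields ::
  "('f, 'k) ring_scheme \<Rightarrow> ('f, 'a, 'u) dp_algebra_scheme \<Rightarrow>
    (('f, 'a, ('a \<Rightarrow> 'f \<times> 'a) set set) gterm set \<Rightarrow> 'a) set" where
  "geometric_vector_fields F A =
    {v \<in> dp_hom F (cotangent F A) A \<inter> extensional (carrier (cotangent F A)).
      \<forall>a\<in>carrier A. v (cotangent_base F A a) = a}"

section \<open>Divided powers in characteristic p\<close>

context comm_nonunital_algebra
begin

lemma mult_add_right:
  "\<lbrakk>a \<in> carrier A; b \<in> carrier A; c \<in> carrier A\<rbrakk> \<Longrightarrow>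
    a \<otimes>\<^bsub>A\<^esub> (b \<oplus>\<^bsub>A\<^esub> c) = a \<otimes>\<^bsub>A\<^esub> b \<oplus>\<^bsub>A\<^esub> a \<otimes>\<^bsub>A\<^esub> c"
  using mult_add_left[of b c a] by (simp add: mult_comm[of a])

lemma mult_smult_right:
  "\<lbrakk>r \<in> carrier F; a \<in> carrier A; b \<in> carrier A\<rbrakk> \<Longrightarrow>
    a \<otimes>\<^bsub>A\<^esub> (r \<odot>\<^bsub>A\<^esub> b) = r \<odot>\<^bsub>A\<^esub> (a \<otimes>\<^bsub>A\<^esub> b)"
  using mult_smult_left[of r b a] by (simp add: mult_comm[of a])

lemma mult_lcomm:
  "\<lbrakk>a \<in> carrier A; b \<in> carrier A; c \<in> carrier A\<rbrakk> \<Longrightarrow>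
    a \<otimes>\<^bsub>A\<^esub> (b \<otimes>\<^bsub>A\<^esub> c) = b \<otimes>\<^bsub>A\<^esub> (a \<otimes>\<^bsub>A\<^esub> c)"
  by (metis mult_assoc mult_comm)

lemma null_mult [simp]: "a \<in> carrier A \<Longrightarrow> \<zero>\<^bsub>A\<^esub> \<otimes>\<^bsub>A\<^esub> a = \<zero>\<^bsub>A\<^esub>"
  using mult_smult_left[of "\<zero>\<^bsub>F\<^esub>" "\<zero>\<^bsub>A\<^esub>" a] by simp

lemma mult_null [simp]: "a \<in> carrier A \<Longrightarrow> a \<otimes>\<^bsub>A\<^esub> \<zero>\<^bsub>A\<^esub> = \<zero>\<^bsub>A\<^esub>"
  using mult_comm[of a "\<zero>\<^bsub>A\<^esub>"] by simp

lemma nmult_smult: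
  fixes k :: nat
  assumes "a \<in> carrier A"
  shows "[k] \<cdot>\<^bsub>A\<^esub> a = ([k] \<cdot>\<^bsub>F\<^esub> \<one>\<^bsub>F\<^esub>) \<odot>\<^bsub>A\<^esub> a"
  using assms by (induction k) (simp_all add: smult_l_distr)

lemma nmult_closed [simp, intro]:
  fixes k :: nat
  shows "a \<in> carrier A \<Longrightarrow> [k] \<cdot>\<^bsub>A\<^esub> a \<in> carrier A"
  by simp

lemma mult_nmult_left:
  fixes k :: nat
  shows "\<lbrakk>a \<in> carrier A; b \<in> carrier A\<rbrakk> \<Longrightarrow> ([k] \<cdot>\<^bsub>A\<^esub> a) \<otimes>\<^bsub>A\<^esub> b = [k] \<cdot>\<^bsub>A\<^esub> (a \<otimes>\<^bsub>A\<^esub> b)"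
  by (simp add: nmult_smult mult_smult_left)

lemma mult_nmult_right:
  fixes k :: nat
  shows "\<lbrakk>a \<in> carrier A; b \<in> carrier A\<rbrakk> \<Longrightarrow> a \<otimes>\<^bsub>A\<^esub> ([k] \<cdot>\<^bsub>A\<^esub> b) = [k] \<cdot>\<^bsub>A\<^esub> (a \<otimes>\<^bsub>A\<^esub> b)"
  by (simp add: nmult_smult mult_smult_right)

lemma nmult_nmult:
  fixes j k :: nat
  shows "a \<in> carrier A \<Longrightarrow> [j] \<cdot>\<^bsub>A\<^esub> ([k] \<cdot>\<^bsub>A\<^esub> a) = [(j * k)] \<cdot>\<^bsub>A\<^esub> a"
  by (simp add: M.add.nat_pow_pow mult.commute)

lemma nmult_add:
  fixes j k :: nat
  shows "a \<in> carrier A \<Longrightarrow> [j] \<cdot>\<^bsub>A\<^esub> a \<oplus>\<^bsub>A\<^esub> [k] \<cdot>\<^bsub>A\<^esub> a = [(j + k)] \<cdot>\<^bsub>A\<^esub> a"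
  by (simp add: M.add.nat_pow_mult)

lemma npow_closed [simp, intro]: "\<lbrakk>n \<ge> 1; a \<in> carrier A\<rbrakk> \<Longrightarrow> npow A a n \<in> carrier A"
proof (induction n rule: nat_induct_at_least)
  case (Suc n)
  then show ?case by (cases n) auto
qed simp

lemma nmult_one_eq_zero_iff:
  fixes n :: nat
  shows "[n] \<cdot>\<^bsub>F\<^esub> \<one>\<^bsub>F\<^esub> = \<zero>\<^bsub>F\<^esub> \<longleftrightarrow> characteristic F dvd n"
  unfolding characteristic_def
  using group.pow_eq_id[OF R.a_group, of "\<one>\<^bsub>F\<^esub>" n] by (simp add: add_pow_def)

lemma nmult_one_mult:
  fixes m n :: nat
  shows "[(m * n)] \<cdot>\<^bsub>F\<^esub> \<one>\<^bsub>F\<^esub> = [m] \<cdot>\<^bsub>F\<^esub> \<one>\<^bsub>F\<^esub> \<otimes>\<^bsub>F\<^esub> [n] \<cdot>\<^bsub>F\<^esub> \<one>\<^bsub>F\<^esub>"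
  by (simp add: R.add_pow_ldistr R.add.nat_pow_pow mult.commute)

lemma prime_characteristic:
  assumes "characteristic F > 0"
  shows "Factorial_Ring.prime (characteristic F)"
proof -
  let ?p = "characteristic F"
  have ne1: "?p \<noteq> 1"
    using nmult_one_eq_zero_iff[of 1] by simp
  have "a = 1 \<or> b = 1" if ab: "?p = a * b" for a b :: nat
  proof -
    have "[(a * b)] \<cdot>\<^bsub>F\<^esub> \<one>\<^bsub>F\<^esub> = \<zero>\<^bsub>F\<^esub>"
      using nmult_one_eq_zero_iff[of "a * b"] ab by simp
    then have "[a] \<cdot>\<^bsub>F\<^esub> \<one>\<^bsub>F\<^esub> = \<zero>\<^bsub>F\<^esub> \<or> [b] \<cdot>\<^bsub>F\<^esub> \<one>\<^bsub>F\<^esub> = \<zero>\<^bsub>F\<^esub>"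
      unfolding nmult_one_mult using F.integral[of "[a] \<cdot>\<^bsub>F\<^esub> \<one>\<^bsub>F\<^esub>" "[b] \<cdot>\<^bsub>F\<^esub> \<one>\<^bsub>F\<^esub>"] by simp
    then have "?p dvd a \<or> ?p dvd b"
      by (simp add: nmult_one_eq_zero_iff)
    then show ?thesis
      using ab assms by (metis dvd_mult_cancel1 dvd_mult_cancel2 dvd_refl dvd_triv_left dvd_triv_right
          gcd_nat.antisym mult_cancel1 mult_cancel2 mult_is_0 nat_mult_1 nat_mult_1_right neq0_conv)
  qed
  then show ?thesis
    using ne1 assms by (metis One_nat_def Suc_lessI prime_nat_iff dvd_def mult.right_neutral mult.commute)
qed

lemma nmult_eq_zero:
  fixes n :: nat
  shows "\<lbrakk>characteristic F dvd n; a \<in> carrier A\<rbrakk> \<Longrightarrow> [n] \<cdot>\<^bsub>A\<^esub> a = \<zero>\<^bsub>A\<^esub>"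
  using nmult_one_eq_zero_iff[of n] by (simp add: nmult_smult)

lemma nmult_cancel:
  fixes n :: nat
  assumes "\<not> characteristic F dvd n" "a \<in> carrier A" "b \<in> carrier A" "[n] \<cdot>\<^bsub>A\<^esub> a = [n] \<cdot>\<^bsub>A\<^esub> b"
  shows "a = b"
proof -
  let ?r = "[n] \<cdot>\<^bsub>F\<^esub> \<one>\<^bsub>F\<^esub>"
  have "?r \<in> Units F"
    using assms(1) by (simp add: F.field_Units nmult_one_eq_zero_iff)
  then have inv: "inv\<^bsub>F\<^esub> ?r \<in> carrier F" "inv\<^bsub>F\<^esub> ?r \<otimes>\<^bsub>F\<^esub> ?r = \<one>\<^bsub>F\<^esub>"
    by auto
  have "inv\<^bsub>F\<^esub> ?r \<odot>\<^bsub>A\<^esub> (?r \<odot>\<^bsub>A\<^esub> a) = inv\<^bsub>F\<^esub> ?r \<odot>\<^bsub>A\<^esub> (?r \<odot>\<^bsub>A\<^esub> b)"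
    using assms by (simp add: nmult_smult)
  then show ?thesis
    using inv assms by (simp flip: smult_assoc1)
qed

end

lemma binomial_step: "n \<ge> 1 \<Longrightarrow> Suc m * n choose n = Suc m * (Suc m * n - 1 choose (n - 1))"
proof -
  assume n: "n \<ge> 1"
  then obtain k where k: "n = Suc k" by (cases n) auto
  have "Suc k * (Suc m * n choose Suc k) = Suc m * n * (Suc m * n - 1 choose k)"
    by (rule binomial_absorption)
  then have "n * (Suc m * n choose n) = n * (Suc m * (Suc m * n - 1 choose (n - 1)))"
    unfolding k by (simp only: diff_Suc_1) (simp only: ac_simps)
  then show ?thesis
    using n by (metis mult_left_cancel not_one_le_zero)
qed

lemma fact_mult_dvd: "fact m * fact n ^ m dvd (fact (m * n) :: nat)" if "n \<ge> 1"
proof (induction m)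
  case (Suc m)
  have "(fact (Suc m * n) :: nat) = fact (m * n) * fact n * (Suc m * n choose n)"
    using binomial_fact_lemma[of n "Suc m * n"] by (simp add: algebra_simps)
  moreover note binomial_step[OF that, of m]
  ultimately have "(fact (Suc m * n) :: nat) = fact (m * n) * (fact n * Suc m * (Suc m * n - 1 choose (n - 1)))"
    by (simp add: algebra_simps)
  moreover have "fact (Suc m) * fact n ^ Suc m = fact m * fact n ^ m * (fact n * Suc m :: nat)"
    by (simp add: algebra_simps)
  ultimately show ?case
    using Suc by (metis mult_dvd_mono dvd_triv_left)
qed simp

definition dpc :: "nat \<Rightarrow> nat \<Rightarrow> nat" where
  "dpc m n = fact (m * n) div (fact m * fact n ^ m)"

lemma dpc_0 [simp]: "dpc 0 n = 1"
  by (simp add: dpc_def)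

lemma dpc_Suc: "n \<ge> 1 \<Longrightarrow> dpc (Suc m) n = dpc m n * (Suc m * n - 1 choose (n - 1))"
proof -
  assume n: "n \<ge> 1"
  define c where "c = (Suc m * n - 1 choose (n - 1))"
  have 1: "(fact (Suc m * n) :: nat) = fact (m * n) * fact n * (Suc m * n choose n)"
    using binomial_fact_lemma[of n "Suc m * n"] by (simp add: algebra_simps)
  have "fact (m * n) = dpc m n * (fact m * fact n ^ m)"
    using fact_mult_dvd[OF n, of m] by (simp add: dpc_def)
  then have "(fact (Suc m * n) :: nat) = (dpc m n * c) * (fact (Suc m) * fact n ^ Suc m)"
    using 1 binomial_step[OF n, of m] by (simp add: algebra_simps c_def)
  then show ?thesis
    unfolding dpc_def[of "Suc m"] c_def by simp
qed

lemma not_dvd_dpc: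
  assumes "Factorial_Ring.prime p"
  shows "\<not> p dvd dpc m p"
proof (induction m)
  case (Suc m)
  have p: "p \<ge> 1" using assms prime_ge_1_nat by blast
  have "\<not> p dvd (m * p + j choose j)" if "j < p" for j
    using that
  proof (induction j)
    case (Suc j)
    have "\<not> p dvd m * p + Suc j"
      using Suc.prems by (metis dvd_add_right_iff dvd_triv_right nat_dvd_not_less zero_less_Suc)
    then have "\<not> p dvd (m * p + Suc j) * (m * p + j choose j)"
      using Suc assms by (simp add: prime_dvd_mult_iff del: add_Suc_right)
    moreover have "Suc j * (m * p + Suc j choose Suc j) = (m * p + Suc j) * (m * p + j choose j)"
      using binomial_absorption[of j "m * p + Suc j"] by simp
    ultimately show ?case by (metis dvd_mult)
  qed (use assms in auto)
  from this[of "p - 1"] have "\<not> p dvd (Suc m * p - 1 choose (p - 1))"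
    using p by (simp add: add.commute)
  then show ?case
    using Suc assms p by (simp add: dpc_Suc prime_dvd_mult_iff)
qed (use assms in auto)

lemma (in comm_nonunital_algebra) npow_eq_fact_aux:
  assumes g: "\<And>n. n \<ge> 1 \<Longrightarrow> g n \<in> carrier A"
    and step: "\<And>n. n \<ge> 1 \<Longrightarrow> g 1 \<otimes>\<^bsub>A\<^esub> g n = [Suc n] \<cdot>\<^bsub>A\<^esub> g (Suc n)"
    and n: "n \<ge> 1"
  shows "npow A (g 1) n = [(fact n :: nat)] \<cdot>\<^bsub>A\<^esub> (g n)"
  using n
proof (induction n rule: nat_induct_at_least)
  case base
  then show ?case using g[of 1] by simp
next
  case (Suc n)
  then obtain m where m: "n = Suc m" by (cases n) auto
  have "npow A (g 1) (Suc n) = g 1 \<otimes>\<^bsub>A\<^esub> [(fact n :: nat)] \<cdot>\<^bsub>A\<^esub> (g n)"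
    using Suc unfolding m by simp
  also have "\<dots> = [(fact n :: nat)] \<cdot>\<^bsub>A\<^esub> ([Suc n] \<cdot>\<^bsub>A\<^esub> g (Suc n))"
    using Suc g[of 1] g[of n] step[of n] by (simp only: mult_nmult_right order.refl)
  also have "\<dots> = [(fact n * Suc n)] \<cdot>\<^bsub>A\<^esub> g (Suc n)"
    using g[of "Suc n"] by (intro nmult_nmult) simp
  also have "fact n * Suc n = (fact (Suc n) :: nat)"
    by (simp only: fact_Suc of_nat_id mult.commute)
  finally show ?case .
qed

lemma (in divided_power_algebra) npow_eq_fact:
  assumes "n \<ge> 1" "a \<in> carrier A"
  shows "npow A a n = [(fact n :: nat)] \<cdot>\<^bsub>A\<^esub> (\<gamma>\<^bsub>A\<^esub> n a)"
proof -
  have "\<gamma>\<^bsub>A\<^esub> 1 a \<otimes>\<^bsub>A\<^esub> \<gamma>\<^bsub>A\<^esub> n a = [Suc n] \<cdot>\<^bsub>A\<^esub> \<gamma>\<^bsub>A\<^esub> (Suc n) a" if "n \<ge> 1" for n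
    using dp_mult[of 1 n a] that assms by (simp only: plus_1_eq_Suc choose_one order.refl)
  from npow_eq_fact_aux[of "\<lambda>n. \<gamma>\<^bsub>A\<^esub> n a", OF _ this] show ?thesis
    using assms dp_one[of a] by auto
qed

lemma dp_determined:
  assumes A: "divided_power_algebra F A" and B: "divided_power_algebra F (A\<lparr>dp := g\<rparr>)"
    and p: "characteristic F = p" "p > 0"
    and eq: "\<And>a. a \<in> carrier A \<Longrightarrow> g p a = \<gamma>\<^bsub>A\<^esub> p a"
    and "n \<ge> 1" "a \<in> carrier A"
  shows "g n a = \<gamma>\<^bsub>A\<^esub> n a"
proof -
  interpret A: divided_power_algebra F A by fact
  interpret B: divided_power_algebra F "A\<lparr>dp := g\<rparr>" by fact
  have pow: "[k] \<cdot>\<^bsub>A\<lparr>dp := g\<rparr>\<^esub> x = [k] \<cdot>\<^bsub>A\<^esub> x" for k :: nat and x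
    by (simp add: add_pow_def)
  have pp: "Factorial_Ring.prime p" using A.prime_characteristic p by simp
  then have p2: "p \<ge> 2" by (rule prime_ge_2_nat)
  show ?thesis
    using \<open>n \<ge> 1\<close> \<open>a \<in> carrier A\<close>
  proof (induction n arbitrary: a rule: less_induct)
    case (less n)
    have g: "g k x \<in> carrier A" if "k \<ge> 1" "x \<in> carrier A" for k x
      using B.dp_closed[of k x] that by simp
    consider "n = 1" | "n > 1" "\<not> p dvd n" | m where "n = m * p" "m \<ge> 1"
      using less.prems by (metis dvd_def le_less mult.commute mult_0_right less_one not_le)
    then show ?case
    proof cases
      case 1
      then show ?thesis using A.dp_one[of a] B.dp_one[of a] less.prems by simp
    next
      case 2
      have "g 1 a \<otimes>\<^bsub>A\<^esub> g (n - 1) a = [(1 + (n - 1) choose 1)] \<cdot>\<^bsub>A\<^esub> (g (1 + (n - 1)) a)"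
        using B.dp_mult[of 1 "n - 1" a] 2 less.prems by (simp add: pow)
      moreover have "\<gamma>\<^bsub>A\<^esub> 1 a \<otimes>\<^bsub>A\<^esub> \<gamma>\<^bsub>A\<^esub> (n - 1) a = [(1 + (n - 1) choose 1)] \<cdot>\<^bsub>A\<^esub> (\<gamma>\<^bsub>A\<^esub> (1 + (n - 1)) a)"
        using A.dp_mult[of 1 "n - 1" a] 2 less.prems by simp
      moreover have "g 1 a = \<gamma>\<^bsub>A\<^esub> 1 a" "g (n - 1) a = \<gamma>\<^bsub>A\<^esub> (n - 1) a"
        using less 2 by auto
      ultimately have "[n] \<cdot>\<^bsub>A\<^esub> (g n a) = [n] \<cdot>\<^bsub>A\<^esub> (\<gamma>\<^bsub>A\<^esub> n a)"
        using 2 by simp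
      then show ?thesis
        using A.nmult_cancel[of n "g n a" "\<gamma>\<^bsub>A\<^esub> n a"] 2 p g less.prems by auto
    next
      case 3
      show ?thesis
      proof (cases "m = 1")
        case True
        then show ?thesis using 3 eq less.prems by simp
      next
        case False
        have mn: "m < n" using 3 p2 by simp
        have p1: "p \<ge> 1" using p2 by simp
        have "g m (g p a) = \<gamma>\<^bsub>A\<^esub> m (\<gamma>\<^bsub>A\<^esub> p a)"
          using less.IH[OF mn 3(2), of "\<gamma>\<^bsub>A\<^esub> p a"] eq[OF less.prems(2)] less.prems p1 by simp
        moreover have "g m (g p a) = [(dpc m p)] \<cdot>\<^bsub>A\<^esub> (g n a)"
          using B.dp_dp[of m p a] 3 less.prems p1 by (simp add: pow dpc_def)
        moreover have "\<gamma>\<^bsub>A\<^esub> m (\<gamma>\<^bsub>A\<^esub> p a) = [(dpc m p)] \<cdot>\<^bsub>A\<^esub> (\<gamma>\<^bsub>A\<^esub> n a)"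
          using A.dp_dp[of m p a] 3 less.prems p1 by (simp add: dpc_def)
        ultimately show ?thesis
          using A.nmult_cancel[of "dpc m p" "g n a" "\<gamma>\<^bsub>A\<^esub> n a"] not_dvd_dpc[OF pp] p g less.prems
          by auto
      qed
    qed
  qed
qed

section \<open>Existence of the tangent divided power structure\<close>

context comm_nonunital_algebra
begin

lemma finsum_first:
  assumes "f \<in> UNIV \<rightarrow> carrier A"
  shows "finsum A f {..m::nat} = f 0 \<oplus>\<^bsub>A\<^esub> finsum A f {1..m}"
proof -
  have "{..m} = insert 0 {1..m}" by auto
  then show ?thesis
    using assms by (simp add: M.finsum_insert Pi_iff)
qed

lemma finsum_last:
  assumes "f \<in> UNIV \<rightarrow> carrier A"
  shows "finsum A f {..m::nat} = f m \<oplus>\<^bsub>A\<^esub> finsum A (\<lambda>l. f (l - 1)) {1..m}"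
proof -
  have 1: "{..m} = insert m {..<m}" by auto
  have 2: "{1..m} = Suc ` {..<m}" by (simp add: image_Suc_lessThan)
  have "finsum A (\<lambda>l. f (l - 1)) {1..m} = finsum A f {..<m}"
    unfolding 2 using assms by (subst M.finsum_reindex) auto
  then show ?thesis
    unfolding 1 using assms by (simp add: M.finsum_insert Pi_iff)
qed

lemma finsum_smult_mult:
  assumes "finite I" "f \<in> I \<rightarrow> carrier A" "b \<in> carrier A"
  shows "finsum A f I \<otimes>\<^bsub>A\<^esub> b = finsum A (\<lambda>i. f i \<otimes>\<^bsub>A\<^esub> b) I"
  using assms(1,2)
proof (induction I rule: finite_induct)
  case (insert i I)
  then show ?case
    using assms(3) by (simp add: M.finsum_insert mult_add_left Pi_iff M.finsum_closed)
qed (use assms in simp)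

end

context divided_power_algebra
begin

definition dpl :: "nat \<Rightarrow> 'a \<Rightarrow> 'a \<Rightarrow> 'a" where
  "dpl k a b = (if k = 0 then b else \<gamma>\<^bsub>A\<^esub> k a \<otimes>\<^bsub>A\<^esub> b)"

lemma dpl_0 [simp]: "dpl 0 a b = b"
  by (simp add: dpl_def)

lemma dpl_pos: "k \<ge> 1 \<Longrightarrow> \<gamma>\<^bsub>A\<^esub> k a \<otimes>\<^bsub>A\<^esub> b = dpl k a b"
  by (simp add: dpl_def)

lemma dpl_closed [simp, intro]: "\<lbrakk>a \<in> carrier A; b \<in> carrier A\<rbrakk> \<Longrightarrow> dpl k a b \<in> carrier A"
  by (simp add: dpl_def)

lemma dpl_add:
  "\<lbrakk>a \<in> carrier A; b \<in> carrier A; c \<in> carrier A\<rbrakk> \<Longrightarrow> dpl k a (b \<oplus>\<^bsub>A\<^esub> c) = dpl k a b \<oplus>\<^bsub>A\<^esub> dpl k a c"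
  by (simp add: dpl_def mult_add_right)

lemma dpl_smult:
  "\<lbrakk>r \<in> carrier F; a \<in> carrier A; b \<in> carrier A\<rbrakk> \<Longrightarrow> dpl k a (r \<odot>\<^bsub>A\<^esub> b) = r \<odot>\<^bsub>A\<^esub> dpl k a b"
  by (simp add: dpl_def mult_smult_right)

lemma dpl_nmult:
  fixes j :: nat
  shows "\<lbrakk>a \<in> carrier A; b \<in> carrier A\<rbrakk> \<Longrightarrow> dpl k a ([j] \<cdot>\<^bsub>A\<^esub> b) = [j] \<cdot>\<^bsub>A\<^esub> dpl k a b"
  by (simp add: dpl_def mult_nmult_right)

lemma mult_dpl:
  "\<lbrakk>a \<in> carrier A; b \<in> carrier A; c \<in> carrier A\<rbrakk> \<Longrightarrow> c \<otimes>\<^bsub>A\<^esub> dpl k a b = dpl k a (c \<otimes>\<^bsub>A\<^esub> b)"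
  by (simp add: dpl_def mult_lcomm)

lemma dpl_comm:
  "\<lbrakk>a \<in> carrier A; b \<in> carrier A; c \<in> carrier A\<rbrakk> \<Longrightarrow> dpl k a (dpl l c b) = dpl l c (dpl k a b)"
  by (simp add: dpl_def mult_lcomm)

lemma dpl_dpl:
  "\<lbrakk>a \<in> carrier A; b \<in> carrier A\<rbrakk> \<Longrightarrow>
    dpl k a (dpl l a b) = [((k + l) choose k)] \<cdot>\<^bsub>A\<^esub> dpl (k + l) a b"
  by (auto simp: dpl_def dp_mult mult_nmult_left simp flip: mult_assoc)

lemma dpl_smult_base:
  "\<lbrakk>r \<in> carrier F; a \<in> carrier A; b \<in> carrier A\<rbrakk> \<Longrightarrow> dpl k (r \<odot>\<^bsub>A\<^esub> a) b = (r [^]\<^bsub>F\<^esub> k) \<odot>\<^bsub>A\<^esub> dpl k a b"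
  by (simp add: dpl_def dp_smult mult_smult_left)

lemma dpl_mult_base:
  "\<lbrakk>a \<in> carrier A; b \<in> carrier A; c \<in> carrier A\<rbrakk> \<Longrightarrow>
    dpl k (a \<otimes>\<^bsub>A\<^esub> c) b = [(fact k :: nat)] \<cdot>\<^bsub>A\<^esub> dpl k a (dpl k c b)"
  by (simp add: dpl_def dp_prod mult_nmult_left mult_assoc)

lemma dpl_dp_base:
  "\<lbrakk>n \<ge> 1; a \<in> carrier A; b \<in> carrier A\<rbrakk> \<Longrightarrow>
    dpl k (\<gamma>\<^bsub>A\<^esub> n a) b = [(dpc k n)] \<cdot>\<^bsub>A\<^esub> dpl (k * n) a b"
  by (auto simp: dpl_def dp_dp dpc_def mult_nmult_left)

lemma dpl_add_base:
  assumes "a \<in> carrier A" "c \<in> carrier A" "b \<in> carrier A"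
  shows "dpl n (a \<oplus>\<^bsub>A\<^esub> c) b = (\<Oplus>\<^bsub>A\<^esub>l\<in>{..n}. dpl l a (dpl (n - l) c b))"
proof (cases "n = 0")
  case False
  then have n: "n \<ge> 1" by simp
  let ?f = "\<lambda>l. dpl l a (dpl (n - l) c b)"
  have eq: "(\<Oplus>\<^bsub>A\<^esub>l\<in>{1..n-1}. \<gamma>\<^bsub>A\<^esub> l a \<otimes>\<^bsub>A\<^esub> \<gamma>\<^bsub>A\<^esub> (n - l) c) \<otimes>\<^bsub>A\<^esub> b = finsum A ?f {1..n-1}"
    using assms
    by (subst finsum_smult_mult) (auto intro!: M.finsum_cong' simp: dpl_def mult_assoc)
  have "{1..n} = insert n {1..n-1}" using n by auto
  then have "finsum A ?f {..n} = ?f 0 \<oplus>\<^bsub>A\<^esub> (?f n \<oplus>\<^bsub>A\<^esub> finsum A ?f {1..n-1})"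
    using assms n by (subst finsum_first) (auto simp: M.finsum_insert)
  also have "\<dots> = ?f n \<oplus>\<^bsub>A\<^esub> finsum A ?f {1..n-1} \<oplus>\<^bsub>A\<^esub> ?f 0"
    using assms by (simp add: M.a_ac M.finsum_closed)
  also have "\<dots> = \<gamma>\<^bsub>A\<^esub> n a \<otimes>\<^bsub>A\<^esub> b \<oplus>\<^bsub>A\<^esub> (\<Oplus>\<^bsub>A\<^esub>l\<in>{1..n-1}. \<gamma>\<^bsub>A\<^esub> l a \<otimes>\<^bsub>A\<^esub> \<gamma>\<^bsub>A\<^esub> (n - l) c) \<otimes>\<^bsub>A\<^esub> b \<oplus>\<^bsub>A\<^esub> \<gamma>\<^bsub>A\<^esub> n c \<otimes>\<^bsub>A\<^esub> b"
    using n by (simp add: eq[simplified] dpl_def)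
  also have "\<dots> = (\<gamma>\<^bsub>A\<^esub> n a \<oplus>\<^bsub>A\<^esub> (\<Oplus>\<^bsub>A\<^esub>l\<in>{1..n-1}. \<gamma>\<^bsub>A\<^esub> l a \<otimes>\<^bsub>A\<^esub> \<gamma>\<^bsub>A\<^esub> (n - l) c) \<oplus>\<^bsub>A\<^esub> \<gamma>\<^bsub>A\<^esub> n c) \<otimes>\<^bsub>A\<^esub> b"
  proof -
    have "(\<Oplus>\<^bsub>A\<^esub>l\<in>{1..n-1}. \<gamma>\<^bsub>A\<^esub> l a \<otimes>\<^bsub>A\<^esub> \<gamma>\<^bsub>A\<^esub> (n - l) c) \<in> carrier A"
      using assms by (intro M.finsum_closed) auto
    then show ?thesis
      using assms n by (simp add: mult_add_left)
  qed
  also have "\<dots> = dpl n (a \<oplus>\<^bsub>A\<^esub> c) b"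
    using assms n by (simp only: dp_add dpl_pos[symmetric])
  finally show ?thesis ..
qed (use assms in simp)

definition tdp :: "nat \<Rightarrow> 'a \<times> 'a \<Rightarrow> 'a \<times> 'a" where
  "tdp n = (\<lambda>(a, b). (\<gamma>\<^bsub>A\<^esub> n a, dpl (n - 1) a b))"

lemma tdp_dpa: "divided_power_algebra F (square_zero_ext A tdp)"
proof -
  let ?T = "square_zero_ext A tdp"
  have ops [simp]:
    "carrier ?T = carrier A \<times> carrier A" "\<zero>\<^bsub>?T\<^esub> = (\<zero>\<^bsub>A\<^esub>, \<zero>\<^bsub>A\<^esub>)"
    "(a, b) \<oplus>\<^bsub>?T\<^esub> (a', b') = (a \<oplus>\<^bsub>A\<^esub> a', b \<oplus>\<^bsub>A\<^esub> b')"
    "(a, b) \<otimes>\<^bsub>?T\<^esub> (a', b') = (a \<otimes>\<^bsub>A\<^esub> a', a \<otimes>\<^bsub>A\<^esub> b' \<oplus>\<^bsub>A\<^esub> a' \<otimes>\<^bsub>A\<^esub> b)"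
    "r \<odot>\<^bsub>?T\<^esub> (a, b) = (r \<odot>\<^bsub>A\<^esub> a, r \<odot>\<^bsub>A\<^esub> b)"
    "\<gamma>\<^bsub>?T\<^esub> n (a, b) = (\<gamma>\<^bsub>A\<^esub> n a, dpl (n - 1) a b)" for a b a' b' r n
    by (simp_all add: square_zero_ext_def tdp_def)
  have grp: "abelian_group ?T"
  proof (rule abelian_groupI)
    fix x assume "x \<in> carrier ?T"
    then obtain a b where x: "x = (a, b)" "a \<in> carrier A" "b \<in> carrier A" by auto
    then show "\<exists>y\<in>carrier ?T. y \<oplus>\<^bsub>?T\<^esub> x = \<zero>\<^bsub>?T\<^esub>"
      by (intro bexI[of _ "(\<ominus>\<^bsub>A\<^esub> a, \<ominus>\<^bsub>A\<^esub> b)"]) (auto simp: M.l_neg)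
  qed (auto simp: M.a_ac)
  have mod: "module F ?T"
    by (rule moduleI[OF R.is_cring grp])
       (auto simp: smult_l_distr smult_r_distr smult_assoc1)
  have "comm_nonunital_algebra_axioms F ?T"
    by unfold_locales
       (auto simp: mult_assoc mult_comm mult_lcomm mult_add_left mult_add_right mult_smult_left
          mult_smult_right smult_r_distr M.a_ac)
  then have "comm_nonunital_algebra F ?T"
    by (intro comm_nonunital_algebra.intro mod F.field_axioms)
  then interpret T: comm_nonunital_algebra F ?T .
  have pow: "[k] \<cdot>\<^bsub>?T\<^esub> (a, b) = ([k] \<cdot>\<^bsub>A\<^esub> a, [k] \<cdot>\<^bsub>A\<^esub> b)" for k :: nat and a b
    by (induction k) (simp_all add: add_pow_def)
  have fs: "finsum ?T (\<lambda>i. (f i, h i)) I = (finsum A f I, finsum A h I)"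
    if "finite I" "f \<in> I \<rightarrow> carrier A" "h \<in> I \<rightarrow> carrier A" for f h and I :: "nat set"
    using that
  proof (induction I rule: finite_induct)
    case (insert i I)
    have "finsum ?T (\<lambda>i. (f i, h i)) (insert i I) = (f i, h i) \<oplus>\<^bsub>?T\<^esub> finsum ?T (\<lambda>i. (f i, h i)) I"
      using insert by (intro T.M.finsum_insert) (auto simp: Pi_iff)
    then show ?case
      using insert by (simp add: M.finsum_insert Pi_iff)
  qed (simp add: T.M.finsum_empty)
  have closed: "\<gamma>\<^bsub>?T\<^esub> n x \<in> carrier ?T" if "n \<ge> 1" "x \<in> carrier ?T" for n x
    using that by auto
  have dmult: "\<gamma>\<^bsub>?T\<^esub> m x \<otimes>\<^bsub>?T\<^esub> \<gamma>\<^bsub>?T\<^esub> n x = [((m + n) choose m)] \<cdot>\<^bsub>?T\<^esub> (\<gamma>\<^bsub>?T\<^esub> (m + n) x)"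
    if mn: "m \<ge> 1" "n \<ge> 1" and x: "x \<in> carrier ?T" for m n x
  proof -
    obtain a b where ab: "x = (a, b)" "a \<in> carrier A" "b \<in> carrier A" using x by auto
    obtain i j where ij: "m = Suc i" "n = Suc j" using mn by (metis Suc_le_D One_nat_def)
    have "dpl m a (dpl j a b) \<oplus>\<^bsub>A\<^esub> dpl n a (dpl i a b)
        = [((m + j) choose m)] \<cdot>\<^bsub>A\<^esub> dpl (m + j) a b \<oplus>\<^bsub>A\<^esub> [((n + i) choose n)] \<cdot>\<^bsub>A\<^esub> dpl (n + i) a b"
      using ab by (simp add: dpl_dpl)
    also have "\<dots> = [(((m + j) choose m) + ((n + i) choose n))] \<cdot>\<^bsub>A\<^esub> dpl (m + n - 1) a b"
      using ab ij nmult_add[of "dpl (m + n - 1) a b"] by (simp add: add.commute)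
    also have "((m + j) choose m) + ((n + i) choose n) = ((m + n) choose m)"
      using ij binomial_symmetric[of "n" "n + i"] by (simp add: add.commute)
    finally have "\<gamma>\<^bsub>A\<^esub> m a \<otimes>\<^bsub>A\<^esub> dpl (n - 1) a b \<oplus>\<^bsub>A\<^esub> \<gamma>\<^bsub>A\<^esub> n a \<otimes>\<^bsub>A\<^esub> dpl (m - 1) a b
        = [((m + n) choose m)] \<cdot>\<^bsub>A\<^esub> dpl (m + n - 1) a b"
      using mn by (simp only: dpl_pos) (simp add: ij)
    then show ?thesis
      using ab mn by (simp add: pow dp_mult)
  qed
  have d1: "\<gamma>\<^bsub>?T\<^esub> 1 x = x" if "x \<in> carrier ?T" for x
    using that dp_one by auto
  have npow: "npow ?T x n = [(fact n :: nat)] \<cdot>\<^bsub>?T\<^esub> (\<gamma>\<^bsub>?T\<^esub> n x)" if "n \<ge> 1" "x \<in> carrier ?T" for n x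
  proof -
    have "\<gamma>\<^bsub>?T\<^esub> 1 x \<otimes>\<^bsub>?T\<^esub> \<gamma>\<^bsub>?T\<^esub> n x = [Suc n] \<cdot>\<^bsub>?T\<^esub> \<gamma>\<^bsub>?T\<^esub> (Suc n) x" if "n \<ge> 1" for n
      using dmult[of 1 n x] that \<open>x \<in> carrier ?T\<close> by (simp only: plus_1_eq_Suc choose_one order.refl)
    from T.npow_eq_fact_aux[of "\<lambda>n. \<gamma>\<^bsub>?T\<^esub> n x", OF _ this] show ?thesis
      using that closed d1[of x] by auto
  qed
  have dprod: "\<gamma>\<^bsub>?T\<^esub> n (x \<otimes>\<^bsub>?T\<^esub> y) = [(fact n :: nat)] \<cdot>\<^bsub>?T\<^esub> (\<gamma>\<^bsub>?T\<^esub> n x \<otimes>\<^bsub>?T\<^esub> \<gamma>\<^bsub>?T\<^esub> n y)"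
    if n: "n \<ge> 1" and xy: "x \<in> carrier ?T" "y \<in> carrier ?T" for n x y
  proof -
    obtain a b c d where ab: "x = (a, b)" "y = (c, d)"
      "a \<in> carrier A" "b \<in> carrier A" "c \<in> carrier A" "d \<in> carrier A" using xy by auto
    obtain k where k: "n = Suc k" using n by (metis Suc_le_D One_nat_def)
    have step: "dpl k u (u \<otimes>\<^bsub>A\<^esub> z) = [n] \<cdot>\<^bsub>A\<^esub> dpl n u z" if "u \<in> carrier A" "z \<in> carrier A" for u z
      using that dpl_dpl[of u z k 1] dpl_pos[of 1 u z] dp_one[of u] by (simp add: k)
    have main: "dpl k (u \<otimes>\<^bsub>A\<^esub> v) (u \<otimes>\<^bsub>A\<^esub> z) = [(fact n :: nat)] \<cdot>\<^bsub>A\<^esub> dpl n u (dpl k v z)"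
      if "u \<in> carrier A" "v \<in> carrier A" "z \<in> carrier A" for u v z
    proof -
      have "dpl k (u \<otimes>\<^bsub>A\<^esub> v) (u \<otimes>\<^bsub>A\<^esub> z) = [(fact k :: nat)] \<cdot>\<^bsub>A\<^esub> dpl k v (dpl k u (u \<otimes>\<^bsub>A\<^esub> z))"
        using that by (simp add: dpl_mult_base dpl_comm[of u _ v])
      also have "\<dots> = [(fact k :: nat)] \<cdot>\<^bsub>A\<^esub> ([n] \<cdot>\<^bsub>A\<^esub> dpl n u (dpl k v z))"
        using that by (simp only: step dpl_nmult dpl_closed dpl_comm[of u _ v])
      also have "\<dots> = [(fact k * n)] \<cdot>\<^bsub>A\<^esub> dpl n u (dpl k v z)"
        using that by (intro nmult_nmult) simp
      also have "fact k * n = (fact n :: nat)"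
        by (simp only: k fact_Suc of_nat_id mult.commute)
      finally show ?thesis .
    qed
    have "dpl k (a \<otimes>\<^bsub>A\<^esub> c) (a \<otimes>\<^bsub>A\<^esub> d \<oplus>\<^bsub>A\<^esub> c \<otimes>\<^bsub>A\<^esub> b)
      = dpl k (a \<otimes>\<^bsub>A\<^esub> c) (a \<otimes>\<^bsub>A\<^esub> d) \<oplus>\<^bsub>A\<^esub> dpl k (c \<otimes>\<^bsub>A\<^esub> a) (c \<otimes>\<^bsub>A\<^esub> b)"
      using ab by (simp add: dpl_add mult_comm[of a c])
    also have "\<dots> = [(fact n :: nat)] \<cdot>\<^bsub>A\<^esub> (dpl n a (dpl k c d) \<oplus>\<^bsub>A\<^esub> dpl n c (dpl k a b))"
      using ab by (simp add: main M.add.nat_pow_distrib)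
    finally show ?thesis
      using ab n k by (simp add: pow dp_prod dpl_pos)
  qed
  have ddp: "\<gamma>\<^bsub>?T\<^esub> m (\<gamma>\<^bsub>?T\<^esub> n x) = [(fact (m * n) div (fact m * fact n ^ m) :: nat)] \<cdot>\<^bsub>?T\<^esub> (\<gamma>\<^bsub>?T\<^esub> (m * n) x)"
    if mn: "m \<ge> 1" "n \<ge> 1" and x: "x \<in> carrier ?T" for m n x
  proof -
    obtain a b where ab: "x = (a, b)" "a \<in> carrier A" "b \<in> carrier A" using x by auto
    obtain i j where ij: "m = Suc i" "n = Suc j" using mn by (metis Suc_le_D One_nat_def)
    have e: "i * n + j = m * n - 1" by (simp add: ij)
    have i: "m - 1 = i" "n - 1 = j" by (simp_all add: ij)
    have "dpl i (\<gamma>\<^bsub>A\<^esub> n a) (dpl j a b) = [(dpc i n)] \<cdot>\<^bsub>A\<^esub> ([((i * n + j) choose (i * n))] \<cdot>\<^bsub>A\<^esub> dpl (i * n + j) a b)"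
      using ab mn by (simp add: dpl_dp_base dpl_dpl)
    also have "\<dots> = [(dpc i n * ((i * n + j) choose (i * n)))] \<cdot>\<^bsub>A\<^esub> dpl (i * n + j) a b"
      using ab by (intro nmult_nmult) simp
    also have "dpc i n * ((i * n + j) choose (i * n)) = dpc m n"
      using dpc_Suc[of n i] mn binomial_symmetric[of j "i * n + j"] ij e by (simp add: ac_simps)
    finally have "dpl (m - 1) (\<gamma>\<^bsub>A\<^esub> n a) (dpl (n - 1) a b)
        = [(fact (m * n) div (fact m * fact n ^ m) :: nat)] \<cdot>\<^bsub>A\<^esub> dpl (m * n - 1) a b"
      using i by (simp only: e dpc_def)
    then show ?thesis
      using ab mn by (simp add: pow dp_dp)
  qed
  have dadd: "\<gamma>\<^bsub>?T\<^esub> n (x \<oplus>\<^bsub>?T\<^esub> y) =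
      \<gamma>\<^bsub>?T\<^esub> n x \<oplus>\<^bsub>?T\<^esub> (\<Oplus>\<^bsub>?T\<^esub>l\<in>{1..n-1}. \<gamma>\<^bsub>?T\<^esub> l x \<otimes>\<^bsub>?T\<^esub> \<gamma>\<^bsub>?T\<^esub> (n - l) y) \<oplus>\<^bsub>?T\<^esub> \<gamma>\<^bsub>?T\<^esub> n y"
    if n: "n \<ge> 1" and xy: "x \<in> carrier ?T" "y \<in> carrier ?T" for n x y
  proof -
    obtain a b c d where ab: "x = (a, b)" "y = (c, d)"
      "a \<in> carrier A" "b \<in> carrier A" "c \<in> carrier A" "d \<in> carrier A" using xy by auto
    obtain m where m: "n = Suc m" using n by (metis Suc_le_D One_nat_def)
    let ?f = "\<lambda>l. \<gamma>\<^bsub>A\<^esub> l a \<otimes>\<^bsub>A\<^esub> dpl (m - l) c d"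
    let ?g = "\<lambda>l. \<gamma>\<^bsub>A\<^esub> (n - l) c \<otimes>\<^bsub>A\<^esub> dpl (l - 1) a b"
    have fg: "?f \<in> {1..m} \<rightarrow> carrier A" "?g \<in> {1..m} \<rightarrow> carrier A"
      using ab m by auto
    have 1: "dpl m (a \<oplus>\<^bsub>A\<^esub> c) d = dpl m c d \<oplus>\<^bsub>A\<^esub> finsum A ?f {1..m}"
      using ab by (subst dpl_add_base, simp_all, subst finsum_first)
        (auto intro!: arg_cong2[where f = "add A"] M.finsum_cong' simp: dpl_def)
    have "finsum A (\<lambda>l. dpl (l - 1) a (dpl (m - (l - 1)) c b)) {1..m} = finsum A ?g {1..m}"
    proof (rule M.finsum_cong')
      show "dpl (l - 1) a (dpl (m - (l - 1)) c b) = ?g l" if "l \<in> {1..m}" for l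
      proof -
        have "m - (l - 1) = n - l" "n - l \<ge> 1" using that m by auto
        then show ?thesis using ab by (simp add: dpl_pos dpl_comm[of a _ c])
      qed
    qed (use fg in auto)
    then have 2: "dpl m (a \<oplus>\<^bsub>A\<^esub> c) b = dpl m a b \<oplus>\<^bsub>A\<^esub> finsum A ?g {1..m}"
      using ab by (subst dpl_add_base, simp_all, subst finsum_last) auto
    have "dpl m (a \<oplus>\<^bsub>A\<^esub> c) (b \<oplus>\<^bsub>A\<^esub> d)
      = (dpl m a b \<oplus>\<^bsub>A\<^esub> finsum A ?g {1..m}) \<oplus>\<^bsub>A\<^esub> (dpl m c d \<oplus>\<^bsub>A\<^esub> finsum A ?f {1..m})"
      using ab by (simp add: dpl_add 1 2)
    also have "\<dots> = dpl m a b \<oplus>\<^bsub>A\<^esub> finsum A (\<lambda>l. ?f l \<oplus>\<^bsub>A\<^esub> ?g l) {1..m} \<oplus>\<^bsub>A\<^esub> dpl m c d"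
      using ab fg by (simp add: M.finsum_addf M.a_ac M.finsum_closed)
    finally have second: "dpl m (a \<oplus>\<^bsub>A\<^esub> c) (b \<oplus>\<^bsub>A\<^esub> d)
      = dpl m a b \<oplus>\<^bsub>A\<^esub> finsum A (\<lambda>l. ?f l \<oplus>\<^bsub>A\<^esub> ?g l) {1..m} \<oplus>\<^bsub>A\<^esub> dpl m c d" .
    have "(\<Oplus>\<^bsub>?T\<^esub>l\<in>{1..n-1}. \<gamma>\<^bsub>?T\<^esub> l x \<otimes>\<^bsub>?T\<^esub> \<gamma>\<^bsub>?T\<^esub> (n - l) y)
      = finsum ?T (\<lambda>l. (\<gamma>\<^bsub>A\<^esub> l a \<otimes>\<^bsub>A\<^esub> \<gamma>\<^bsub>A\<^esub> (n - l) c, ?f l \<oplus>\<^bsub>A\<^esub> ?g l)) {1..m}"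
      using ab m by (simp add: diff_right_commute)
    also have "\<dots> = (finsum A (\<lambda>l. \<gamma>\<^bsub>A\<^esub> l a \<otimes>\<^bsub>A\<^esub> \<gamma>\<^bsub>A\<^esub> (n - l) c) {1..m}, finsum A (\<lambda>l. ?f l \<oplus>\<^bsub>A\<^esub> ?g l) {1..m})"
      using ab fg m by (intro fs) auto
    finally show ?thesis
      using ab n m second by (simp add: dp_add)
  qed
  show ?thesis
  proof (intro divided_power_algebra.intro divided_power_algebra_axioms.intro)
    show "\<gamma>\<^bsub>?T\<^esub> n (x \<otimes>\<^bsub>?T\<^esub> y) = npow ?T x n \<otimes>\<^bsub>?T\<^esub> \<gamma>\<^bsub>?T\<^esub> n y"
      if "n \<ge> 1" "x \<in> carrier ?T" "y \<in> carrier ?T" for n x y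
      using that closed by (simp only: dprod npow T.mult_nmult_left)
    show "\<gamma>\<^bsub>?T\<^esub> n (x \<otimes>\<^bsub>?T\<^esub> y) = \<gamma>\<^bsub>?T\<^esub> n x \<otimes>\<^bsub>?T\<^esub> npow ?T y n"
      if "n \<ge> 1" "x \<in> carrier ?T" "y \<in> carrier ?T" for n x y
      using that closed by (simp only: dprod npow T.mult_nmult_right)
    show "\<gamma>\<^bsub>?T\<^esub> n (r \<odot>\<^bsub>?T\<^esub> x) = (r [^]\<^bsub>F\<^esub> n) \<odot>\<^bsub>?T\<^esub> \<gamma>\<^bsub>?T\<^esub> n x"
      if "n \<ge> 1" "r \<in> carrier F" "x \<in> carrier ?T" for n r x
    proof -
      note hyps = that
      obtain a b where ab: "x = (a, b)" "a \<in> carrier A" "b \<in> carrier A" using hyps(3) by auto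
      obtain m where m: "n = Suc m" using hyps(1) by (metis Suc_le_D One_nat_def)
      show ?thesis
        using ab m hyps by (simp add: dp_smult dpl_smult dpl_smult_base R.m_comm flip: smult_assoc1)
    qed
  qed (fact T.comm_nonunital_algebra_axioms closed dmult d1 dprod ddp dadd)+
qed

text \<open>By Wilson's theorem \<open>(p - 1)! = -1\<close> in \<open>F\<close>, hence \<open>a\<^sup>[\<^sup>p\<^sup>-\<^sup>1\<^sup>] = - a\<^sup>p\<^sup>-\<^sup>1\<close>.\<close>

lemma dpl_eq_minus_npow:
  assumes p: "characteristic F = p" "p > 0" and ab: "a \<in> carrier A" "b \<in> carrier A"
  shows "dpl (p - 1) a b = \<ominus>\<^bsub>A\<^esub> (npow A a (p - 1) \<otimes>\<^bsub>A\<^esub> b)"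
proof -
  have pp: "Factorial_Ring.prime p" using prime_characteristic p by simp
  then have p2: "p \<ge> 2" by (rule prime_ge_2_nat)
  have "[fact (p - 1) = (- 1 :: int)] (mod int p)"
    using wilson_theorem[of p] pp by simp
  then have "int p dvd int (fact (p - 1) + 1)"
    by (simp add: cong_iff_dvd_diff add.commute)
  then have dvd: "characteristic F dvd fact (p - 1) + 1"
    unfolding p by (simp only: int_dvd_int_iff)
  have "npow A a (p - 1) \<otimes>\<^bsub>A\<^esub> b = [(fact (p - 1) :: nat)] \<cdot>\<^bsub>A\<^esub> dpl (p - 1) a b"
    using p2 ab by (simp add: npow_eq_fact mult_nmult_left dpl_pos)
  then have "npow A a (p - 1) \<otimes>\<^bsub>A\<^esub> b \<oplus>\<^bsub>A\<^esub> dpl (p - 1) a b = [(fact (p - 1) + 1 :: nat)] \<cdot>\<^bsub>A\<^esub> dpl (p - 1) a b"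
    using ab by simp
  also have "\<dots> = \<zero>\<^bsub>A\<^esub>"
    using nmult_eq_zero[OF dvd] ab by simp
  finally show ?thesis
    using ab p2 M.minus_equality[of "dpl (p - 1) a b"] by (simp add: M.a_comm)
qed

end

lemma tangent_dpa:
  assumes A: "divided_power_algebra F A" and p: "characteristic F = p" "p > 0"
  shows "divided_power_algebra F (tangent p F A)"
    and "\<lbrakk>a \<in> carrier A; b \<in> carrier A\<rbrakk> \<Longrightarrow>
      \<gamma>\<^bsub>tangent p F A\<^esub> p (a, b) = (\<gamma>\<^bsub>A\<^esub> p a, \<ominus>\<^bsub>A\<^esub> (npow A a (p - 1) \<otimes>\<^bsub>A\<^esub> b))"
    and "\<lbrakk>n \<ge> 2; a \<in> carrier A; b \<in> carrier A\<rbrakk> \<Longrightarrow>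
      \<gamma>\<^bsub>tangent p F A\<^esub> n (a, b) = (\<gamma>\<^bsub>A\<^esub> n a, \<gamma>\<^bsub>A\<^esub> (n - 1) a \<otimes>\<^bsub>A\<^esub> b)"
proof -
  interpret A: divided_power_algebra F A by fact
  let ?P = "\<lambda>g. divided_power_algebra F (square_zero_ext A g) \<and>
     (\<forall>a\<in>carrier A. \<forall>b\<in>carrier A. g p (a, b) = (\<gamma>\<^bsub>A\<^esub> p a, \<ominus>\<^bsub>A\<^esub> (npow A a (p - 1) \<otimes>\<^bsub>A\<^esub> b)))"
  have t: "?P A.tdp"
    using A.tdp_dpa A.dpl_eq_minus_npow[OF p] by (simp add: A.tdp_def)
  define g where "g = (SOME g. ?P g)"
  have g: "?P g"
    unfolding g_def by (rule someI[of ?P, OF t])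
  have tan: "tangent p F A = square_zero_ext A g"
    by (simp add: tangent_def g_def)
  show "divided_power_algebra F (tangent p F A)"
    using g by (simp add: tan)
  show "\<gamma>\<^bsub>tangent p F A\<^esub> p (a, b) = (\<gamma>\<^bsub>A\<^esub> p a, \<ominus>\<^bsub>A\<^esub> (npow A a (p - 1) \<otimes>\<^bsub>A\<^esub> b))"
    if "a \<in> carrier A" "b \<in> carrier A"
    using g that by (simp add: tan square_zero_ext_def)
  show "\<gamma>\<^bsub>tangent p F A\<^esub> n (a, b) = (\<gamma>\<^bsub>A\<^esub> n a, \<gamma>\<^bsub>A\<^esub> (n - 1) a \<otimes>\<^bsub>A\<^esub> b)"
    if n: "n \<ge> 2" and ab: "a \<in> carrier A" "b \<in> carrier A"
  proof -
    have "(square_zero_ext A A.tdp)\<lparr>dp := g\<rparr> = square_zero_ext A g"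
      by (simp add: square_zero_ext_def)
    then have "g n (a, b) = \<gamma>\<^bsub>square_zero_ext A A.tdp\<^esub> n (a, b)"
      using t g p n ab
      by (intro dp_determined[of F "square_zero_ext A A.tdp" g p n "(a, b)"])
        (auto simp: square_zero_ext_def)
    then show ?thesis
      using n by (simp add: tan square_zero_ext_def A.tdp_def A.dpl_def)
  qed
qed

section \<open>The adjunction\<close>

lemma (in abelian_monoid) finsum_atLeast1_Suc:
  assumes "f \<in> {1..Suc k} \<rightarrow> carrier G"
  shows "finsum G f {1..Suc k} = finsum G f {1..k} \<oplus> f (Suc k)"
proof -
  have "{1..Suc k} = insert (Suc k) {1..k}" by auto
  then show ?thesis
    using assms by (simp add: finsum_insert Pi_iff a_comm)
qed

lemma gsum_gterms:
  "(\<And>l. \<lbrakk>1 \<le> l; l \<le> k\<rbrakk> \<Longrightarrow> f l \<in> gterms F A M) \<Longrightarrow> gsum f k \<in> gterms F A M"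
  by (induction k) (auto intro: gterms.intros)

lemma gnat_gterms: "t \<in> gterms F A M \<Longrightarrow> gnat k t \<in> gterms F A M"
  unfolding gnat_def by (rule gsum_gterms)

lemma gpow_gterms: "\<lbrakk>n \<ge> 1; t \<in> gterms F A M\<rbrakk> \<Longrightarrow> gpow t n \<in> gterms F A M"
proof (induction n rule: nat_induct_at_least)
  case (Suc n)
  then show ?case by (cases n) (auto intro: gterms.intros)
qed simp

locale gamma_data = A: divided_power_algebra F A + M: nonunital_module F A M
  for F :: "('f, 'k) ring_scheme" (structure) and A :: "('f, 'a, 'u) dp_algebra_scheme" (structure)
    and M :: "('f, 'a, 'm, 'v) act_module_scheme" (structure)
begin

lemma gamma_eq_gterms: "gamma_eq F A M s t \<Longrightarrow> s \<in> gterms F A M \<and> t \<in> gterms F A M"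
  by (induction rule: gamma_eq.induct)
     (auto intro!: gterms.intros gsum_gterms gnat_gterms gpow_gterms)

abbreviation (input) cl where "cl t \<equiv> gamma_rel F A M `` {t}"

abbreviation (input) T where "T \<equiv> gterms F A M"

abbreviation (input) G where "G \<equiv> gamma_algebra F A M"

lemma equiv_gamma_rel: "equiv T (gamma_rel F A M)"
proof (rule equivI)
  show "gamma_rel F A M \<subseteq> T \<times> T"
    using gamma_eq_gterms by (auto simp: gamma_rel_def)
  show "refl_on T (gamma_rel F A M)"
    by (auto simp: refl_on_def gamma_rel_def intro: gamma_eq.gam_refl)
  show "sym (gamma_rel F A M)"
    by (auto simp: sym_def gamma_rel_def intro: gamma_eq.gam_sym)
  show "trans (gamma_rel F A M)"
    by (auto simp: trans_def gamma_rel_def intro: gamma_eq.gam_trans)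
qed

lemma cl_eqI: "gamma_eq F A M s t \<Longrightarrow> cl s = cl t"
  by (rule equiv_class_eq[OF equiv_gamma_rel]) (simp add: gamma_rel_def)

lemma in_cl: "u \<in> cl t \<longleftrightarrow> gamma_eq F A M t u"
  by (simp add: gamma_rel_def)

lemma cl_gterms: "u \<in> cl t \<Longrightarrow> u \<in> T"
  using gamma_eq_gterms[of t u] by (simp add: gamma_rel_def)

lemma carrier_G: "carrier G = cl ` T"
  by (auto simp: gamma_algebra_def Let_def quotient_def)

lemma cl_closed [simp, intro]: "t \<in> T \<Longrightarrow> cl t \<in> carrier G"
  by (simp add: carrier_G)

lemma zero_G [simp]: "\<zero>\<^bsub>G\<^esub> = cl GZero"
  by (simp add: gamma_algebra_def Let_def)

lemma UN_cl: "\<lbrakk>t \<in> T; \<And>u. gamma_eq F A M t u \<Longrightarrow> f u = f t\<rbrakk> \<Longrightarrow> (\<Union>u\<in>cl t. f u) = f t"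
  unfolding in_cl[symmetric] using equiv_class_self[OF equiv_gamma_rel, of t] by blast

lemma add_G [simp]: "\<lbrakk>s \<in> T; t \<in> T\<rbrakk> \<Longrightarrow> cl s \<oplus>\<^bsub>G\<^esub> cl t = cl (GAdd s t)"
proof -
  assume st: "s \<in> T" "t \<in> T"
  have inner: "(\<Union>v\<in>cl t. cl (GAdd u v)) = cl (GAdd u t)" if "u \<in> T" for u
    using st that by (intro UN_cl cl_eqI gamma_eq.gam_cong_add) (auto intro: gamma_eq.intros(1,2))
  have "(\<Union>u\<in>cl s. \<Union>v\<in>cl t. cl (GAdd u v)) = (\<Union>u\<in>cl s. cl (GAdd u t))"
    by (rule SUP_cong[OF refl], drule cl_gterms) (rule inner)
  also have "\<dots> = cl (GAdd s t)"
    using st by (intro UN_cl cl_eqI gamma_eq.gam_cong_add) (auto intro: gamma_eq.intros(1,2))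
  finally show ?thesis by (simp add: gamma_algebra_def Let_def)
qed

lemma mult_G [simp]: "\<lbrakk>s \<in> T; t \<in> T\<rbrakk> \<Longrightarrow> cl s \<otimes>\<^bsub>G\<^esub> cl t = cl (GMult s t)"
proof -
  assume st: "s \<in> T" "t \<in> T"
  have inner: "(\<Union>v\<in>cl t. cl (GMult u v)) = cl (GMult u t)" if "u \<in> T" for u
    using st that by (intro UN_cl cl_eqI gamma_eq.gam_cong_mult) (auto intro: gamma_eq.intros(1,2))
  have "(\<Union>u\<in>cl s. \<Union>v\<in>cl t. cl (GMult u v)) = (\<Union>u\<in>cl s. cl (GMult u t))"
    by (rule SUP_cong[OF refl], drule cl_gterms) (rule inner)
  also have "\<dots> = cl (GMult s t)"
    using st by (intro UN_cl cl_eqI gamma_eq.gam_cong_mult) (auto intro: gamma_eq.intros(1,2))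
  finally show ?thesis by (simp add: gamma_algebra_def Let_def)
qed

lemma smult_G [simp]: "\<lbrakk>r \<in> carrier F; t \<in> T\<rbrakk> \<Longrightarrow> r \<odot>\<^bsub>G\<^esub> cl t = cl (GSmult r t)"
  by (simp add: gamma_algebra_def Let_def UN_cl cl_eqI gamma_eq.gam_cong_smult gamma_eq.gam_sym)

lemma dp_G [simp]: "\<lbrakk>n \<ge> 1; t \<in> T\<rbrakk> \<Longrightarrow> \<gamma>\<^bsub>G\<^esub> n (cl t) = cl (GDp n t)"
  by (simp add: gamma_algebra_def Let_def UN_cl cl_eqI gamma_eq.gam_cong_dp gamma_eq.gam_sym)

lemma gamma_dpa: "divided_power_algebra F G"
proof -
  note [rule del] = subset_antisym
  note [intro] = gterms.intros
  note [simp] = gterms.intros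
  have grp: "abelian_group G"
  proof (rule abelian_groupI)
    show "x \<oplus>\<^bsub>G\<^esub> y \<oplus>\<^bsub>G\<^esub> z = x \<oplus>\<^bsub>G\<^esub> (y \<oplus>\<^bsub>G\<^esub> z)"
      if "x \<in> carrier G" "y \<in> carrier G" "z \<in> carrier G" for x y z
      using that by (auto simp: carrier_G intro!: cl_eqI gamma_eq.gam_add_assoc)
    show "x \<oplus>\<^bsub>G\<^esub> y = y \<oplus>\<^bsub>G\<^esub> x" if "x \<in> carrier G" "y \<in> carrier G" for x y
      using that by (auto simp: carrier_G intro!: cl_eqI gamma_eq.gam_add_comm)
    show "\<zero>\<^bsub>G\<^esub> \<oplus>\<^bsub>G\<^esub> x = x" if "x \<in> carrier G" for x
      using that by (auto simp: carrier_G intro!: cl_eqI gamma_eq.gam_add_zero)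
    show "\<exists>y\<in>carrier G. y \<oplus>\<^bsub>G\<^esub> x = \<zero>\<^bsub>G\<^esub>" if "x \<in> carrier G" for x
    proof -
      note x = that
      obtain t where t: "x = cl t" "t \<in> T" using x unfolding carrier_G by blast
      then have "cl (GSmult (\<ominus> \<one>) t) \<oplus>\<^bsub>G\<^esub> x = \<zero>\<^bsub>G\<^esub>"
        by (auto intro!: cl_eqI gamma_eq.gam_add_neg)
      then show ?thesis using t by blast
    qed
  qed (auto simp: carrier_G)
  have mod: "module F G"
  proof (rule moduleI[OF A.R.is_cring grp])
    show "(r \<oplus> r') \<odot>\<^bsub>G\<^esub> x = r \<odot>\<^bsub>G\<^esub> x \<oplus>\<^bsub>G\<^esub> r' \<odot>\<^bsub>G\<^esub> x"
      if "r \<in> carrier F" "r' \<in> carrier F" "x \<in> carrier G" for r r' x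
      using that by (auto simp: carrier_G intro!: cl_eqI gamma_eq.gam_smult_add_left)
    show "r \<odot>\<^bsub>G\<^esub> (x \<oplus>\<^bsub>G\<^esub> y) = r \<odot>\<^bsub>G\<^esub> x \<oplus>\<^bsub>G\<^esub> r \<odot>\<^bsub>G\<^esub> y"
      if "r \<in> carrier F" "x \<in> carrier G" "y \<in> carrier G" for r x y
      using that by (auto simp: carrier_G intro!: cl_eqI gamma_eq.gam_smult_add_right)
    show "r \<otimes> r' \<odot>\<^bsub>G\<^esub> x = r \<odot>\<^bsub>G\<^esub> (r' \<odot>\<^bsub>G\<^esub> x)"
      if "r \<in> carrier F" "r' \<in> carrier F" "x \<in> carrier G" for r r' x
      using that by (auto simp: carrier_G intro!: cl_eqI gamma_eq.gam_smult_assoc)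
    show "\<one> \<odot>\<^bsub>G\<^esub> x = x" if "x \<in> carrier G" for x
      using that by (auto simp: carrier_G intro!: cl_eqI gamma_eq.gam_smult_one)
  qed (auto simp: carrier_G)
  have "comm_nonunital_algebra_axioms F G"
  proof
    show "x \<otimes>\<^bsub>G\<^esub> y \<otimes>\<^bsub>G\<^esub> z = x \<otimes>\<^bsub>G\<^esub> (y \<otimes>\<^bsub>G\<^esub> z)"
      if "x \<in> carrier G" "y \<in> carrier G" "z \<in> carrier G" for x y z
      using that by (auto simp: carrier_G intro!: cl_eqI gamma_eq.gam_mult_assoc)
    show "x \<otimes>\<^bsub>G\<^esub> y = y \<otimes>\<^bsub>G\<^esub> x" if "x \<in> carrier G" "y \<in> carrier G" for x y
      using that by (auto simp: carrier_G intro!: cl_eqI gamma_eq.gam_mult_comm)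
    show "(x \<oplus>\<^bsub>G\<^esub> y) \<otimes>\<^bsub>G\<^esub> z = x \<otimes>\<^bsub>G\<^esub> z \<oplus>\<^bsub>G\<^esub> y \<otimes>\<^bsub>G\<^esub> z"
      if "x \<in> carrier G" "y \<in> carrier G" "z \<in> carrier G" for x y z
      using that by (auto simp: carrier_G intro!: cl_eqI gamma_eq.gam_mult_add)
    show "(r \<odot>\<^bsub>G\<^esub> x) \<otimes>\<^bsub>G\<^esub> y = r \<odot>\<^bsub>G\<^esub> (x \<otimes>\<^bsub>G\<^esub> y)"
      if "r \<in> carrier F" "x \<in> carrier G" "y \<in> carrier G" for r x y
      using that by (auto simp: carrier_G intro!: cl_eqI gamma_eq.gam_mult_smult)
  qed (auto simp: carrier_G)
  then interpret G: comm_nonunital_algebra F G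
    by (intro comm_nonunital_algebra.intro mod A.F.field_axioms)
  have sum: "finsum G (\<lambda>l. cl (f l)) {1..k} = cl (gsum f k)"
    if "\<And>l. \<lbrakk>1 \<le> l; l \<le> k\<rbrakk> \<Longrightarrow> f l \<in> T" for f k
    using that
  proof (induction k)
    case (Suc k)
    then show ?case
      using G.M.finsum_atLeast1_Suc[of "\<lambda>l. cl (f l)" k] by (auto simp: gsum_gterms)
  qed simp
  have nat: "[k] \<cdot>\<^bsub>G\<^esub> cl t = cl (gnat k t)" if "t \<in> T" for k :: nat and t
    using that gnat_gterms[of t F A M]
    by (induction k) (simp_all add: gnat_def)
  have npow: "npow G (cl t) n = cl (gpow t n)" if "n \<ge> 1" "t \<in> T" for n t
    using that
  proof (induction n rule: nat_induct_at_least)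
    case (Suc n)
    then show ?case by (cases n) (auto simp: gpow_gterms)
  qed simp
  have [simp]: "r [^] (n :: nat) \<in> carrier F" if "r \<in> carrier F" for r n
    using that by simp
  show ?thesis
  proof (intro divided_power_algebra.intro divided_power_algebra_axioms.intro)
    show "comm_nonunital_algebra F G" by unfold_locales
    fix n :: nat assume n: "n \<ge> 1"
    show "\<gamma>\<^bsub>G\<^esub> n x \<in> carrier G" if "x \<in> carrier G" for x
      using that n by (auto simp: carrier_G)
    show "\<gamma>\<^bsub>G\<^esub> n (r \<odot>\<^bsub>G\<^esub> x) = (r [^] n) \<odot>\<^bsub>G\<^esub> \<gamma>\<^bsub>G\<^esub> n x"
      if "r \<in> carrier F" "x \<in> carrier G" for r x
      using that n by (auto simp: carrier_G intro!: cl_eqI gamma_eq.gam_dp_smult)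
    show "\<gamma>\<^bsub>G\<^esub> n (x \<oplus>\<^bsub>G\<^esub> y) =
        \<gamma>\<^bsub>G\<^esub> n x \<oplus>\<^bsub>G\<^esub> (\<Oplus>\<^bsub>G\<^esub>l\<in>{1..n-1}. \<gamma>\<^bsub>G\<^esub> l x \<otimes>\<^bsub>G\<^esub> \<gamma>\<^bsub>G\<^esub> (n - l) y) \<oplus>\<^bsub>G\<^esub> \<gamma>\<^bsub>G\<^esub> n y"
      if xy: "x \<in> carrier G" "y \<in> carrier G" for x y
    proof -
      obtain s t where st: "x = cl s" "y = cl t" "s \<in> T" "t \<in> T" using xy unfolding carrier_G by blast
      let ?f = "\<lambda>l. GMult (GDp l s) (GDp (n - l) t)"
      have "(\<Oplus>\<^bsub>G\<^esub>l\<in>{1..n-1}. \<gamma>\<^bsub>G\<^esub> l x \<otimes>\<^bsub>G\<^esub> \<gamma>\<^bsub>G\<^esub> (n - l) y) = (\<Oplus>\<^bsub>G\<^esub>l\<in>{1..n-1}. cl (?f l))"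
        using st n by (intro G.M.finsum_cong') auto
      also have "\<dots> = cl (gsum ?f (n - 1))"
        using st n by (intro sum) auto
      finally have "(\<Oplus>\<^bsub>G\<^esub>l\<in>{1..n-1}. \<gamma>\<^bsub>G\<^esub> l x \<otimes>\<^bsub>G\<^esub> \<gamma>\<^bsub>G\<^esub> (n - l) y) = cl (gsum ?f (n - 1))" .
      moreover have "gsum ?f (n - 1) \<in> T" using st n by (intro gsum_gterms) auto
      ultimately show ?thesis
        using st n gamma_eq.gam_dp_add[OF n st(3,4)] by (simp add: cl_eqI)
    qed
    show "\<gamma>\<^bsub>G\<^esub> n (x \<otimes>\<^bsub>G\<^esub> y) = [(fact n :: nat)] \<cdot>\<^bsub>G\<^esub> (\<gamma>\<^bsub>G\<^esub> n x \<otimes>\<^bsub>G\<^esub> \<gamma>\<^bsub>G\<^esub> n y)"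
      if "x \<in> carrier G" "y \<in> carrier G" for x y
      using that n by (auto simp: carrier_G nat intro!: cl_eqI gamma_eq.gam_dp_prod)
    show "\<gamma>\<^bsub>G\<^esub> n (x \<otimes>\<^bsub>G\<^esub> y) = npow G x n \<otimes>\<^bsub>G\<^esub> \<gamma>\<^bsub>G\<^esub> n y"
      if "x \<in> carrier G" "y \<in> carrier G" for x y
      using that n by (auto simp: carrier_G npow gpow_gterms intro!: cl_eqI gamma_eq.gam_dp_prod_left)
    show "\<gamma>\<^bsub>G\<^esub> n (x \<otimes>\<^bsub>G\<^esub> y) = \<gamma>\<^bsub>G\<^esub> n x \<otimes>\<^bsub>G\<^esub> npow G y n"
      if "x \<in> carrier G" "y \<in> carrier G" for x y
      using that n by (auto simp: carrier_G npow gpow_gterms intro!: cl_eqI gamma_eq.gam_dp_prod_right)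
    fix m :: nat assume m: "m \<ge> 1"
    show "\<gamma>\<^bsub>G\<^esub> m x \<otimes>\<^bsub>G\<^esub> \<gamma>\<^bsub>G\<^esub> n x = [((m + n) choose m)] \<cdot>\<^bsub>G\<^esub> (\<gamma>\<^bsub>G\<^esub> (m + n) x)"
      if "x \<in> carrier G" for x
      using that m n by (auto simp: carrier_G nat intro!: cl_eqI gamma_eq.gam_dp_mult)
    show "\<gamma>\<^bsub>G\<^esub> m (\<gamma>\<^bsub>G\<^esub> n x) = [(fact (m * n) div (fact m * fact n ^ m) :: nat)] \<cdot>\<^bsub>G\<^esub> (\<gamma>\<^bsub>G\<^esub> (m * n) x)"
      if "x \<in> carrier G" for x
      using that m n by (auto simp: carrier_G nat intro!: cl_eqI gamma_eq.gam_dp_dp)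
  next
    show "\<gamma>\<^bsub>G\<^esub> 1 x = x" if "x \<in> carrier G" for x
      using that gamma_eq.gam_dp_one by (auto simp: carrier_G intro!: cl_eqI)
  qed
qed

lemma gamma_base_hom: "gamma_base F A M \<in> dp_hom F A G"
  unfolding dp_hom_def gamma_base_def
  by (auto simp: gterms.intros
      intro!: cl_eqI gamma_eq.gam_base_add gamma_eq.gam_base_smult gamma_eq.gam_base_mult gamma_eq.gam_base_dp
      del: subset_antisym)

lemma gamma_gen_closed: "x \<in> carrier M \<Longrightarrow> gamma_gen F A M x \<in> carrier G"
  by (auto simp: gamma_gen_def gterms.intros)

lemma gamma_gen_add:
  "\<lbrakk>x \<in> carrier M; y \<in> carrier M\<rbrakk> \<Longrightarrow>
    gamma_gen F A M (x \<oplus>\<^bsub>M\<^esub> y) = gamma_gen F A M x \<oplus>\<^bsub>G\<^esub> gamma_gen F A M y"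
  by (auto simp: gamma_gen_def gterms.intros intro!: cl_eqI gamma_eq.gam_gen_add del: subset_antisym)

lemma gamma_gen_smult:
  "\<lbrakk>r \<in> carrier F; x \<in> carrier M\<rbrakk> \<Longrightarrow>
    gamma_gen F A M (r \<odot>\<^bsub>M\<^esub> x) = r \<odot>\<^bsub>G\<^esub> gamma_gen F A M x"
  by (auto simp: gamma_gen_def gterms.intros intro!: cl_eqI gamma_eq.gam_gen_smult del: subset_antisym)

lemma gamma_gen_act:
  "\<lbrakk>a \<in> carrier A; x \<in> carrier M\<rbrakk> \<Longrightarrow>
    gamma_gen F A M (a \<triangleright>\<^bsub>M\<^esub> x) = gamma_base F A M a \<otimes>\<^bsub>G\<^esub> gamma_gen F A M x"
  by (auto simp: gamma_gen_def gamma_base_def gterms.intros intro!: cl_eqI gamma_eq.gam_gen_act del: subset_antisym)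

end

primrec geval ::
  "('f, 'b, 'w) dp_algebra_scheme \<Rightarrow> ('a \<Rightarrow> 'b) \<Rightarrow> ('m \<Rightarrow> 'b) \<Rightarrow> ('f, 'a, 'm) gterm \<Rightarrow> 'b" where
  "geval B f g (GBase a) = f a"
| "geval B f g (GGen x) = g x"
| "geval B f g GZero = \<zero>\<^bsub>B\<^esub>"
| "geval B f g (GAdd s t) = geval B f g s \<oplus>\<^bsub>B\<^esub> geval B f g t"
| "geval B f g (GSmult r t) = r \<odot>\<^bsub>B\<^esub> geval B f g t"
| "geval B f g (GMult s t) = geval B f g s \<otimes>\<^bsub>B\<^esub> geval B f g t"
| "geval B f g (GDp n t) = \<gamma>\<^bsub>B\<^esub> n (geval B f g t)"

lemma (in gamma_data) gamma_universal:
  fixes B :: "('f, 'b, 'w) dp_algebra_scheme"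
  assumes B: "divided_power_algebra F B" and f: "f \<in> dp_hom F A B"
    and g: "g \<in> carrier M \<rightarrow> carrier B"
      "\<And>x y. \<lbrakk>x \<in> carrier M; y \<in> carrier M\<rbrakk> \<Longrightarrow> g (x \<oplus>\<^bsub>M\<^esub> y) = g x \<oplus>\<^bsub>B\<^esub> g y"
      "\<And>r x. \<lbrakk>r \<in> carrier F; x \<in> carrier M\<rbrakk> \<Longrightarrow> g (r \<odot>\<^bsub>M\<^esub> x) = r \<odot>\<^bsub>B\<^esub> g x"
      "\<And>a x. \<lbrakk>a \<in> carrier A; x \<in> carrier M\<rbrakk> \<Longrightarrow> g (a \<triangleright>\<^bsub>M\<^esub> x) = f a \<otimes>\<^bsub>B\<^esub> g x"
  shows "\<exists>!h. h \<in> dp_hom F G B \<inter> extensional (carrier G) \<and>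
    (\<forall>a\<in>carrier A. h (gamma_base F A M a) = f a) \<and>
    (\<forall>x\<in>carrier M. h (gamma_gen F A M x) = g x)"
proof -
  interpret B: divided_power_algebra F B by fact
  interpret G: divided_power_algebra F G by (rule gamma_dpa)
  note [simp] = gterms.intros
  have f0: "f a \<in> carrier B" if "a \<in> carrier A" for a
    using f that by (auto simp: dp_hom_def)
  have f1: "f (a \<oplus>\<^bsub>A\<^esub> b) = f a \<oplus>\<^bsub>B\<^esub> f b" "f (a \<otimes>\<^bsub>A\<^esub> b) = f a \<otimes>\<^bsub>B\<^esub> f b"
    if "a \<in> carrier A" "b \<in> carrier A" for a b
    using f that by (auto simp: dp_hom_def)
  have f2: "f (r \<odot>\<^bsub>A\<^esub> a) = r \<odot>\<^bsub>B\<^esub> f a" if "r \<in> carrier F" "a \<in> carrier A" for r a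
    using f that by (auto simp: dp_hom_def)
  have f3: "f (\<gamma>\<^bsub>A\<^esub> n a) = \<gamma>\<^bsub>B\<^esub> n (f a)" if "n \<ge> 1" "a \<in> carrier A" for n a
    using f that by (auto simp: dp_hom_def)
  let ?e = "geval B f g"
  have e [simp, intro]: "?e t \<in> carrier B" if "t \<in> T" for t
    using that by induction (use f0 g(1) in auto)
  have sum: "?e (gsum u k) = finsum B (\<lambda>l. ?e (u l)) {1..k}"
    if "\<And>l. \<lbrakk>1 \<le> l; l \<le> k\<rbrakk> \<Longrightarrow> u l \<in> T" for u k
    using that
  proof (induction k)
    case (Suc k)
    then show ?case
      using B.M.finsum_atLeast1_Suc[of "\<lambda>l. ?e (u l)" k] by auto
  qed simp
  have nat: "?e (gnat k t) = [k] \<cdot>\<^bsub>B\<^esub> ?e t" for k t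
    by (induction k) (simp_all add: gnat_def)
  have npow: "?e (gpow t n) = npow B (?e t) n" if "n \<ge> 1" for n t
    using that
  proof (induction n rule: nat_induct_at_least)
    case (Suc n)
    then show ?case by (cases n) auto
  qed simp
  have eq: "?e s = ?e t" if "gamma_eq F A M s t" for s t
    using that
  proof (induction rule: gamma_eq.induct)
    case (gam_add_neg t)
    then show ?case
      by (simp add: B.smult_l_minus B.M.l_neg)
  next
    case (gam_dp_add n s t)
    then show ?case
      by (subst geval.simps, subst geval.simps, subst B.dp_add) (auto simp: sum)
  next
    case (gam_add_comm s t)
    then show ?case by (simp add: B.M.a_comm)
  next
    case (gam_mult_comm s t)
    then show ?case by (simp add: B.mult_comm)
  next
    case (gam_dp_one t)
    then show ?case using B.dp_one by auto
  qed (use gamma_eq_gterms f0 g in \<open>auto simp: B.M.a_assoc B.smult_l_distr B.smult_r_distr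
        B.smult_assoc1 B.mult_assoc B.mult_add_left B.mult_smult_left B.dp_smult B.dp_mult
        B.dp_dp nat npow f1 f2 f3 B.dp_prod Pi_iff
        simp flip: B.dp_prod_left B.dp_prod_right\<close>)
  define h where "h = (\<lambda>X\<in>carrier G. ?e (SOME t. t \<in> X))"
  have h: "h (cl t) = ?e t" if "t \<in> T" for t
  proof -
    have "t \<in> cl t" using that by (simp add: gamma_rel_def gamma_eq.gam_refl)
    then have "gamma_eq F A M t (SOME u. u \<in> cl t)"
      unfolding in_cl[symmetric] by (rule someI)
    then show ?thesis using eq that by (simp add: h_def)
  qed
  have hom: "h \<in> dp_hom F G B"
    by (auto simp: dp_hom_def carrier_G h)
  show ?thesis
  proof (rule ex1I[of _ h])
    show "h \<in> dp_hom F G B \<inter> extensional (carrier G) \<and>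
      (\<forall>a\<in>carrier A. h (gamma_base F A M a) = f a) \<and>
      (\<forall>x\<in>carrier M. h (gamma_gen F A M x) = g x)"
      using hom by (auto simp: gamma_base_def gamma_gen_def h) (simp add: h_def)
  next
    fix h' assume h': "h' \<in> dp_hom F G B \<inter> extensional (carrier G) \<and>
      (\<forall>a\<in>carrier A. h' (gamma_base F A M a) = f a) \<and>
      (\<forall>x\<in>carrier M. h' (gamma_gen F A M x) = g x)"
    then have c: "h' X \<in> carrier B" if "X \<in> carrier G" for X
      using that by (auto simp: dp_hom_def)
    have p1: "h' (X \<oplus>\<^bsub>G\<^esub> Y) = h' X \<oplus>\<^bsub>B\<^esub> h' Y" "h' (X \<otimes>\<^bsub>G\<^esub> Y) = h' X \<otimes>\<^bsub>B\<^esub> h' Y"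
      if "X \<in> carrier G" "Y \<in> carrier G" for X Y
      using h' that by (auto simp: dp_hom_def)
    have p2: "h' (r \<odot>\<^bsub>G\<^esub> X) = r \<odot>\<^bsub>B\<^esub> h' X" if "r \<in> carrier F" "X \<in> carrier G" for r X
      using h' that by (auto simp: dp_hom_def)
    have p3: "h' (\<gamma>\<^bsub>G\<^esub> n X) = \<gamma>\<^bsub>B\<^esub> n (h' X)" if "n \<ge> 1" "X \<in> carrier G" for n X
      using h' that by (auto simp: dp_hom_def)
    have "h' (cl t) = ?e t" if "t \<in> T" for t
      using that
    proof induction
      case term_zero
      have "h' \<zero>\<^bsub>G\<^esub> = h' (\<zero>\<^bsub>F\<^esub> \<odot>\<^bsub>G\<^esub> \<zero>\<^bsub>G\<^esub>)"
        by (simp only: G.smult_l_null G.M.zero_closed)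
      also have "\<dots> = \<zero>\<^bsub>B\<^esub>"
        using c[OF G.M.zero_closed] by (simp only: p2 A.R.zero_closed G.M.zero_closed B.smult_l_null)
      finally show ?case by simp
    next
      case (term_add s t)
      then show ?case using p1(1)[of "cl s" "cl t"] by simp
    next
      case (term_mult s t)
      then show ?case using p1(2)[of "cl s" "cl t"] by simp
    next
      case (term_smult r t)
      then show ?case using p2[of r "cl t"] by simp
    next
      case (term_dp n t)
      then show ?case using p3[of n "cl t"] by simp
    qed (use h' in \<open>auto simp: gamma_base_def gamma_gen_def\<close>)
    then have "h' X = h X" if "X \<in> carrier G" for X
      using that h by (auto simp: carrier_G)
    then show "h' = h"
      using h' by (intro extensionalityI[of _ "carrier G"]) (auto simp: h_def)
  qed
qed

section \<open>The modules of differentials\<close>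

lemma (in comm_nonunital_algebra) free_act_module:
  "nonunital_module F A (free_act_module F A S)"
proof -
  let ?L = "free_act_module F A S"
  have mem: "u \<in> carrier ?L \<longleftrightarrow> (\<forall>s. fst (u s) \<in> carrier F \<and> snd (u s) \<in> carrier A) \<and>
      (\<forall>s. s \<notin> S \<longrightarrow> u s = (\<zero>, \<zero>\<^bsub>A\<^esub>)) \<and> finite {s. u s \<noteq> (\<zero>, \<zero>\<^bsub>A\<^esub>)}" for u
    by (auto simp: free_act_module_def Pi_iff mem_Times_iff)
  have ops [simp]:
    "(u \<oplus>\<^bsub>?L\<^esub> v) s = (fst (u s) \<oplus> fst (v s), snd (u s) \<oplus>\<^bsub>A\<^esub> snd (v s))"
    "\<zero>\<^bsub>?L\<^esub> s = (\<zero>, \<zero>\<^bsub>A\<^esub>)"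
    "(r \<odot>\<^bsub>?L\<^esub> u) s = (r \<otimes> fst (u s), r \<odot>\<^bsub>A\<^esub> snd (u s))"
    "(a \<triangleright>\<^bsub>?L\<^esub> u) s = (\<zero>, (fst (u s) \<odot>\<^bsub>A\<^esub> a) \<oplus>\<^bsub>A\<^esub> (a \<otimes>\<^bsub>A\<^esub> snd (u s)))" for u v s r a
    by (simp_all add: free_act_module_def)
  have fin2: "finite {s. h s \<noteq> (\<zero>, \<zero>\<^bsub>A\<^esub>)}"
    if "finite {s. u s \<noteq> (\<zero>, \<zero>\<^bsub>A\<^esub>)}" "finite {s. v s \<noteq> (\<zero>, \<zero>\<^bsub>A\<^esub>)}"
      "\<And>s. \<lbrakk>u s = (\<zero>, \<zero>\<^bsub>A\<^esub>); v s = (\<zero>, \<zero>\<^bsub>A\<^esub>)\<rbrakk> \<Longrightarrow> h s = (\<zero>, \<zero>\<^bsub>A\<^esub>)" for u v h :: "'s \<Rightarrow> _"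
    by (rule finite_subset[OF _ finite_UnI[OF that(1,2)]]) (use that(3) in auto)
  have add: "u \<oplus>\<^bsub>?L\<^esub> v \<in> carrier ?L" if "u \<in> carrier ?L" "v \<in> carrier ?L" for u v
    unfolding mem
  proof (intro conjI)
    show "finite {s. (u \<oplus>\<^bsub>?L\<^esub> v) s \<noteq> (\<zero>, \<zero>\<^bsub>A\<^esub>)}"
      by (rule fin2[of u v]) (use that in \<open>auto simp: mem\<close>)
  qed (use that in \<open>auto simp: mem\<close>)
  have smul: "r \<odot>\<^bsub>?L\<^esub> u \<in> carrier ?L" if "r \<in> carrier F" "u \<in> carrier ?L" for r u
    unfolding mem
  proof (intro conjI)
    show "finite {s. (r \<odot>\<^bsub>?L\<^esub> u) s \<noteq> (\<zero>, \<zero>\<^bsub>A\<^esub>)}"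
      by (rule fin2[of u u]) (use that in \<open>auto simp: mem\<close>)
  qed (use that in \<open>auto simp: mem\<close>)
  have act: "a \<triangleright>\<^bsub>?L\<^esub> u \<in> carrier ?L" if "a \<in> carrier A" "u \<in> carrier ?L" for a u
    unfolding mem
  proof (intro conjI)
    show "finite {s. (a \<triangleright>\<^bsub>?L\<^esub> u) s \<noteq> (\<zero>, \<zero>\<^bsub>A\<^esub>)}"
      by (rule fin2[of u u]) (use that in \<open>auto simp: mem\<close>)
  qed (use that in \<open>auto simp: mem\<close>)
  have zero: "\<zero>\<^bsub>?L\<^esub> \<in> carrier ?L"
    unfolding mem by simp
  have neg: "(\<ominus> \<one>) \<odot>\<^bsub>?L\<^esub> u \<oplus>\<^bsub>?L\<^esub> u = \<zero>\<^bsub>?L\<^esub>" if "u \<in> carrier ?L" for u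
    using that unfolding mem
    by (intro ext) (simp add: R.l_minus smult_l_minus R.l_neg M.l_neg)
  have grp: "abelian_group ?L"
  proof (rule abelian_groupI)
    show "\<exists>v\<in>carrier ?L. v \<oplus>\<^bsub>?L\<^esub> u = \<zero>\<^bsub>?L\<^esub>" if "u \<in> carrier ?L" for u
      using neg[OF that] smul[OF R.a_inv_closed[OF R.one_closed] that] by blast
    show "u \<oplus>\<^bsub>?L\<^esub> v \<in> carrier ?L" if "u \<in> carrier ?L" "v \<in> carrier ?L" for u v
      using that by (rule add)
  qed (auto simp: zero fun_eq_iff mem R.a_ac M.a_ac)
  have mod: "module F ?L"
    by (rule moduleI[OF R.is_cring grp smul])
      (auto simp: fun_eq_iff mem R.l_distr R.r_distr smult_l_distr smult_r_distr R.m_assoc smult_assoc1)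
  show ?thesis
    by (intro nonunital_module.intro nonunital_module_axioms.intro mod
          comm_nonunital_algebra_axioms act)
      (auto simp: fun_eq_iff mem smult_r_distr smult_l_distr mult_add_left mult_add_right M.a_ac
        mult_smult_left mult_smult_right R.m_comm mult_assoc simp flip: smult_assoc1)
qed

lemma (in comm_nonunital_algebra) free_gen_closed:
  "s \<in> S \<Longrightarrow> free_gen F A s \<in> carrier (free_act_module F A S)"
  by (auto simp: free_gen_def free_act_module_def if_distrib cong: if_cong)

context nonunital_module
begin

lemma generated_submodule:
  assumes "S \<subseteq> carrier M"
  shows "act_submodule F A M (generated_submodule F A M S)" and "S \<subseteq> generated_submodule F A M S"
proof -
  let ?C = "{N. act_submodule F A M N \<and> S \<subseteq> N}"
  have c: "carrier M \<in> ?C"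
    using assms M.carrier_is_submodule by (auto simp: act_submodule_def)
  have sub: "submodule N F M" if "N \<in> ?C" for N
    using that by (simp add: act_submodule_def)
  have "submodule (\<Inter>?C) F M"
  proof (rule M.submoduleI)
    show "\<Inter>?C \<subseteq> carrier M" using c by blast
    show "\<zero>\<^bsub>M\<^esub> \<in> \<Inter>?C"
      using sub subgroup.one_closed[OF submodule.axioms(1)] by fastforce
  next
    show "\<ominus>\<^bsub>M\<^esub> x \<in> \<Inter>?C" if "x \<in> \<Inter>?C" for x
      using that M.submoduleE(3)[OF sub] by blast
    show "x \<oplus>\<^bsub>M\<^esub> y \<in> \<Inter>?C" if "x \<in> \<Inter>?C" "y \<in> \<Inter>?C" for x y
      using that M.submoduleE(5)[OF sub] by blast
    show "r \<odot>\<^bsub>M\<^esub> x \<in> \<Inter>?C" if "r \<in> carrier F" "x \<in> \<Inter>?C" for r x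
      using that M.submoduleE(4)[OF sub] by blast
  qed
  then show "act_submodule F A M (generated_submodule F A M S)"
    by (auto simp: act_submodule_def generated_submodule_def)
  show "S \<subseteq> generated_submodule F A M S"
    by (auto simp: generated_submodule_def)
qed

lemma
  assumes N: "act_submodule F A M N"
  shows quotient_module: "nonunital_module F A (quotient_module M N)"
    and quotient_carrier: "carrier (quotient_module M N) = (\<lambda>x. N +>\<^bsub>M\<^esub> x) ` carrier M"
    and quotient_zero: "\<zero>\<^bsub>quotient_module M N\<^esub> = N"
    and quotient_add: "\<lbrakk>x \<in> carrier M; y \<in> carrier M\<rbrakk> \<Longrightarrow>
      (N +>\<^bsub>M\<^esub> x) \<oplus>\<^bsub>quotient_module M N\<^esub> (N +>\<^bsub>M\<^esub> y) = N +>\<^bsub>M\<^esub> (x \<oplus>\<^bsub>M\<^esub> y)"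
    and quotient_smult: "\<lbrakk>r \<in> carrier F; x \<in> carrier M\<rbrakk> \<Longrightarrow>
      r \<odot>\<^bsub>quotient_module M N\<^esub> (N +>\<^bsub>M\<^esub> x) = N +>\<^bsub>M\<^esub> (r \<odot>\<^bsub>M\<^esub> x)"
    and quotient_act: "\<lbrakk>a \<in> carrier A; x \<in> carrier M\<rbrakk> \<Longrightarrow>
      a \<triangleright>\<^bsub>quotient_module M N\<^esub> (N +>\<^bsub>M\<^esub> x) = N +>\<^bsub>M\<^esub> (a \<triangleright>\<^bsub>M\<^esub> x)"
    and quotient_eq: "\<lbrakk>x \<in> carrier M; y \<in> carrier M; x \<ominus>\<^bsub>M\<^esub> y \<in> N\<rbrakk> \<Longrightarrow> N +>\<^bsub>M\<^esub> x = N +>\<^bsub>M\<^esub> y"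
proof -
  let ?Q = "quotient_module M N"
  have sub: "subgroup N (add_monoid M)"
    using N by (simp add: act_submodule_def submodule_def)
  then interpret N: abelian_subgroup N M
    by (intro abelian_subgroupI3 additive_subgroupI M.M.abelian_group_axioms)
  have smultN: "r \<odot>\<^bsub>M\<^esub> x \<in> N" if "r \<in> carrier F" "x \<in> N" for r x
    using N that by (auto simp: act_submodule_def intro: submodule.smult_closed)
  have actN: "a \<triangleright>\<^bsub>M\<^esub> x \<in> N" if "a \<in> carrier A" "x \<in> N" for a x
    using N that by (auto simp: act_submodule_def)
  show carrier: "carrier ?Q = (\<lambda>x. N +>\<^bsub>M\<^esub> x) ` carrier M"
    by (auto simp: quotient_module_def A_RCOSETS_def')
  show zero: "\<zero>\<^bsub>?Q\<^esub> = N"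
    by (simp add: quotient_module_def)
  then have zero': "\<zero>\<^bsub>?Q\<^esub> = N +>\<^bsub>M\<^esub> \<zero>\<^bsub>M\<^esub>"
    by (simp add: N.a_subset)
  show add: "(N +>\<^bsub>M\<^esub> x) \<oplus>\<^bsub>?Q\<^esub> (N +>\<^bsub>M\<^esub> y) = N +>\<^bsub>M\<^esub> (x \<oplus>\<^bsub>M\<^esub> y)"
    if "x \<in> carrier M" "y \<in> carrier M" for x y
    using that by (simp add: quotient_module_def N.a_rcos_sum)
  have shift: "N +>\<^bsub>M\<^esub> (n \<oplus>\<^bsub>M\<^esub> x) = N +>\<^bsub>M\<^esub> x" if "n \<in> N" "x \<in> carrier M" for n x
    using that N.a_subset by (metis M.M.a_rcosI M.M.a_repr_independence sub)
  have elem: "\<exists>n\<in>N. y = n \<oplus>\<^bsub>M\<^esub> x" if "y \<in> N +>\<^bsub>M\<^esub> x" for x y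
    using that by (auto simp: a_r_coset_def')
  show smult: "r \<odot>\<^bsub>?Q\<^esub> (N +>\<^bsub>M\<^esub> x) = N +>\<^bsub>M\<^esub> (r \<odot>\<^bsub>M\<^esub> x)"
    if rx: "r \<in> carrier F" "x \<in> carrier M" for r x
  proof -
    have "N +>\<^bsub>M\<^esub> (r \<odot>\<^bsub>M\<^esub> y) = N +>\<^bsub>M\<^esub> (r \<odot>\<^bsub>M\<^esub> x)" if "y \<in> N +>\<^bsub>M\<^esub> x" for y
    proof -
      obtain n where n: "n \<in> N" "y = n \<oplus>\<^bsub>M\<^esub> x" using elem \<open>y \<in> N +>\<^bsub>M\<^esub> x\<close> by blast
      then have "n \<in> carrier M" using N.a_subset by blast
      with n rx show ?thesis by (simp add: M.smult_r_distr shift smultN)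
    qed
    moreover have "x \<in> N +>\<^bsub>M\<^esub> x" using rx by (simp add: N.a_rcos_self)
    ultimately have "(\<Union>y\<in>N +>\<^bsub>M\<^esub> x. N +>\<^bsub>M\<^esub> (r \<odot>\<^bsub>M\<^esub> y)) = N +>\<^bsub>M\<^esub> (r \<odot>\<^bsub>M\<^esub> x)"
      by (intro SUP_eq_const) blast+
    then show ?thesis by (simp add: quotient_module_def)
  qed
  show act: "a \<triangleright>\<^bsub>?Q\<^esub> (N +>\<^bsub>M\<^esub> x) = N +>\<^bsub>M\<^esub> (a \<triangleright>\<^bsub>M\<^esub> x)"
    if ax: "a \<in> carrier A" "x \<in> carrier M" for a x
  proof -
    have "N +>\<^bsub>M\<^esub> (a \<triangleright>\<^bsub>M\<^esub> y) = N +>\<^bsub>M\<^esub> (a \<triangleright>\<^bsub>M\<^esub> x)" if "y \<in> N +>\<^bsub>M\<^esub> x" for y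
    proof -
      obtain n where n: "n \<in> N" "y = n \<oplus>\<^bsub>M\<^esub> x" using elem \<open>y \<in> N +>\<^bsub>M\<^esub> x\<close> by blast
      then have "n \<in> carrier M" using N.a_subset by blast
      with n ax show ?thesis by (simp add: act_add_right shift actN)
    qed
    moreover have "x \<in> N +>\<^bsub>M\<^esub> x" using ax by (simp add: N.a_rcos_self)
    ultimately have "(\<Union>y\<in>N +>\<^bsub>M\<^esub> x. N +>\<^bsub>M\<^esub> (a \<triangleright>\<^bsub>M\<^esub> y)) = N +>\<^bsub>M\<^esub> (a \<triangleright>\<^bsub>M\<^esub> x)"
      by (intro SUP_eq_const) blast+
    then show ?thesis by (simp add: quotient_module_def)
  qed
  show "N +>\<^bsub>M\<^esub> x = N +>\<^bsub>M\<^esub> y" if "x \<in> carrier M" "y \<in> carrier M" "x \<ominus>\<^bsub>M\<^esub> y \<in> N"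
  proof -
    have "x = (x \<ominus>\<^bsub>M\<^esub> y) \<oplus>\<^bsub>M\<^esub> y"
      using that by (simp add: a_minus_def M.M.a_assoc M.M.l_neg)
    then show ?thesis using shift that by metis
  qed
  have ex: "\<exists>x'\<in>carrier M. X = N +>\<^bsub>M\<^esub> x'" if "X \<in> carrier ?Q" for X
    using that by (auto simp: carrier)
  note [rule del] = subset_antisym
  have grp: "abelian_group ?Q"
  proof (rule abelian_groupI)
    fix X assume "X \<in> carrier ?Q"
    then obtain x where x: "x \<in> carrier M" "X = N +>\<^bsub>M\<^esub> x" using ex by blast
    have "N +>\<^bsub>M\<^esub> (\<ominus>\<^bsub>M\<^esub> x) \<in> carrier ?Q" using x carrier by auto
    moreover have "(N +>\<^bsub>M\<^esub> (\<ominus>\<^bsub>M\<^esub> x)) \<oplus>\<^bsub>?Q\<^esub> X = \<zero>\<^bsub>?Q\<^esub>"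
      using x by (simp only: add zero' M.M.a_inv_closed M.M.l_neg)
    ultimately show "\<exists>Y\<in>carrier ?Q. Y \<oplus>\<^bsub>?Q\<^esub> X = \<zero>\<^bsub>?Q\<^esub>" by blast
  qed (auto simp: carrier add zero' M.M.a_ac)
  have mod: "module F ?Q"
    by (rule moduleI[OF A.R.is_cring grp])
      (auto simp: carrier add smult M.smult_l_distr M.smult_r_distr M.smult_assoc1)
  show "nonunital_module F A ?Q"
    by (intro nonunital_module.intro nonunital_module_axioms.intro mod
          A.comm_nonunital_algebra_axioms)
      (auto simp: carrier add smult act act_add_left act_add_right act_smult_left act_smult_right
        act_assoc)
qed

end

context comm_nonunital_algebra
begin

abbreviation (input) L where "L \<equiv> free_act_module F A (carrier A)"

lemma kahler_relations_closed: "kahler_relations F A \<subseteq> carrier L"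
proof -
  interpret L: nonunital_module F A L by (rule free_act_module)
  show ?thesis
    by (auto simp: kahler_relations_def Let_def free_gen_closed)
qed

lemma kahler_submodule: "act_submodule F A L (kahler_submodule F A)"
  and kahler_relations_subset: "kahler_relations F A \<subseteq> kahler_submodule F A"
  using nonunital_module.generated_submodule[OF free_act_module kahler_relations_closed]
  by (simp_all add: kahler_submodule_def)

lemma kahler_module: "nonunital_module F A (kahler F A)"
  unfolding kahler_def
  by (rule nonunital_module.quotient_module[OF free_act_module kahler_submodule])

lemma kahler_d_closed: "a \<in> carrier A \<Longrightarrow> kahler_d F A a \<in> carrier (kahler F A)"
  by (auto simp: kahler_def kahler_d_def free_gen_closed
      nonunital_module.quotient_carrier[OF free_act_module kahler_submodule])

lemma kahler_d_linear:
  assumes "a \<in> carrier A" "b \<in> carrier A" "r \<in> carrier F"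
  shows "kahler_d F A (a \<oplus>\<^bsub>A\<^esub> r \<odot>\<^bsub>A\<^esub> b) =
    kahler_d F A a \<oplus>\<^bsub>kahler F A\<^esub> r \<odot>\<^bsub>kahler F A\<^esub> kahler_d F A b"
proof -
  interpret L: nonunital_module F A L by (rule free_act_module)
  have "free_gen F A (a \<oplus>\<^bsub>A\<^esub> r \<odot>\<^bsub>A\<^esub> b) \<ominus>\<^bsub>L\<^esub> (free_gen F A a \<oplus>\<^bsub>L\<^esub> r \<odot>\<^bsub>L\<^esub> free_gen F A b)
      \<in> kahler_submodule F A"
    using assms by (intro subsetD[OF kahler_relations_subset]) (auto simp: kahler_relations_def Let_def)
  then show ?thesis
    using assms L.quotient_eq[OF kahler_submodule]
    by (simp add: kahler_def kahler_d_def free_gen_closed L.quotient_add[OF kahler_submodule]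
        L.quotient_smult[OF kahler_submodule])
qed

lemma kahler_d_mult:
  assumes "a \<in> carrier A" "b \<in> carrier A"
  shows "kahler_d F A (a \<otimes>\<^bsub>A\<^esub> b) =
    (a \<triangleright>\<^bsub>kahler F A\<^esub> kahler_d F A b) \<oplus>\<^bsub>kahler F A\<^esub> (b \<triangleright>\<^bsub>kahler F A\<^esub> kahler_d F A a)"
proof -
  interpret L: nonunital_module F A L by (rule free_act_module)
  have "free_gen F A (a \<otimes>\<^bsub>A\<^esub> b) \<ominus>\<^bsub>L\<^esub>
      ((a \<triangleright>\<^bsub>L\<^esub> free_gen F A b) \<oplus>\<^bsub>L\<^esub> (b \<triangleright>\<^bsub>L\<^esub> free_gen F A a)) \<in> kahler_submodule F A"
    using assms by (intro subsetD[OF kahler_relations_subset]) (auto simp: kahler_relations_def Let_def)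
  then show ?thesis
    using assms L.quotient_eq[OF kahler_submodule]
    by (simp add: kahler_def kahler_d_def free_gen_closed L.quotient_add[OF kahler_submodule]
        L.quotient_act[OF kahler_submodule])
qed

end

context divided_power_algebra
begin

lemma omega_submodule: "act_submodule F A (kahler F A) (omega_submodule F A)"
  and omega_relation: "\<lbrakk>n \<ge> 2; a \<in> carrier A\<rbrakk> \<Longrightarrow>
    kahler_d F A (\<gamma>\<^bsub>A\<^esub> n a) \<ominus>\<^bsub>kahler F A\<^esub> (\<gamma>\<^bsub>A\<^esub> (n - 1) a \<triangleright>\<^bsub>kahler F A\<^esub> kahler_d F A a)
      \<in> omega_submodule F A"
proof -
  interpret K: nonunital_module F A "kahler F A" by (rule kahler_module)
  let ?S = "{kahler_d F A (\<gamma>\<^bsub>A\<^esub> n a) \<ominus>\<^bsub>kahler F A\<^esub> (\<gamma>\<^bsub>A\<^esub> (n - 1) a \<triangleright>\<^bsub>kahler F A\<^esub> kahler_d F A a) |n a.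
        2 \<le> n \<and> a \<in> carrier A}"
  have "?S \<subseteq> carrier (kahler F A)"
    by (auto intro!: K.M.minus_closed K.act_closed kahler_d_closed)
  note K.generated_submodule[OF this]
  then show "act_submodule F A (kahler F A) (omega_submodule F A)"
    and "\<lbrakk>n \<ge> 2; a \<in> carrier A\<rbrakk> \<Longrightarrow>
      kahler_d F A (\<gamma>\<^bsub>A\<^esub> n a) \<ominus>\<^bsub>kahler F A\<^esub> (\<gamma>\<^bsub>A\<^esub> (n - 1) a \<triangleright>\<^bsub>kahler F A\<^esub> kahler_d F A a)
        \<in> omega_submodule F A"
    by (auto simp: omega_submodule_def)
qed

lemma omega_module: "nonunital_module F A (omega F A)"
  unfolding omega_def
  by (rule nonunital_module.quotient_module[OF kahler_module omega_submodule])

lemma omega_d_closed: "a \<in> carrier A \<Longrightarrow> omega_d F A a \<in> carrier (omega F A)"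
  by (auto simp: omega_def omega_d_def kahler_d_closed
      nonunital_module.quotient_carrier[OF kahler_module omega_submodule])

lemma omega_d_linear:
  assumes "a \<in> carrier A" "b \<in> carrier A" "r \<in> carrier F"
  shows "omega_d F A (a \<oplus>\<^bsub>A\<^esub> r \<odot>\<^bsub>A\<^esub> b) =
    omega_d F A a \<oplus>\<^bsub>omega F A\<^esub> r \<odot>\<^bsub>omega F A\<^esub> omega_d F A b"
proof -
  interpret K: nonunital_module F A "kahler F A" by (rule kahler_module)
  show ?thesis
    using assms by (simp add: omega_def omega_d_def kahler_d_closed kahler_d_linear
        K.quotient_add[OF omega_submodule] K.quotient_smult[OF omega_submodule])
qed

lemma omega_d_mult:
  assumes "a \<in> carrier A" "b \<in> carrier A"
  shows "omega_d F A (a \<otimes>\<^bsub>A\<^esub> b) =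
    (a \<triangleright>\<^bsub>omega F A\<^esub> omega_d F A b) \<oplus>\<^bsub>omega F A\<^esub> (b \<triangleright>\<^bsub>omega F A\<^esub> omega_d F A a)"
proof -
  interpret K: nonunital_module F A "kahler F A" by (rule kahler_module)
  show ?thesis
    using assms by (simp add: omega_def omega_d_def kahler_d_closed kahler_d_mult
        K.quotient_add[OF omega_submodule] K.quotient_act[OF omega_submodule])
qed

lemma omega_d_dp:
  assumes "n \<ge> 2" "a \<in> carrier A"
  shows "omega_d F A (\<gamma>\<^bsub>A\<^esub> n a) = \<gamma>\<^bsub>A\<^esub> (n - 1) a \<triangleright>\<^bsub>omega F A\<^esub> omega_d F A a"
proof -
  interpret K: nonunital_module F A "kahler F A" by (rule kahler_module)
  show ?thesis
    using assms K.quotient_eq[OF omega_submodule _ _ omega_relation[OF assms]]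
    by (simp add: omega_def omega_d_def kahler_d_closed K.quotient_act[OF omega_submodule])
qed

lemma cotangent_dpa: "divided_power_algebra F (cotangent F A)"
  by (intro gamma_data.gamma_dpa gamma_data.intro divided_power_algebra_axioms omega_module)

end

end

theory Submission
  imports Defs
begin

text \<open>
  A linear multiplicative map between divided power algebras in characteristic \<open>p\<close> commutes with all
  divided powers as soon as it commutes with the \<open>p\<close>-th one. Applied to \<open>a \<mapsto> (a, D a)\<close>, this gives
  the algebraic case, and it also shows that a special inner derivation satisfies
  \<open>D (a\<^sup>[\<^sup>n\<^sup>]) = a\<^sup>[\<^sup>n\<^sup>-\<^sup>1\<^sup>] D a\<close> for all \<open>n \<ge> 2\<close>. Derivations with the latter property are the module
  morphisms from the differentials \<open>\<Omega>\<^sup>1\<^sub>A\<close> to \<open>A\<close>, which by the adjunction are the retractions of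
  \<open>A \<rightarrow> \<Gamma>\<^sub>A\<^sup>+(\<Omega>\<^sup>1\<^sub>A)\<close>.
\<close>

section \<open>Maps commuting with the \<open>p\<close>-th divided power\<close>

text \<open>Strong induction on \<open>n\<close>. If \<open>p\<close> does not divide
  \<open>n\<close>, then \<open>n\<close> is invertible in \<open>F\<close> and
  \<open>a * \<gamma> (n - 1) a = n \<gamma> n a\<close> reduces degree \<open>n\<close> to degree
  \<open>n - 1\<close>. If \<open>n = m * p\<close>, then \<open>\<gamma> m (\<gamma> p a)\<close>
  is \<open>dpc m p\<close> times \<open>\<gamma> n a\<close>, and this coefficient is prime to
  \<open>p\<close> by \<open>not_dvd_dpc\<close>, so it can be cancelled.\<close>

lemma dp_homI_char:
  assumes A: "divided_power_algebra F A" and B: "divided_power_algebra F B"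
    and p: "characteristic F = p" "p > 0"
    and h: "h \<in> carrier A \<rightarrow> carrier B"
    and add: "\<And>a b. \<lbrakk>a \<in> carrier A; b \<in> carrier A\<rbrakk> \<Longrightarrow> h (a \<oplus>\<^bsub>A\<^esub> b) = h a \<oplus>\<^bsub>B\<^esub> h b"
    and smult: "\<And>r a. \<lbrakk>r \<in> carrier F; a \<in> carrier A\<rbrakk> \<Longrightarrow> h (r \<odot>\<^bsub>A\<^esub> a) = r \<odot>\<^bsub>B\<^esub> h a"
    and mult: "\<And>a b. \<lbrakk>a \<in> carrier A; b \<in> carrier A\<rbrakk> \<Longrightarrow> h (a \<otimes>\<^bsub>A\<^esub> b) = h a \<otimes>\<^bsub>B\<^esub> h b"
    and dp: "\<And>a. a \<in> carrier A \<Longrightarrow> h (\<gamma>\<^bsub>A\<^esub> p a) = \<gamma>\<^bsub>B\<^esub> p (h a)"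
  shows "h \<in> dp_hom F A B"
proof -
  interpret A: divided_power_algebra F A by fact
  interpret B: divided_power_algebra F B by fact
  have hc [simp]: "h a \<in> carrier B" if "a \<in> carrier A" for a
    using h that by blast
  have nmult: "h ([k] \<cdot>\<^bsub>A\<^esub> a) = [k] \<cdot>\<^bsub>B\<^esub> (h a)" if "a \<in> carrier A" for k :: nat and a
    using that by (simp add: A.nmult_smult B.nmult_smult smult)
  have pp: "Factorial_Ring.prime p" using A.prime_characteristic p by simp
  then have p2: "p \<ge> 2" by (rule prime_ge_2_nat)
  have "h (\<gamma>\<^bsub>A\<^esub> n a) = \<gamma>\<^bsub>B\<^esub> n (h a)" if "n \<ge> 1" "a \<in> carrier A" for n a
    using that
  proof (induction n arbitrary: a rule: less_induct)
    case (less n)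
    consider "n = 1" | "n > 1" "\<not> p dvd n" | m where "n = m * p" "m \<ge> 1"
      using less.prems by (metis dvd_def le_less mult.commute mult_0_right less_one not_le)
    then show ?case
    proof cases
      case 1
      then show ?thesis using A.dp_one[of a] B.dp_one[of "h a"] less.prems by simp
    next
      case 2
      have "h a \<otimes>\<^bsub>B\<^esub> h (\<gamma>\<^bsub>A\<^esub> (n - 1) a) = [n] \<cdot>\<^bsub>B\<^esub> h (\<gamma>\<^bsub>A\<^esub> n a)"
        using A.dp_mult[of 1 "n - 1" a] 2 less.prems A.dp_one[of a]
        by (simp flip: mult nmult)
      moreover have "h a \<otimes>\<^bsub>B\<^esub> \<gamma>\<^bsub>B\<^esub> (n - 1) (h a) = [n] \<cdot>\<^bsub>B\<^esub> (\<gamma>\<^bsub>B\<^esub> n (h a))"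
        using B.dp_mult[of 1 "n - 1" "h a"] 2 less.prems B.dp_one[of "h a"] by simp
      moreover have "h (\<gamma>\<^bsub>A\<^esub> (n - 1) a) = \<gamma>\<^bsub>B\<^esub> (n - 1) (h a)"
        using less 2 by auto
      ultimately have "[n] \<cdot>\<^bsub>B\<^esub> h (\<gamma>\<^bsub>A\<^esub> n a) = [n] \<cdot>\<^bsub>B\<^esub> (\<gamma>\<^bsub>B\<^esub> n (h a))"
        by simp
      then show ?thesis
        by (rule B.nmult_cancel[rotated -1]) (use 2 p less.prems in simp_all)
    next
      case 3
      show ?thesis
      proof (cases "m = 1")
        case True
        then show ?thesis using 3 dp less.prems by simp
      next
        case False
        have mn: "m < n" using 3 p2 by simp
        have p1: "p \<ge> 1" using p2 by simp
        \<comment> \<open>The induction hypothesis in degree \<open>m\<close> is used at the element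
          \<open>\<gamma> p a\<close> instead of \<open>a\<close>, hence the generalisation over
          \<open>a\<close>.\<close>
        have "h (\<gamma>\<^bsub>A\<^esub> m (\<gamma>\<^bsub>A\<^esub> p a)) = \<gamma>\<^bsub>B\<^esub> m (\<gamma>\<^bsub>B\<^esub> p (h a))"
          using less.IH[OF mn 3(2), of "\<gamma>\<^bsub>A\<^esub> p a"] dp less.prems p1 by simp
        moreover have "\<gamma>\<^bsub>A\<^esub> m (\<gamma>\<^bsub>A\<^esub> p a) = [(dpc m p)] \<cdot>\<^bsub>A\<^esub> (\<gamma>\<^bsub>A\<^esub> n a)"
          using A.dp_dp[of m p a] 3 less.prems p1 by (simp add: dpc_def)
        moreover have "\<gamma>\<^bsub>B\<^esub> m (\<gamma>\<^bsub>B\<^esub> p (h a)) = [(dpc m p)] \<cdot>\<^bsub>B\<^esub> (\<gamma>\<^bsub>B\<^esub> n (h a))"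
          using B.dp_dp[of m p "h a"] 3 less.prems p1 by (simp add: dpc_def)
        ultimately have "[(dpc m p)] \<cdot>\<^bsub>B\<^esub> h (\<gamma>\<^bsub>A\<^esub> n a) = [(dpc m p)] \<cdot>\<^bsub>B\<^esub> (\<gamma>\<^bsub>B\<^esub> n (h a))"
          using less.prems nmult by simp
        then show ?thesis
          by (rule B.nmult_cancel[rotated -1]) (use not_dvd_dpc[OF pp] p less.prems in simp_all)
      qed
    qed
  qed
  then show ?thesis
    using h add smult mult by (simp add: dp_hom_def)
qed

section \<open>The algebraic tangent structure\<close>

lemma tangent_simps [simp]:
  "carrier (tangent p F A) = carrier A \<times> carrier A"
  "(a, b) \<oplus>\<^bsub>tangent p F A\<^esub> (a', b') = (a \<oplus>\<^bsub>A\<^esub> a', b \<oplus>\<^bsub>A\<^esub> b')"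
  "(a, b) \<otimes>\<^bsub>tangent p F A\<^esub> (a', b') = (a \<otimes>\<^bsub>A\<^esub> a', a \<otimes>\<^bsub>A\<^esub> b' \<oplus>\<^bsub>A\<^esub> a' \<otimes>\<^bsub>A\<^esub> b)"
  "r \<odot>\<^bsub>tangent p F A\<^esub> (a, b) = (r \<odot>\<^bsub>A\<^esub> a, r \<odot>\<^bsub>A\<^esub> b)"
  by (simp_all add: tangent_def square_zero_ext_def)

text \<open>The Leibniz rule is multiplicativity of the graph for the square-zero product, and the
  condition on \<open>D (\<gamma> p a)\<close> is compatibility with the \<open>p\<close>-th
  operation of the tangent algebra. The other degrees follow from
  \<open>dp_homI_char\<close>.\<close>

lemma graph_in_dp_hom_tangent:
  assumes A: "divided_power_algebra F A" and p: "characteristic F = p" "p > 0"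
    and D: "D \<in> special_inner_derivations p F A"
  shows "(\<lambda>a. (a, D a)) \<in> dp_hom F A (tangent p F A)"
proof (rule dp_homI_char[OF A tangent_dpa(1)[OF A p] p])
  show "(\<lambda>a. (a, D a)) \<in> carrier A \<rightarrow> carrier (tangent p F A)"
    using D by (auto simp: special_inner_derivations_def)
  show "(\<gamma>\<^bsub>A\<^esub> p a, D (\<gamma>\<^bsub>A\<^esub> p a)) = \<gamma>\<^bsub>tangent p F A\<^esub> p (a, D a)" if "a \<in> carrier A" for a
  proof -
    have "D a \<in> carrier A"
      using D that by (auto simp: special_inner_derivations_def)
    then show ?thesis
      using D that by (simp add: special_inner_derivations_def tangent_dpa(2)[OF A p])
  qed
qed (use D in \<open>auto simp: special_inner_derivations_def\<close>)

text \<open>This is the second component of the statement that the graph of \<open>D\<close>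
  preserves the \<open>n\<close>-th divided power. It replaces the condition in degree
  \<open>p\<close> by the family of relations that defines \<Omega>.\<close>

lemma special_inner_derivation_dp:
  assumes A: "divided_power_algebra F A" and p: "characteristic F = p" "p > 0"
    and D: "D \<in> special_inner_derivations p F A" and n: "n \<ge> 2" and a: "a \<in> carrier A"
  shows "D (\<gamma>\<^bsub>A\<^esub> n a) = \<gamma>\<^bsub>A\<^esub> (n - 1) a \<otimes>\<^bsub>A\<^esub> D a"
proof -
  have Da: "D a \<in> carrier A"
    using D a by (auto simp: special_inner_derivations_def)
  have "(\<gamma>\<^bsub>A\<^esub> n a, D (\<gamma>\<^bsub>A\<^esub> n a)) = \<gamma>\<^bsub>tangent p F A\<^esub> n (a, D a)"
    using graph_in_dp_hom_tangent[OF A p D] n a by (simp add: dp_hom_def)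
  also have "\<dots> = (\<gamma>\<^bsub>A\<^esub> n a, \<gamma>\<^bsub>A\<^esub> (n - 1) a \<otimes>\<^bsub>A\<^esub> D a)"
    using n a Da by (rule tangent_dpa(3)[OF A p])
  finally show ?thesis by simp
qed

text \<open>A section of the first projection is the graph of its second component. The conditions
  for a graph to be a morphism, read in that component, are those for a special inner
  derivation.\<close>

lemma algebraic_vector_fields_bij:
  assumes A: "divided_power_algebra F A" and p: "characteristic F = p" "p > 0"
  shows "bij_betw (\<lambda>v. \<lambda>a\<in>carrier A. snd (v a))
    (algebraic_vector_fields p F A) (special_inner_derivations p F A)"
proof (rule bij_betw_byWitness[where f' = "\<lambda>D. \<lambda>a\<in>carrier A. (a, D a)"])
  interpret A: divided_power_algebra F A by fact
  have pair: "v a = (a, snd (v a))" if "v \<in> algebraic_vector_fields p F A" "a \<in> carrier A" for v a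
    using that by (auto simp: algebraic_vector_fields_def prod_eq_iff)
  show "\<forall>v\<in>algebraic_vector_fields p F A.
      (\<lambda>a\<in>carrier A. (a, (\<lambda>a\<in>carrier A. snd (v a)) a)) = v"
  proof (intro ballI ext)
    fix v a assume v: "v \<in> algebraic_vector_fields p F A"
    \<comment> \<open>Off the carrier both sides are \<open>undefined\<close>: the vector field by
      extensionality, the graph by restriction.\<close>
    then have "v a = undefined" if "a \<notin> carrier A"
      using that by (simp add: algebraic_vector_fields_def extensional_def)
    then show "(\<lambda>a\<in>carrier A. (a, (\<lambda>a\<in>carrier A. snd (v a)) a)) a = v a"
      by (cases "a \<in> carrier A") (simp_all flip: pair[OF v])
  qed
  show "\<forall>D\<in>special_inner_derivations p F A.
      (\<lambda>a\<in>carrier A. snd ((\<lambda>a\<in>carrier A. (a, D a)) a)) = D"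
    by (auto simp: fun_eq_iff special_inner_derivations_def PiE_def extensional_def)
  show "(\<lambda>v. \<lambda>a\<in>carrier A. snd (v a)) ` algebraic_vector_fields p F A
      \<subseteq> special_inner_derivations p F A"
  proof (rule image_subsetI)
    fix v assume v: "v \<in> algebraic_vector_fields p F A"
    define D where "D = (\<lambda>a. snd (v a))"
    have eq: "v a = (a, D a)" if "a \<in> carrier A" for a
      using pair[OF v that] by (simp add: D_def)
    have hom: "v \<in> dp_hom F A (tangent p F A)"
      using v by (simp add: algebraic_vector_fields_def)
    have Dc [simp]: "D a \<in> carrier A" if "a \<in> carrier A" for a
      using hom eq[OF that] that by (auto simp: dp_hom_def Pi_iff)
    have "D (a \<oplus>\<^bsub>A\<^esub> b) = D a \<oplus>\<^bsub>A\<^esub> D b" if "a \<in> carrier A" "b \<in> carrier A" for a b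
    proof -
      have "v (a \<oplus>\<^bsub>A\<^esub> b) = v a \<oplus>\<^bsub>tangent p F A\<^esub> v b"
        using hom that by (simp add: dp_hom_def)
      then show ?thesis using that by (simp add: eq)
    qed
    moreover have "D (r \<odot>\<^bsub>A\<^esub> a) = r \<odot>\<^bsub>A\<^esub> D a" if "r \<in> carrier F" "a \<in> carrier A" for r a
    proof -
      have "v (r \<odot>\<^bsub>A\<^esub> a) = r \<odot>\<^bsub>tangent p F A\<^esub> v a"
        using hom that by (simp add: dp_hom_def)
      then show ?thesis using that by (simp add: eq)
    qed
    moreover have "D (a \<otimes>\<^bsub>A\<^esub> b) = a \<otimes>\<^bsub>A\<^esub> D b \<oplus>\<^bsub>A\<^esub> b \<otimes>\<^bsub>A\<^esub> D a"
      if "a \<in> carrier A" "b \<in> carrier A" for a b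
    proof -
      have "v (a \<otimes>\<^bsub>A\<^esub> b) = v a \<otimes>\<^bsub>tangent p F A\<^esub> v b"
        using hom that by (simp add: dp_hom_def)
      then show ?thesis using that by (simp add: eq)
    qed
    \<comment> \<open>Here the defining formula for the \<open>p\<close>-th operation of the tangent
      algebra enters; its second component is the right-hand side.\<close>
    moreover have "D (\<gamma>\<^bsub>A\<^esub> p a) = \<ominus>\<^bsub>A\<^esub> (npow A a (p - 1) \<otimes>\<^bsub>A\<^esub> D a)" if "a \<in> carrier A" for a
    proof -
      have "v (\<gamma>\<^bsub>A\<^esub> p a) = \<gamma>\<^bsub>tangent p F A\<^esub> p (v a)"
        using hom that p by (simp add: dp_hom_def)
      then show ?thesis using that p by (simp add: eq tangent_dpa(2)[OF A])
    qed
    ultimately show "(\<lambda>a\<in>carrier A. snd (v a)) \<in> special_inner_derivations p F A"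
      using p unfolding D_def[symmetric] by (simp add: special_inner_derivations_def)
  qed
  show "(\<lambda>D. \<lambda>a\<in>carrier A. (a, D a)) ` special_inner_derivations p F A
      \<subseteq> algebraic_vector_fields p F A"
    using graph_in_dp_hom_tangent[OF A p]
    by (fastforce simp: algebraic_vector_fields_def dp_hom_def)
qed

section \<open>Module morphisms\<close>

text \<open>No extensionality is imposed, so plain composites are again morphisms. Uniqueness is
  accordingly stated pointwise on carriers.\<close>

definition act_hom ::
  "('f, 'k) ring_scheme \<Rightarrow> ('f, 'a, 'u) module_scheme \<Rightarrow> ('f, 'a, 'm, 'v) act_module_scheme \<Rightarrow>
    ('f, 'a, 'n, 'w) act_module_scheme \<Rightarrow> ('m \<Rightarrow> 'n) set" where
  "act_hom F A M N = {h \<in> carrier M \<rightarrow> carrier N.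
     (\<forall>x\<in>carrier M. \<forall>y\<in>carrier M. h (x \<oplus>\<^bsub>M\<^esub> y) = h x \<oplus>\<^bsub>N\<^esub> h y) \<and>
     (\<forall>r\<in>carrier F. \<forall>x\<in>carrier M. h (r \<odot>\<^bsub>M\<^esub> x) = r \<odot>\<^bsub>N\<^esub> h x) \<and>
     (\<forall>a\<in>carrier A. \<forall>x\<in>carrier M. h (a \<triangleright>\<^bsub>M\<^esub> x) = a \<triangleright>\<^bsub>N\<^esub> h x)}"

lemma act_homI:
  assumes "\<And>x. x \<in> carrier M \<Longrightarrow> h x \<in> carrier N"
    and "\<And>x y. \<lbrakk>x \<in> carrier M; y \<in> carrier M\<rbrakk> \<Longrightarrow> h (x \<oplus>\<^bsub>M\<^esub> y) = h x \<oplus>\<^bsub>N\<^esub> h y"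
    and "\<And>r x. \<lbrakk>r \<in> carrier F; x \<in> carrier M\<rbrakk> \<Longrightarrow> h (r \<odot>\<^bsub>M\<^esub> x) = r \<odot>\<^bsub>N\<^esub> h x"
    and "\<And>a x. \<lbrakk>a \<in> carrier A; x \<in> carrier M\<rbrakk> \<Longrightarrow> h (a \<triangleright>\<^bsub>M\<^esub> x) = a \<triangleright>\<^bsub>N\<^esub> h x"
  shows "h \<in> act_hom F A M N"
  using assms by (simp add: act_hom_def)

lemma
  assumes "h \<in> act_hom F A M N"
  shows act_hom_closed: "x \<in> carrier M \<Longrightarrow> h x \<in> carrier N"
    and act_hom_add: "\<lbrakk>x \<in> carrier M; y \<in> carrier M\<rbrakk> \<Longrightarrow> h (x \<oplus>\<^bsub>M\<^esub> y) = h x \<oplus>\<^bsub>N\<^esub> h y"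
    and act_hom_smult: "\<lbrakk>r \<in> carrier F; x \<in> carrier M\<rbrakk> \<Longrightarrow> h (r \<odot>\<^bsub>M\<^esub> x) = r \<odot>\<^bsub>N\<^esub> h x"
    and act_hom_act: "\<lbrakk>a \<in> carrier A; x \<in> carrier M\<rbrakk> \<Longrightarrow> h (a \<triangleright>\<^bsub>M\<^esub> x) = a \<triangleright>\<^bsub>N\<^esub> h x"
  using assms by (auto simp: act_hom_def)

lemma act_hom_comp:
  "\<lbrakk>h \<in> act_hom F A M N; k \<in> act_hom F A N P\<rbrakk> \<Longrightarrow> (\<lambda>x. k (h x)) \<in> act_hom F A M P"
  by (auto simp: act_hom_def Pi_iff)

text \<open>The regular module: derivations from \<open>A\<close> to \<open>A\<close> will be
  morphisms from \<Omega> to it.\<close>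

definition self_module :: "('f, 'a, 'u) module_scheme \<Rightarrow> ('f, 'a, 'a) act_module" where
  "self_module A =
    \<lparr>carrier = carrier A, monoid.mult = undefined, one = undefined, zero = \<zero>\<^bsub>A\<^esub>, add = add A,
     smult = smult A, act = monoid.mult A\<rparr>"

lemma self_module_simps [simp]:
  "carrier (self_module A) = carrier A"
  "\<zero>\<^bsub>self_module A\<^esub> = \<zero>\<^bsub>A\<^esub>"
  "x \<oplus>\<^bsub>self_module A\<^esub> y = x \<oplus>\<^bsub>A\<^esub> y"
  "r \<odot>\<^bsub>self_module A\<^esub> x = r \<odot>\<^bsub>A\<^esub> x"
  "a \<triangleright>\<^bsub>self_module A\<^esub> x = a \<otimes>\<^bsub>A\<^esub> x"
  by (simp_all add: self_module_def)

lemma (in comm_nonunital_algebra) self_module: "nonunital_module F A (self_module A)"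
proof -
  have grp: "abelian_group (self_module A)"
  proof (rule abelian_groupI)
    show "\<exists>y\<in>carrier (self_module A). y \<oplus>\<^bsub>self_module A\<^esub> x = \<zero>\<^bsub>self_module A\<^esub>"
      if "x \<in> carrier (self_module A)" for x
      using that M.l_neg[of x] by auto
  qed (auto simp: M.a_ac)
  have mod: "module F (self_module A)"
    by (rule moduleI[OF R.is_cring grp])
      (auto simp: smult_l_distr smult_r_distr smult_assoc1)
  show ?thesis
    by (intro nonunital_module.intro nonunital_module_axioms.intro mod comm_nonunital_algebra_axioms)
      (auto simp: mult_add_left mult_add_right mult_smult_left mult_smult_right mult_assoc)
qed

section \<open>Kernels, generated submodules and quotients\<close>

context nonunital_module
begin

lemma act_hom_zero:
  assumes P: "nonunital_module F A P" and h: "h \<in> act_hom F A M P"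
  shows "h \<zero>\<^bsub>M\<^esub> = \<zero>\<^bsub>P\<^esub>"
proof -
  interpret P: nonunital_module F A P by fact
  have "h (\<zero>\<^bsub>F\<^esub> \<odot>\<^bsub>M\<^esub> \<zero>\<^bsub>M\<^esub>) = \<zero>\<^bsub>F\<^esub> \<odot>\<^bsub>P\<^esub> h \<zero>\<^bsub>M\<^esub>"
    by (intro act_hom_smult[OF h]) auto
  then show ?thesis
    using act_hom_closed[OF h, of "\<zero>\<^bsub>M\<^esub>"] by simp
qed

lemma act_hom_minus:
  assumes P: "nonunital_module F A P" and h: "h \<in> act_hom F A M P"
    and xy: "x \<in> carrier M" "y \<in> carrier M"
  shows "h (x \<ominus>\<^bsub>M\<^esub> y) = h x \<ominus>\<^bsub>P\<^esub> h y"
proof -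
  interpret P: nonunital_module F A P by fact
  have "h (\<ominus>\<^bsub>M\<^esub> y) \<oplus>\<^bsub>P\<^esub> h y = \<zero>\<^bsub>P\<^esub>"
    using xy act_hom_zero[OF P h] by (simp add: M.M.l_neg flip: act_hom_add[OF h])
  then have "h (\<ominus>\<^bsub>M\<^esub> y) = \<ominus>\<^bsub>P\<^esub> h y"
    using xy act_hom_closed[OF h] by (metis M.M.a_inv_closed P.M.M.minus_equality)
  then show ?thesis
    using xy by (simp add: a_minus_def act_hom_add[OF h])
qed

lemma kernel_submodule:
  assumes P: "nonunital_module F A P" and h: "h \<in> act_hom F A M P"
  shows "act_submodule F A M {x \<in> carrier M. h x = \<zero>\<^bsub>P\<^esub>}"
proof -
  interpret P: nonunital_module F A P by fact
  have "submodule {x \<in> carrier M. h x = \<zero>\<^bsub>P\<^esub>} F M"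
  proof (rule M.submoduleI)
    show "\<ominus>\<^bsub>M\<^esub> x \<in> {x \<in> carrier M. h x = \<zero>\<^bsub>P\<^esub>}" if "x \<in> {x \<in> carrier M. h x = \<zero>\<^bsub>P\<^esub>}" for x
      using that act_hom_minus[OF P h, of "\<zero>\<^bsub>M\<^esub>" x] act_hom_zero[OF P h]
      by (simp add: a_minus_def)
  qed (auto simp: act_hom_add[OF h] act_hom_smult[OF h] act_hom_zero[OF P h])
  \<comment> \<open>Needed for stability of the kernel under the action; it follows by writing the
    zero vector as the scalar zero times itself.\<close>
  moreover have "a \<triangleright>\<^bsub>P\<^esub> \<zero>\<^bsub>P\<^esub> = \<zero>\<^bsub>P\<^esub>" if "a \<in> carrier A" for a
    using P.act_smult_right[of "\<zero>\<^bsub>F\<^esub>" a "\<zero>\<^bsub>P\<^esub>"] that by simp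
  ultimately show ?thesis
    by (simp add: act_submodule_def act_hom_act[OF h])
qed

text \<open>The kernel is one of the submodules whose intersection is the generated one. Thus
  relations need to be checked on generators only.\<close>

lemma generated_submodule_kernel:
  assumes P: "nonunital_module F A P" and h: "h \<in> act_hom F A M P"
    and S: "S \<subseteq> carrier M" "\<And>x. x \<in> S \<Longrightarrow> h x = \<zero>\<^bsub>P\<^esub>" and x: "x \<in> generated_submodule F A M S"
  shows "h x = \<zero>\<^bsub>P\<^esub>"
  using kernel_submodule[OF P h] S x by (auto simp: generated_submodule_def)

lemma quotient_proj_hom:
  assumes N: "act_submodule F A M N"
  shows "(\<lambda>x. N +>\<^bsub>M\<^esub> x) \<in> act_hom F A M (quotient_module M N)"
  by (rule act_homI)
    (simp_all add: quotient_carrier[OF N] quotient_add[OF N] quotient_smult[OF N] quotient_act[OF N])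

lemma quotient_universal:
  assumes P: "nonunital_module F A P" and h: "h \<in> act_hom F A M P"
    and N: "act_submodule F A M N" "\<And>x. x \<in> N \<Longrightarrow> h x = \<zero>\<^bsub>P\<^esub>"
  obtains k where "k \<in> act_hom F A (quotient_module M N) P"
    and "\<And>x. x \<in> carrier M \<Longrightarrow> k (N +>\<^bsub>M\<^esub> x) = h x"
proof -
  interpret P: nonunital_module F A P by fact
  have sub: "subgroup N (add_monoid M)"
    using N by (simp add: act_submodule_def submodule_def)
  then interpret N: abelian_subgroup N M
    by (intro abelian_subgroupI3 additive_subgroupI M.M.abelian_group_axioms)
  \<comment> \<open>The value on a coset is computed at an arbitrary representative; two
    representatives differ by an element of \<open>N\<close>, on which \<open>h\<close>
    vanishes.\<close>
  define k where "k = (\<lambda>X. h (SOME x. x \<in> X))"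
  have k: "k (N +>\<^bsub>M\<^esub> x) = h x" if x: "x \<in> carrier M" for x
  proof -
    have "x \<in> N +>\<^bsub>M\<^esub> x" using x by (simp add: N.a_rcos_self)
    then have "(SOME y. y \<in> N +>\<^bsub>M\<^esub> x) \<in> N +>\<^bsub>M\<^esub> x" by (rule someI)
    then obtain n where n: "n \<in> N" "(SOME y. y \<in> N +>\<^bsub>M\<^esub> x) = n \<oplus>\<^bsub>M\<^esub> x"
      by (auto simp: a_r_coset_def')
    then have "h (n \<oplus>\<^bsub>M\<^esub> x) = h x"
      using N(2) x N.a_subset act_hom_closed[OF h x]
      by (subst act_hom_add[OF h]) auto
    then show ?thesis by (simp add: k_def n)
  qed
  moreover have "k \<in> act_hom F A (quotient_module M N) P"
    by (rule act_homI)
      (auto simp: quotient_carrier[OF N(1)] quotient_add[OF N(1)] quotient_smult[OF N(1)]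
        quotient_act[OF N(1)] k act_hom_closed[OF h] act_hom_add[OF h] act_hom_smult[OF h]
        act_hom_act[OF h])
  ultimately show ?thesis using that by blast
qed

text \<open>Surjectivity of the projection, in a form that applies to arbitrary functions
  \<open>h\<close> and \<open>k\<close>.\<close>

lemma quotient_hom_eqI:
  assumes N: "act_submodule F A M N"
    and eq: "\<And>x. x \<in> carrier M \<Longrightarrow> h (N +>\<^bsub>M\<^esub> x) = k (N +>\<^bsub>M\<^esub> x)"
    and "X \<in> carrier (quotient_module M N)"
  shows "h X = k X"
  using assms by (auto simp: quotient_carrier[OF N])

end

section \<open>Universal property of the modules of differentials\<close>

context nonunital_module
begin

text \<open>The morphism is a finite sum over the support of \<open>u\<close>. The work lies in
  comparing supports: that of a sum, a multiple or an action may be smaller than those of the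
  arguments.\<close>

lemma free_act_module_universal:
  assumes f: "\<And>s. s \<in> S \<Longrightarrow> f s \<in> carrier M"
  obtains h where "h \<in> act_hom F A (free_act_module F A S) M"
    and "\<And>s. s \<in> S \<Longrightarrow> h (free_gen F A s) = f s"
proof -
  let ?L = "free_act_module F A S"
  let ?supp = "\<lambda>u. {s. u s \<noteq> (\<zero>\<^bsub>F\<^esub>, \<zero>\<^bsub>A\<^esub>)}"
  interpret L: nonunital_module F A ?L by (rule A.free_act_module)
  have mem: "fst (u s) \<in> carrier F" "snd (u s) \<in> carrier A" "?supp u \<subseteq> S" "finite (?supp u)"
    if "u \<in> carrier ?L" for u s
    using that by (auto simp: free_act_module_def Pi_iff mem_Times_iff)
  have ops:
    "(u \<oplus>\<^bsub>?L\<^esub> v) s = (fst (u s) \<oplus>\<^bsub>F\<^esub> fst (v s), snd (u s) \<oplus>\<^bsub>A\<^esub> snd (v s))"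
    "(r \<odot>\<^bsub>?L\<^esub> u) s = (r \<otimes>\<^bsub>F\<^esub> fst (u s), r \<odot>\<^bsub>A\<^esub> snd (u s))"
    "(a \<triangleright>\<^bsub>?L\<^esub> u) s = (\<zero>\<^bsub>F\<^esub>, (fst (u s) \<odot>\<^bsub>A\<^esub> a) \<oplus>\<^bsub>A\<^esub> (a \<otimes>\<^bsub>A\<^esub> snd (u s)))" for u v s r a
    by (simp_all add: free_act_module_def)
  have null [simp]: "\<zero>\<^bsub>A\<^esub> \<triangleright>\<^bsub>M\<^esub> x = \<zero>\<^bsub>M\<^esub>" if "x \<in> carrier M" for x
    using act_smult_left[of "\<zero>\<^bsub>F\<^esub>" "\<zero>\<^bsub>A\<^esub>" x] that by simp
  have act_null: "a \<triangleright>\<^bsub>M\<^esub> \<zero>\<^bsub>M\<^esub> = \<zero>\<^bsub>M\<^esub>" if "a \<in> carrier A" for a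
    using act_smult_right[of "\<zero>\<^bsub>F\<^esub>" a "\<zero>\<^bsub>M\<^esub>"] that by simp
  \<comment> \<open>A coefficient \<open>(r, a)\<close> stands for \<open>r s + a s\<close>, with
    the scalar and the algebra part acting separately, so it contributes
    \<open>r f(s) + a f(s)\<close>.\<close>
  define e where "e u s = fst (u s) \<odot>\<^bsub>M\<^esub> f s \<oplus>\<^bsub>M\<^esub> snd (u s) \<triangleright>\<^bsub>M\<^esub> f s" for u s
  have e: "e u s \<in> carrier M" if "u \<in> carrier ?L" "s \<in> S" for u s
    using mem[OF that(1)] f[OF that(2)] by (simp add: e_def)
  define h where "h u = finsum M (e u) (?supp u)" for u
  \<comment> \<open>Any finite set between the support and \<open>S\<close> may serve as index set,
    since the extra terms vanish. This allows one index set for \<open>u\<close>, \<open>v\<close>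
    and their sum.\<close>
  have h: "h u = finsum M (e u) I"
    if u: "u \<in> carrier ?L" and I: "finite I" "?supp u \<subseteq> I" "I \<subseteq> S" for u I
    unfolding h_def
  proof (rule M.M.add.finprod_mono_neutral_cong_left)
    show "e u s = \<zero>\<^bsub>M\<^esub>" if "s \<in> I - ?supp u" for s
      using that I f[of s] by (auto simp: e_def)
  qed (use I e[OF u] in auto)
  have common: "\<exists>I. finite I \<and> ?supp u \<subseteq> I \<and> ?supp v \<subseteq> I \<and> I \<subseteq> S"
    if "u \<in> carrier ?L" "v \<in> carrier ?L" for u v
    using mem[OF that(1)] mem[OF that(2)] by (intro exI[of _ "?supp u \<union> ?supp v"]) auto
  have "h \<in> act_hom F A ?L M"
  proof (rule act_homI)
    show "h u \<in> carrier M" if "u \<in> carrier ?L" for u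
      unfolding h_def using mem[OF that] e[OF that] by (intro M.M.finsum_closed) auto
    show "h (u \<oplus>\<^bsub>?L\<^esub> v) = h u \<oplus>\<^bsub>M\<^esub> h v" if uv: "u \<in> carrier ?L" "v \<in> carrier ?L" for u v
    proof -
      obtain I where I: "finite I" "?supp u \<subseteq> I" "?supp v \<subseteq> I" "I \<subseteq> S"
        using common[OF uv] by blast
      have supp: "?supp (u \<oplus>\<^bsub>?L\<^esub> v) \<subseteq> I"
      proof
        fix s assume s: "s \<in> ?supp (u \<oplus>\<^bsub>?L\<^esub> v)"
        have "u s \<noteq> (\<zero>\<^bsub>F\<^esub>, \<zero>\<^bsub>A\<^esub>) \<or> v s \<noteq> (\<zero>\<^bsub>F\<^esub>, \<zero>\<^bsub>A\<^esub>)"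
          using s by (auto simp: ops)
        then show "s \<in> I" using I by auto
      qed
      have "h (u \<oplus>\<^bsub>?L\<^esub> v) = finsum M (\<lambda>s. e u s \<oplus>\<^bsub>M\<^esub> e v s) I"
        unfolding h[OF L.M.M.a_closed[OF uv] I(1) supp I(4)]
      proof (rule M.M.finsum_cong')
        show "e (u \<oplus>\<^bsub>?L\<^esub> v) s = e u s \<oplus>\<^bsub>M\<^esub> e v s" if "s \<in> I" for s
          using mem[OF uv(1)] mem[OF uv(2)] f[of s] that I
          by (simp add: e_def ops subset_iff M.smult_l_distr act_add_left M.M.a_ac)
      qed (use I e uv in auto)
      also have "\<dots> = h u \<oplus>\<^bsub>M\<^esub> h v"
        using h[OF uv(1) I(1,2,4)] h[OF uv(2) I(1,3,4)] I e uv
        by (simp add: M.M.finsum_addf Pi_iff subset_iff)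
      finally show ?thesis .
    qed
    \<comment> \<open>Scalar multiplication and the action are treated together: both are additive
      maps \<open>t\<close> that apply termwise and do not enlarge the support.\<close>
    have scale: "h v = t (h u)"
      if uv: "u \<in> carrier ?L" "v \<in> carrier ?L"
        and supp: "\<And>s. u s = (\<zero>\<^bsub>F\<^esub>, \<zero>\<^bsub>A\<^esub>) \<Longrightarrow> v s = (\<zero>\<^bsub>F\<^esub>, \<zero>\<^bsub>A\<^esub>)"
        and ev: "\<And>s. s \<in> S \<Longrightarrow> e v s = t (e u s)"
        and t: "t \<zero>\<^bsub>M\<^esub> = \<zero>\<^bsub>M\<^esub>" "\<And>x. x \<in> carrier M \<Longrightarrow> t x \<in> carrier M"
          "\<And>x y. \<lbrakk>x \<in> carrier M; y \<in> carrier M\<rbrakk> \<Longrightarrow> t (x \<oplus>\<^bsub>M\<^esub> y) = t x \<oplus>\<^bsub>M\<^esub> t y"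
      for u v t
    proof -
      have sum: "finsum M (\<lambda>s. t (e u s)) I = t (finsum M (e u) I)" if "finite I" "I \<subseteq> S" for I
        using that
      proof (induction I rule: finite_induct)
        case (insert s I)
        then have "e u \<in> I \<rightarrow> carrier M" "e u s \<in> carrier M"
          using e[OF uv(1)] by auto
        then show ?case
          using insert by (simp add: M.M.finsum_insert t M.M.finsum_closed Pi_iff)
      qed (simp add: t)
      note I = mem(3,4)[OF uv(1)]
      have "h v = finsum M (e v) (?supp u)"
        by (rule h[OF uv(2) I(2) _ I(1)]) (use supp in auto)
      also have "\<dots> = finsum M (\<lambda>s. t (e u s)) (?supp u)"
        by (rule M.M.finsum_cong') (use I ev e[OF uv(1)] t in auto)
      also have "\<dots> = t (h u)"
        using sum[OF I(2,1)] by (simp add: h_def)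
      finally show ?thesis .
    qed
    show "h (r \<odot>\<^bsub>?L\<^esub> u) = r \<odot>\<^bsub>M\<^esub> h u" if r: "r \<in> carrier F" and u: "u \<in> carrier ?L" for r u
    proof (rule scale[OF u L.M.smult_closed[OF r u]])
      show "e (r \<odot>\<^bsub>?L\<^esub> u) s = r \<odot>\<^bsub>M\<^esub> e u s" if "s \<in> S" for s
        using mem[OF u] f[OF that] r
        by (simp add: e_def ops M.smult_assoc1 M.smult_r_distr act_smult_left)
    qed (use r in \<open>auto simp: ops M.smult_r_distr\<close>)
    show "h (a \<triangleright>\<^bsub>?L\<^esub> u) = a \<triangleright>\<^bsub>M\<^esub> h u" if a: "a \<in> carrier A" and u: "u \<in> carrier ?L" for a u
    proof (rule scale[OF u L.act_closed[OF a u]])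
      show "e (a \<triangleright>\<^bsub>?L\<^esub> u) s = a \<triangleright>\<^bsub>M\<^esub> e u s" if "s \<in> S" for s
        using mem[OF u] f[OF that] a
        by (simp add: e_def ops act_add_left act_add_right act_smult_left act_smult_right act_assoc)
    qed (use a in \<open>auto simp: ops act_null act_add_right\<close>)
  qed
  moreover have "h (free_gen F A s) = f s" if s: "s \<in> S" for s
  proof -
    have "h (free_gen F A s) = finsum M (e (free_gen F A s)) {s}"
      by (rule h[OF A.free_gen_closed[OF s]]) (use s in \<open>auto simp: free_gen_def\<close>)
    also have "\<dots> = f s"
      using f[OF s] by (simp add: M.M.finsum_insert e_def free_gen_def)
    finally show ?thesis .
  qed
  ultimately show ?thesis using that by blast
qed

text \<open>Generators span: induction on the support, splitting off the coefficient at one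
  point.\<close>

lemma free_act_module_hom_eqI:
  assumes h: "h \<in> act_hom F A (free_act_module F A S) M"
    and k: "k \<in> act_hom F A (free_act_module F A S) M"
    and eq: "\<And>s. s \<in> S \<Longrightarrow> h (free_gen F A s) = k (free_gen F A s)"
    and u: "u \<in> carrier (free_act_module F A S)"
  shows "h u = k u"
proof -
  let ?L = "free_act_module F A S"
  let ?supp = "\<lambda>u. {s. u s \<noteq> (\<zero>\<^bsub>F\<^esub>, \<zero>\<^bsub>A\<^esub>)}"
  interpret L: nonunital_module F A ?L by (rule A.free_act_module)
  have "finite (?supp u)"
    using u by (simp add: free_act_module_def)
  then show ?thesis
    using u
  proof (induction "?supp u" arbitrary: u rule: finite_induct)
    case empty
    then have "u = \<zero>\<^bsub>?L\<^esub>" by (auto simp: free_act_module_def)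
    then show ?case
      using L.act_hom_zero[OF nonunital_module_axioms h] L.act_hom_zero[OF nonunital_module_axioms k]
      by simp
  next
    case (insert s I)
    define w where "w = u(s := (\<zero>\<^bsub>F\<^esub>, \<zero>\<^bsub>A\<^esub>))"
    obtain r a where ra: "u s = (r, a)" by fastforce
    have us: "u s \<noteq> (\<zero>\<^bsub>F\<^esub>, \<zero>\<^bsub>A\<^esub>)" using insert(4) by auto
    have mem: "r \<in> carrier F" "a \<in> carrier A" "s \<in> S" "fst (u t) \<in> carrier F" "snd (u t) \<in> carrier A" for t
      using insert.prems ra us by (auto simp: free_act_module_def Pi_iff mem_Times_iff)
         (metis mem_Times_iff fst_conv snd_conv)+
    have "?supp w = I"
      using insert(2,4) by (auto simp: w_def)
    moreover have w: "w \<in> carrier ?L"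
      using insert.prems insert(1) \<open>?supp w = I\<close>
      by (auto simp: free_act_module_def w_def Pi_iff)
    ultimately have IH: "h w = k w" using insert.hyps(3)[of w] by simp
    note g = A.free_gen_closed[OF mem(3)]
    have c: "r \<odot>\<^bsub>?L\<^esub> free_gen F A s \<in> carrier ?L" "a \<triangleright>\<^bsub>?L\<^esub> free_gen F A s \<in> carrier ?L"
      using g mem by auto
    \<comment> \<open>On the generator at \<open>s\<close>, the scalar \<open>r\<close> produces the
      coefficient \<open>(r, 0)\<close> and the action of \<open>a\<close> produces
      \<open>(0, a)\<close>; together they restore the deleted value \<open>(r, a)\<close>.\<close>
    have "u = w \<oplus>\<^bsub>?L\<^esub> (r \<odot>\<^bsub>?L\<^esub> free_gen F A s \<oplus>\<^bsub>?L\<^esub> a \<triangleright>\<^bsub>?L\<^esub> free_gen F A s)"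
    proof
      fix t
      show "u t = (w \<oplus>\<^bsub>?L\<^esub> (r \<odot>\<^bsub>?L\<^esub> free_gen F A s \<oplus>\<^bsub>?L\<^esub> a \<triangleright>\<^bsub>?L\<^esub> free_gen F A s)) t"
        using mem(1,2,4,5) ra by (auto simp: free_act_module_def w_def free_gen_def)
    qed
    then show ?case
      using IH eq[OF mem(3)] w c g mem
      by (simp add: act_hom_add[OF h] act_hom_add[OF k] act_hom_smult[OF h] act_hom_smult[OF k]
          act_hom_act[OF h] act_hom_act[OF k])
  qed
qed

end

section \<open>Morphisms out of the Kaehler differentials and out of \<Omega>\<close>

context divided_power_algebra
begin

lemma kahler_proj_hom:
  "(\<lambda>u. kahler_submodule F A +>\<^bsub>free_act_module F A (carrier A)\<^esub> u)
    \<in> act_hom F A (free_act_module F A (carrier A)) (kahler F A)"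
  unfolding kahler_def
  by (rule nonunital_module.quotient_proj_hom[OF free_act_module kahler_submodule])

lemma omega_proj_hom:
  "(\<lambda>x. omega_submodule F A +>\<^bsub>kahler F A\<^esub> x) \<in> act_hom F A (kahler F A) (omega F A)"
  unfolding omega_def
  by (rule nonunital_module.quotient_proj_hom[OF kahler_module omega_submodule])

text \<open>The differentials generate \<Omega>: pulled back along the two surjections from the free
  module, both morphisms agree on the free generators.\<close>

lemma omega_hom_eqI:
  assumes P: "nonunital_module F A P"
    and h: "h \<in> act_hom F A (omega F A) P" and k: "k \<in> act_hom F A (omega F A) P"
    and eq: "\<And>a. a \<in> carrier A \<Longrightarrow> h (omega_d F A a) = k (omega_d F A a)"
    and X: "X \<in> carrier (omega F A)"
  shows "h X = k X"
proof (rule nonunital_module.quotient_hom_eqI[OF kahler_module omega_submodule])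
  show "X \<in> carrier (quotient_module (kahler F A) (omega_submodule F A))"
    using X by (simp add: omega_def)
next
  let ?q = "\<lambda>x. omega_submodule F A +>\<^bsub>kahler F A\<^esub> x"
  let ?r = "\<lambda>u. kahler_submodule F A +>\<^bsub>free_act_module F A (carrier A)\<^esub> u"
  show "h (?q x) = k (?q x)" if "x \<in> carrier (kahler F A)" for x
  proof (rule nonunital_module.quotient_hom_eqI[OF free_act_module kahler_submodule,
        of "\<lambda>x. h (?q x)" "\<lambda>x. k (?q x)"])
    show "x \<in> carrier (quotient_module (free_act_module F A (carrier A)) (kahler_submodule F A))"
      using that by (simp add: kahler_def)
    show "h (?q (?r u)) = k (?q (?r u))" if "u \<in> carrier (free_act_module F A (carrier A))" for u
    proof (rule nonunital_module.free_act_module_hom_eqI[OF P, of "\<lambda>u. h (?q (?r u))" "carrier A"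
          "\<lambda>u. k (?q (?r u))"])
      show "(\<lambda>u. h (?q (?r u))) \<in> act_hom F A (free_act_module F A (carrier A)) P"
        by (rule act_hom_comp[OF act_hom_comp[OF kahler_proj_hom omega_proj_hom] h])
      show "(\<lambda>u. k (?q (?r u))) \<in> act_hom F A (free_act_module F A (carrier A)) P"
        by (rule act_hom_comp[OF act_hom_comp[OF kahler_proj_hom omega_proj_hom] k])
    qed (use that eq in \<open>simp_all add: omega_d_def kahler_d_def\<close>)
  qed
qed

text \<open>The morphism from the free module with values \<open>D a\<close> descends twice:
  linearity and the Leibniz rule kill the relations of the Kaehler module, and then the rule for
  divided powers kills those of \<Omega>.\<close>

lemma omega_universal:
  assumes P: "nonunital_module F A P"
    and D: "\<And>a. a \<in> carrier A \<Longrightarrow> D a \<in> carrier P"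
      "\<And>a b r. \<lbrakk>a \<in> carrier A; b \<in> carrier A; r \<in> carrier F\<rbrakk> \<Longrightarrow>
        D (a \<oplus>\<^bsub>A\<^esub> r \<odot>\<^bsub>A\<^esub> b) = D a \<oplus>\<^bsub>P\<^esub> r \<odot>\<^bsub>P\<^esub> D b"
      "\<And>a b. \<lbrakk>a \<in> carrier A; b \<in> carrier A\<rbrakk> \<Longrightarrow>
        D (a \<otimes>\<^bsub>A\<^esub> b) = (a \<triangleright>\<^bsub>P\<^esub> D b) \<oplus>\<^bsub>P\<^esub> (b \<triangleright>\<^bsub>P\<^esub> D a)"
      "\<And>n a. \<lbrakk>n \<ge> 2; a \<in> carrier A\<rbrakk> \<Longrightarrow> D (\<gamma>\<^bsub>A\<^esub> n a) = \<gamma>\<^bsub>A\<^esub> (n - 1) a \<triangleright>\<^bsub>P\<^esub> D a"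
  obtains g where "g \<in> act_hom F A (omega F A) P"
    and "\<And>a. a \<in> carrier A \<Longrightarrow> g (omega_d F A a) = D a"
proof -
  let ?L = "free_act_module F A (carrier A)"
  interpret P: nonunital_module F A P by fact
  interpret L: nonunital_module F A ?L by (rule free_act_module)
  interpret K: nonunital_module F A "kahler F A" by (rule kahler_module)
  obtain h where h: "h \<in> act_hom F A ?L P"
    and hd: "\<And>a. a \<in> carrier A \<Longrightarrow> h (free_gen F A a) = D a"
    using P.free_act_module_universal[of "carrier A" D] D(1) by blast
  note h_simps = act_hom_add[OF h] act_hom_smult[OF h] act_hom_act[OF h] L.act_hom_minus[OF P h] hd
  have minus_self: "x \<ominus>\<^bsub>P\<^esub> x = \<zero>\<^bsub>P\<^esub>" if "x \<in> carrier P" for x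
    using that by (simp add: a_minus_def P.M.M.r_neg)
  \<comment> \<open>Each relation is a difference whose two terms have the same image, which is why
    \<open>minus_self\<close> closes the goal.\<close>
  have rel: "h u = \<zero>\<^bsub>P\<^esub>" if "u \<in> kahler_relations F A" for u
    using that D(1)
    by (auto simp: kahler_relations_def Let_def h_simps free_gen_closed D(2,3) minus_self)
  have "h u = \<zero>\<^bsub>P\<^esub>" if "u \<in> kahler_submodule F A" for u
    using L.generated_submodule_kernel[OF P h kahler_relations_closed rel] that
    by (simp add: kahler_submodule_def)
  then obtain k where k: "k \<in> act_hom F A (kahler F A) P"
    and kd: "\<And>u. u \<in> carrier ?L \<Longrightarrow> k (kahler_submodule F A +>\<^bsub>?L\<^esub> u) = h u"
    using L.quotient_universal[OF P h kahler_submodule] by (metis kahler_def)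
  have kd': "k (kahler_d F A a) = D a" if "a \<in> carrier A" for a
    using that by (simp add: kahler_d_def kd free_gen_closed hd)
  let ?S = "{kahler_d F A (\<gamma>\<^bsub>A\<^esub> n a) \<ominus>\<^bsub>kahler F A\<^esub> (\<gamma>\<^bsub>A\<^esub> (n - 1) a \<triangleright>\<^bsub>kahler F A\<^esub> kahler_d F A a) |n a.
        2 \<le> n \<and> a \<in> carrier A}"
  have S: "?S \<subseteq> carrier (kahler F A)"
    by (auto intro!: K.M.minus_closed K.act_closed kahler_d_closed)
  have "k x = \<zero>\<^bsub>P\<^esub>" if "x \<in> ?S" for x
    using that D(1)
    by (auto simp: K.act_hom_minus[OF P k] act_hom_act[OF k] kahler_d_closed kd' D(4)
        minus_self)
  then have "k x = \<zero>\<^bsub>P\<^esub>" if "x \<in> omega_submodule F A" for x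
    using K.generated_submodule_kernel[OF P k S] that by (simp add: omega_submodule_def)
  then obtain g where g: "g \<in> act_hom F A (omega F A) P"
    and gd: "\<And>x. x \<in> carrier (kahler F A) \<Longrightarrow> g (omega_submodule F A +>\<^bsub>kahler F A\<^esub> x) = k x"
    using K.quotient_universal[OF P k omega_submodule] by (metis omega_def)
  show ?thesis
    by (rule that[OF g]) (simp add: omega_d_def gd kahler_d_closed kd')
qed

end

section \<open>The geometric tangent structure\<close>

context divided_power_algebra
begin

text \<open>Makes \<open>A\<close> a divided power algebra over itself, the target object for the
  adjunction.\<close>

lemma id_dp_hom: "(\<lambda>a. a) \<in> dp_hom F A A"
  by (simp add: dp_hom_def)

text \<open>This is the adjunct of \<open>v\<close>. Since \<open>v\<close> retracts the base map, a
  product of a base element \<open>a\<close> and a generator goes to \<open>a\<close> times the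
  image of the generator, so the action becomes multiplication in \<open>A\<close>.\<close>

lemma geometric_vector_field_act_hom:
  assumes v: "v \<in> geometric_vector_fields F A"
  shows "(\<lambda>x. v (gamma_gen F A (omega F A) x)) \<in> act_hom F A (omega F A) (self_module A)"
proof -
  interpret G: gamma_data F A "omega F A"
    by (intro gamma_data.intro divided_power_algebra_axioms omega_module)
  have hom: "v \<in> dp_hom F (cotangent F A) A"
    and base: "\<And>a. a \<in> carrier A \<Longrightarrow> v (cotangent_base F A a) = a"
    using v by (simp_all add: geometric_vector_fields_def)
  have basec: "cotangent_base F A a \<in> carrier (cotangent F A)" if "a \<in> carrier A" for a
    using G.gamma_base_hom that by (auto simp: dp_hom_def)
  show ?thesis
    using hom by (intro act_homI)
      (auto simp: dp_hom_def G.gamma_gen_closed G.gamma_gen_add G.gamma_gen_smult G.gamma_gen_act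
        basec base)
qed

text \<open>Composing the universal differential with the adjunct of \<open>v\<close> gives a
  derivation; the relation of \<Omega> in degree \<open>p\<close> gives the special
  condition.\<close>

lemma geometric_vector_field_derivation:
  assumes p: "characteristic F = p" "p > 0" and v: "v \<in> geometric_vector_fields F A"
  shows "(\<lambda>a\<in>carrier A. v (cotangent_d F A a)) \<in> special_inner_derivations p F A"
proof -
  interpret O: nonunital_module F A "omega F A" by (rule omega_module)
  define g where "g = (\<lambda>x. v (gamma_gen F A (omega F A) x))"
  have g: "g \<in> act_hom F A (omega F A) (self_module A)"
    using geometric_vector_field_act_hom[OF v] by (simp add: g_def)
  define D where "D = (\<lambda>a. g (omega_d F A a))"
  have Dc [simp]: "D a \<in> carrier A" if "a \<in> carrier A" for a
    using act_hom_closed[OF g omega_d_closed[OF that]] by (simp add: D_def)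
  have lin: "D (a \<oplus>\<^bsub>A\<^esub> r \<odot>\<^bsub>A\<^esub> b) = D a \<oplus>\<^bsub>A\<^esub> r \<odot>\<^bsub>A\<^esub> D b"
    if "a \<in> carrier A" "b \<in> carrier A" "r \<in> carrier F" for a b r
    using that
    by (simp add: D_def omega_d_linear omega_d_closed act_hom_add[OF g] act_hom_smult[OF g])
  \<comment> \<open>The combined linearity relation is split: \<open>r = 1\<close> gives additivity,
    hence \<open>D\<close> vanishes at zero, and then \<open>a = 0\<close> gives
    homogeneity.\<close>
  have add: "D (a \<oplus>\<^bsub>A\<^esub> b) = D a \<oplus>\<^bsub>A\<^esub> D b" if "a \<in> carrier A" "b \<in> carrier A" for a b
    using lin[OF that R.one_closed] that by simp
  have "D \<zero>\<^bsub>A\<^esub> = D \<zero>\<^bsub>A\<^esub> \<oplus>\<^bsub>A\<^esub> D \<zero>\<^bsub>A\<^esub>"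
    using add[of "\<zero>\<^bsub>A\<^esub>" "\<zero>\<^bsub>A\<^esub>"] by simp
  then have zero: "D \<zero>\<^bsub>A\<^esub> = \<zero>\<^bsub>A\<^esub>"
    using M.add.l_cancel_one'[of "D \<zero>\<^bsub>A\<^esub>" "D \<zero>\<^bsub>A\<^esub>"] by simp
  have smult: "D (r \<odot>\<^bsub>A\<^esub> a) = r \<odot>\<^bsub>A\<^esub> D a" if "r \<in> carrier F" "a \<in> carrier A" for r a
    using lin[of "\<zero>\<^bsub>A\<^esub>" a r] that by (simp add: zero)
  have mult: "D (a \<otimes>\<^bsub>A\<^esub> b) = a \<otimes>\<^bsub>A\<^esub> D b \<oplus>\<^bsub>A\<^esub> b \<otimes>\<^bsub>A\<^esub> D a" if "a \<in> carrier A" "b \<in> carrier A" for a b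
    using that by (simp add: D_def omega_d_mult omega_d_closed act_hom_add[OF g] act_hom_act[OF g])
  have p2: "p \<ge> 2"
    using prime_characteristic p prime_ge_2_nat by simp
  \<comment> \<open>The relation yields the factor \<open>\<gamma> (p - 1) a\<close>;
    \<open>dpl_eq_minus_npow\<close>, a form of Wilson's theorem, turns it into minus the power of
    \<open>a\<close> with \<open>p - 1\<close> factors.\<close>
  have dp: "D (\<gamma>\<^bsub>A\<^esub> p a) = \<ominus>\<^bsub>A\<^esub> (npow A a (p - 1) \<otimes>\<^bsub>A\<^esub> D a)" if "a \<in> carrier A" for a
  proof -
    have "D (\<gamma>\<^bsub>A\<^esub> p a) = \<gamma>\<^bsub>A\<^esub> (p - 1) a \<otimes>\<^bsub>A\<^esub> D a"
      using that p2 by (simp add: D_def omega_d_dp omega_d_closed act_hom_act[OF g])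
    then show ?thesis
      using that p2 dpl_eq_minus_npow[OF p that Dc[OF that]] by (simp add: dpl_def)
  qed
  have "(\<lambda>a\<in>carrier A. v (cotangent_d F A a)) = restrict D (carrier A)"
    by (simp add: D_def g_def)
  then show ?thesis
    using p by (simp add: special_inner_derivations_def add smult mult dp)
qed

lemma geometric_vector_fields_bij:
  assumes p: "characteristic F = p" "p > 0"
  shows "bij_betw (\<lambda>v. \<lambda>a\<in>carrier A. v (cotangent_d F A a))
    (geometric_vector_fields F A) (special_inner_derivations p F A)"
proof (rule bij_betwI')
  interpret G: gamma_data F A "omega F A"
    by (intro gamma_data.intro divided_power_algebra_axioms omega_module)
  \<comment> \<open>The adjunction with target \<open>A\<close> and the identity as base map: the
    condition on base elements says precisely that \<open>v\<close> is a retraction.\<close>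
  have univ: "\<exists>!v. v \<in> geometric_vector_fields F A \<and>
      (\<forall>x\<in>carrier (omega F A). v (gamma_gen F A (omega F A) x) = g x)"
    if g: "g \<in> act_hom F A (omega F A) (self_module A)" for g
    using G.gamma_universal[OF divided_power_algebra_axioms id_dp_hom, of g] g
    by (simp add: act_hom_def geometric_vector_fields_def conj_ac)
  show "((\<lambda>a\<in>carrier A. v (cotangent_d F A a)) = (\<lambda>a\<in>carrier A. w (cotangent_d F A a)))
      \<longleftrightarrow> v = w"
    if v: "v \<in> geometric_vector_fields F A" and w: "w \<in> geometric_vector_fields F A" for v w
  proof
    assume eq: "(\<lambda>a\<in>carrier A. v (cotangent_d F A a)) = (\<lambda>a\<in>carrier A. w (cotangent_d F A a))"
    have d: "v (cotangent_d F A a) = w (cotangent_d F A a)" if "a \<in> carrier A" for a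
      using fun_cong[OF eq, of a] that by simp
    \<comment> \<open>Agreement on differentials extends to all of \<Omega>, and then the uniqueness
      in \<open>univ\<close> identifies the two vector fields.\<close>
    have "v (gamma_gen F A (omega F A) x) = w (gamma_gen F A (omega F A) x)"
      if "x \<in> carrier (omega F A)" for x
      by (rule omega_hom_eqI[OF self_module geometric_vector_field_act_hom[OF v]
            geometric_vector_field_act_hom[OF w] d that])
    then show "v = w"
      using univ[OF geometric_vector_field_act_hom[OF w]] v w by blast
  qed simp
  show "(\<lambda>a\<in>carrier A. v (cotangent_d F A a)) \<in> special_inner_derivations p F A"
    if "v \<in> geometric_vector_fields F A" for v
    using p that by (rule geometric_vector_field_derivation)
  show "\<exists>v\<in>geometric_vector_fields F A. D = (\<lambda>a\<in>carrier A. v (cotangent_d F A a))"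
    if D: "D \<in> special_inner_derivations p F A" for D
  proof -
    have Dc: "D a \<in> carrier A" if "a \<in> carrier A" for a
      using D that by (auto simp: special_inner_derivations_def)
    obtain g where g: "g \<in> act_hom F A (omega F A) (self_module A)"
      and gd: "\<And>a. a \<in> carrier A \<Longrightarrow> g (omega_d F A a) = D a"
    proof (rule omega_universal[OF self_module, of D])
      \<comment> \<open>\<Omega> imposes relations in all degrees \<open>n \<ge> 2\<close>, whereas
        \<open>D\<close> is constrained in degree \<open>p\<close> alone; the algebraic tangent
        structure supplies the rest.\<close>
      show "D (\<gamma>\<^bsub>A\<^esub> n a) = \<gamma>\<^bsub>A\<^esub> (n - 1) a \<triangleright>\<^bsub>self_module A\<^esub> D a" if "n \<ge> 2" "a \<in> carrier A" for n a
        using special_inner_derivation_dp[OF divided_power_algebra_axioms p D that] by simp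
    qed (use D Dc in \<open>auto simp: special_inner_derivations_def\<close>)
    obtain v where v: "v \<in> geometric_vector_fields F A"
      and vg: "\<And>x. x \<in> carrier (omega F A) \<Longrightarrow> v (gamma_gen F A (omega F A) x) = g x"
      using univ[OF g] by blast
    have "D = (\<lambda>a\<in>carrier A. v (cotangent_d F A a))"
      using D by (auto simp: fun_eq_iff vg gd omega_d_closed special_inner_derivations_def
          PiE_def extensional_def)
    then show ?thesis using v by blast
  qed
qed

end

theorem proposition3:
  fixes F :: "('f, 'k) ring_scheme"
    and A :: "('f, 'a, 'u) dp_algebra_scheme"
    and p :: nat
  assumes "field F" and "characteristic F = p" and "p > 0"
    and "divided_power_algebra F A"
  shows "bij_betw (\<lambda>v. \<lambda>a\<in>carrier A. snd (v a))
           (algebraic_vector_fields p F A) (special_inner_derivations p F A) \<and>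
         bij_betw (\<lambda>v. \<lambda>a\<in>carrier A. v (cotangent_d F A a))
           (geometric_vector_fields F A) (special_inner_derivations p F A)"
  using algebraic_vector_fields_bij[OF assms(4,2,3)]
    divided_power_algebra.geometric_vector_fields_bij[OF assms(4,2,3)] by simp

end
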